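(* Let $n\ge1$ and $w\in S_n$. Then \[\mathfrak{S}_w=\sum_{\mathcal{B}\in\mathsf{BPD}(w)}\mathfrak{G}_{\delta(\check{\mathcal{B}})}.\]
   Context: $S_n$ is the symmetric group, $s_i=(i\ i+1)$, $w_0=n\,n-1\cdots1$. Schubert polynomials: $\mathfrak{S}_{w_0}=x_1^{n-1}x_2^{n-2}\cdots x_{n-1}$ and $\mathfrak{S}_{ws_i}=N_i(\mathfrak{S}_w)$ whenever $w(i)>w(i+1)$, where $N_i(f)=(f-s_i\cdot f)/(x_i-x_{i+1})$. Grothendieck polynomials: $\mathfrak{G}_{w_0}=x_1^{n-1}\cdots x_{n-1}$ and $\mathfrak{G}_{ws_i}=N_i((1-x_{i+1})\mathfrak{G}_w)$ whenever $w(i)>w(i+1)$. A bumpless pipe dream (BPD) of size $n$ is a tiling of the $n\times n$ grid by six tile types: an elbow joining bottom and right edges; an elbow joining top and left edges; horizontal; vertical; crossing; blank; such that the segments form $n$ pipes, each entering through the bottom edge of a column and leaving through the right edge of a row (travelling north/east). Label pipes $1,\dots,n$ by entry column; at a crossing the larger incoming label (from below/left) exits through the top and the smaller through the right; $\delta(\mathcal{B})(r)$ is the label leaving row $r$ on the right. A BPD is reduced if each pair of pipes crosses at most once; $\mathsf{BPD}(w)$ is the set of reduced BPDs of size $n$ with $\delta(\mathcal{B})=w$. A co-BPD of size $n$ is a tiling of the $n\times n$ grid by: elbow joining top and right edges; elbow joining bottom and left edges; crossing; blank; horizontal; vertical; forming $n$ pipes each entering through the top edge of a column and leaving through the right edge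 of a row. Label pipes by entry column; at a crossing the larger incoming label (from above/left) exits through the bottom, the smaller through the right; $\delta$ of a co-BPD is read on the right edge from top to bottom. For a BPD $\mathcal{B}$, $\check{\mathcal{B}}$ is the co-BPD obtained tile by tile: bottom–right elbow $\mapsto$ top–right elbow; top–left elbow $\mapsto$ bottom–left elbow; horizontal $\mapsto$ crossing; vertical $\mapsto$ blank; crossing $\mapsto$ horizontal; blank $\mapsto$ vertical. *)

theory Defs
  imports "HOL-Library.Poly_Mapping" "HOL-Library.FuncSet" "HOL-Combinatorics.Permutations"
begin

section \<open>Schubert and Grothendieck polynomials\<close>

text \<open>
  Integer polynomials in \<open>x\<^sub>1, x\<^sub>2, \<dots>\<close> are finitely supported maps from monomials, i.e. exponent
  vectors, to coefficients. Elements of $S_n$ are functions on \<^typ>\<open>nat\<close> that permute \<open>{1..n}\<close>,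
  and \<open>w s\<^sub>i\<close> is \<open>w \<circ> transpose i (i + 1)\<close>.
\<close>

type_synonym ipoly = "(nat \<Rightarrow>\<^sub>0 nat) \<Rightarrow>\<^sub>0 int"

definition X :: "nat \<Rightarrow> ipoly" where
  "X i = Poly_Mapping.single (Poly_Mapping.single i 1) 1"

text \<open>
  \<^const>\<open>Poly_Mapping.map_key\<close> is precomposition on keys; as \<open>s\<^sub>i\<close> is an involution, this is the
  exchange of the variables \<open>x\<^sub>i\<close> and \<open>x\<^bsub>i+1\<^esub>\<close>.
\<close>

definition swap_vars :: "nat \<Rightarrow> ipoly \<Rightarrow> ipoly" where
  "swap_vars i = Poly_Mapping.map_key (Poly_Mapping.map_key (transpose i (i + 1)))"

text \<open>The exact quotient \<open>(f - s\<^sub>i f) / (x\<^sub>i - x\<^bsub>i+1\<^esub>)\<close> in the integral domain \<^typ>\<open>ipoly\<close>.\<close>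

definition divided_difference :: "nat \<Rightarrow> ipoly \<Rightarrow> ipoly" where
  "divided_difference i f = (THE g. (X i - X (i + 1)) * g = f - swap_vars i f)"

definition longest_perm :: "nat \<Rightarrow> nat \<Rightarrow> nat" where
  "longest_perm n = (\<lambda>i. if i \<in> {1..n} then n + 1 - i else i)"

definition staircase :: "nat \<Rightarrow> ipoly" where
  "staircase n = (\<Prod>i = 1..n. X i ^ (n - i))"

text \<open>
  The defining rules produce a polynomial along every descending chain of \<open>S\<^sub>n\<close> starting at the
  longest element. Both families of operators satisfy the braid relations, so the result depends
  only on the permutation reached.
\<close>

inductive is_schubert :: "nat \<Rightarrow> (nat \<Rightarrow> nat) \<Rightarrow> ipoly \<Rightarrow> bool" for n where
  longest: "is_schubert n (longest_perm n) (staircase n)"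
| descend: "is_schubert n (w \<circ> transpose i (i + 1)) (divided_difference i f)"
    if "is_schubert n w f" "1 \<le> i" "i < n" "w i > w (i + 1)"

inductive is_grothendieck :: "nat \<Rightarrow> (nat \<Rightarrow> nat) \<Rightarrow> ipoly \<Rightarrow> bool" for n where
  longest: "is_grothendieck n (longest_perm n) (staircase n)"
| descend: "is_grothendieck n (w \<circ> transpose i (i + 1)) (divided_difference i ((1 - X (i + 1)) * f))"
    if "is_grothendieck n w f" "1 \<le> i" "i < n" "w i > w (i + 1)"

definition schubert :: "nat \<Rightarrow> (nat \<Rightarrow> nat) \<Rightarrow> ipoly" where
  "schubert n w = (THE f. is_schubert n w f)"

definition grothendieck :: "nat \<Rightarrow> (nat \<Rightarrow> nat) \<Rightarrow> ipoly" where
  "grothendieck n w = (THE f. is_grothendieck n w f)"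


section \<open>Tilings\<close>

datatype edge = Top | Bottom | Left | Right

datatype tile =
    Elbow_BR | Elbow_TL  \<comment> \<open>only in bumpless pipe dreams\<close>
  | Elbow_TR | Elbow_BL  \<comment> \<open>only in co-bumpless pipe dreams\<close>
  | Horizontal | Vertical | Crossing | Blank

primrec tile_edges :: "tile \<Rightarrow> edge set" where
  "tile_edges Elbow_BR = {Bottom, Right}"
| "tile_edges Elbow_TL = {Top, Left}"
| "tile_edges Elbow_TR = {Top, Right}"
| "tile_edges Elbow_BL = {Bottom, Left}"
| "tile_edges Horizontal = {Left, Right}"
| "tile_edges Vertical = {Top, Bottom}"
| "tile_edges Crossing = {Top, Bottom, Left, Right}"
| "tile_edges Blank = {}"

text \<open>
  Cells are matrix coordinates \<open>(r, c)\<close>: row \<open>r\<close> counted from the top, column \<open>c\<close> from the left.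
  Tilings are extensional functions on the grid, so that there are finitely many of them.
\<close>

definition grid :: "nat \<Rightarrow> (nat \<times> nat) set" where
  "grid n = {1..n} \<times> {1..n}"

text \<open>
  Segments form pipes iff neighbouring tiles agree on their common edge. All pipes then move
  monotonically towards their exit side, hence there are no closed loops, and they are \<open>n\<close> pipes
  with the prescribed ends iff the edges on the boundary of the grid which carry a segment are
  exactly all those on the entry side and all those on the right.
\<close>

definition pipes_match :: "nat \<Rightarrow> (nat \<times> nat \<Rightarrow> tile) \<Rightarrow> bool" where
  "pipes_match n T \<longleftrightarrow>
     (\<forall>r\<in>{1..n}. \<forall>c\<in>{1..<n}. Right \<in> tile_edges (T (r, c)) \<longleftrightarrow> Left \<in> tile_edges (T (r, c + 1))) \<and>
     (\<forall>r\<in>{1..<n}. \<forall>c\<in>{1..n}. Bottom \<in> tile_edges (T (r, c)) \<longleftrightarrow> Top \<in> tile_edges (T (r + 1, c))) \<and>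
     (\<forall>r\<in>{1..n}. Left \<notin> tile_edges (T (r, 1)) \<and> Right \<in> tile_edges (T (r, n)))"

definition is_bpd :: "nat \<Rightarrow> (nat \<times> nat \<Rightarrow> tile) \<Rightarrow> bool" where
  "is_bpd n T \<longleftrightarrow>
     T \<in> grid n \<rightarrow>\<^sub>E {Elbow_BR, Elbow_TL, Horizontal, Vertical, Crossing, Blank} \<and>
     pipes_match n T \<and>
     (\<forall>c\<in>{1..n}. Top \<notin> tile_edges (T (1, c)) \<and> Bottom \<in> tile_edges (T (n, c)))"

definition is_cobpd :: "nat \<Rightarrow> (nat \<times> nat \<Rightarrow> tile) \<Rightarrow> bool" where
  "is_cobpd n T \<longleftrightarrow>
     T \<in> grid n \<rightarrow>\<^sub>E {Elbow_TR, Elbow_BL, Horizontal, Vertical, Crossing, Blank} \<and>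
     pipes_match n T \<and>
     (\<forall>c\<in>{1..n}. Top \<in> tile_edges (T (1, c)) \<and> Bottom \<notin> tile_edges (T (n, c)))"


section \<open>Labels of pipes\<close>

text \<open>
  A crossing rule maps the two labels entering a crossing, the one from the left first, to the
  labels leaving it through the vertical exit (top for BPDs, bottom for co-BPDs) and through the
  right edge. Pipes as curves go straight; labels are sorted. The label \<open>0\<close> marks an edge without
  a pipe.
\<close>

type_synonym crossing_rule = "nat \<times> nat \<Rightarrow> nat \<times> nat"

definition go_straight :: crossing_rule where
  "go_straight = (\<lambda>(l, v). (v, l))"

definition sort_labels :: crossing_rule where
  "sort_labels = (\<lambda>(l, v). (max l v, min l v))"

text \<open>
  From the labels entering a tile (left, vertical) to those leaving it (vertical, right). Pipes
  enter vertically from below in a BPD and from above in a co-BPD; up to this reflection the two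
  kinds of tiles behave alike.
\<close>

primrec tile_exit :: "crossing_rule \<Rightarrow> tile \<Rightarrow> nat \<times> nat \<Rightarrow> nat \<times> nat" where
  "tile_exit \<chi> Elbow_BR p = (0, snd p)"
| "tile_exit \<chi> Elbow_TL p = (fst p, 0)"
| "tile_exit \<chi> Elbow_TR p = (0, snd p)"
| "tile_exit \<chi> Elbow_BL p = (fst p, 0)"
| "tile_exit \<chi> Horizontal p = (0, fst p)"
| "tile_exit \<chi> Vertical p = (snd p, 0)"
| "tile_exit \<chi> Crossing p = \<chi> p"
| "tile_exit \<chi> Blank p = (0, 0)"

text \<open>The labels entering the cell \<open>(r, c)\<close> of a BPD from the left and from below.\<close>

function bpd_in :: "crossing_rule \<Rightarrow> nat \<Rightarrow> (nat \<times> nat \<Rightarrow> tile) \<Rightarrow> nat \<Rightarrow> nat \<Rightarrow> nat \<times> nat" where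
  "bpd_in \<chi> n T r c =
     (if c \<le> 1 then 0 else snd (tile_exit \<chi> (T (r, c - 1)) (bpd_in \<chi> n T r (c - 1))),
      if n \<le> r then c else fst (tile_exit \<chi> (T (r + 1, c)) (bpd_in \<chi> n T (r + 1) c)))"
  by pat_completeness auto
termination
  by (relation "measure (\<lambda>(\<chi>, n, T, r, c). (n - r) + c)") auto

text \<open>The labels entering the cell \<open>(r, c)\<close> of a co-BPD from the left and from above.\<close>

function cobpd_in :: "crossing_rule \<Rightarrow> (nat \<times> nat \<Rightarrow> tile) \<Rightarrow> nat \<Rightarrow> nat \<Rightarrow> nat \<times> nat" where
  "cobpd_in \<chi> T r c =
     (if c \<le> 1 then 0 else snd (tile_exit \<chi> (T (r, c - 1)) (cobpd_in \<chi> T r (c - 1))),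
      if r \<le> 1 then c else fst (tile_exit \<chi> (T (r - 1, c)) (cobpd_in \<chi> T (r - 1) c)))"
  by pat_completeness auto
termination
  by (relation "measure (\<lambda>(\<chi>, T, r, c). r + c)") auto

declare bpd_in.simps [simp del] cobpd_in.simps [simp del]

definition bpd_perm :: "nat \<Rightarrow> (nat \<times> nat \<Rightarrow> tile) \<Rightarrow> nat \<Rightarrow> nat" where
  "bpd_perm n T = (\<lambda>r. if r \<in> {1..n}
     then snd (tile_exit sort_labels (T (r, n)) (bpd_in sort_labels n T r n)) else r)"

definition cobpd_perm :: "nat \<Rightarrow> (nat \<times> nat \<Rightarrow> tile) \<Rightarrow> nat \<Rightarrow> nat" where
  "cobpd_perm n T = (\<lambda>r. if r \<in> {1..n}
     then snd (tile_exit sort_labels (T (r, n)) (cobpd_in sort_labels T r n)) else r)"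

text \<open>
  The cells at which the pipes entering at columns \<open>a\<close> and \<open>b\<close> cross. Here pipes are followed
  straight through crossings: with sorted labels the same two labels would never cross twice.
\<close>

definition crossings :: "nat \<Rightarrow> (nat \<times> nat \<Rightarrow> tile) \<Rightarrow> nat \<Rightarrow> nat \<Rightarrow> (nat \<times> nat) set" where
  "crossings n T a b =
     {(r, c) \<in> grid n. T (r, c) = Crossing \<and> bpd_in go_straight n T r c \<in> {(a, b), (b, a)}}"

definition reduced :: "nat \<Rightarrow> (nat \<times> nat \<Rightarrow> tile) \<Rightarrow> bool" where
  "reduced n T \<longleftrightarrow> (\<forall>a\<in>{1..n}. \<forall>b\<in>{1..n}. a \<noteq> b \<longrightarrow> card (crossings n T a b) \<le> 1)"

definition BPD :: "nat \<Rightarrow> (nat \<Rightarrow> nat) \<Rightarrow> (nat \<times> nat \<Rightarrow> tile) set" where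
  "BPD n w = {T. is_bpd n T \<and> reduced n T \<and> bpd_perm n T = w}"


section \<open>From BPDs to co-BPDs\<close>

text \<open>Only the six BPD tiles matter; the other two are sent back, making the map an involution.\<close>

primrec check_tile :: "tile \<Rightarrow> tile" where
  "check_tile Elbow_BR = Elbow_TR"
| "check_tile Elbow_TL = Elbow_BL"
| "check_tile Elbow_TR = Elbow_BR"
| "check_tile Elbow_BL = Elbow_TL"
| "check_tile Horizontal = Crossing"
| "check_tile Vertical = Blank"
| "check_tile Crossing = Horizontal"
| "check_tile Blank = Vertical"

definition check :: "nat \<Rightarrow> (nat \<times> nat \<Rightarrow> tile) \<Rightarrow> nat \<times> nat \<Rightarrow> tile" where
  "check n T = restrict (\<lambda>p. check_tile (T p)) (grid n)"

lemma tile_edges_check_tile: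
  "Left \<in> tile_edges (check_tile t) \<longleftrightarrow> Left \<in> tile_edges t"
  "Right \<in> tile_edges (check_tile t) \<longleftrightarrow> Right \<in> tile_edges t"
  "Top \<in> tile_edges (check_tile t) \<longleftrightarrow> Top \<notin> tile_edges t"
  "Bottom \<in> tile_edges (check_tile t) \<longleftrightarrow> Bottom \<notin> tile_edges t"
  by (cases t; simp)+

lemma is_cobpd_check:
  assumes "is_bpd n T"
  shows "is_cobpd n (check n T)"
proof -
  have app: "check n T (r, c) = check_tile (T (r, c))" if "r \<in> {1..n}" "c \<in> {1..n}" for r c
    using that by (simp add: check_def grid_def)
  have T: "T p \<in> {Elbow_BR, Elbow_TL, Horizontal, Vertical, Crossing, Blank}" if "p \<in> grid n" for p
    using assms that unfolding is_bpd_def by (meson PiE_mem)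
  have "check n T \<in> grid n \<rightarrow>\<^sub>E {Elbow_TR, Elbow_BL, Horizontal, Vertical, Crossing, Blank}"
    unfolding check_def using T by (intro restrict_PiE_iff[THEN iffD2] ballI) fastforce
  then show ?thesis
    using assms by (auto simp: is_bpd_def is_cobpd_def pipes_match_def app tile_edges_check_tile)
qed

lemma finite_BPD: "finite (BPD n w)"
proof (rule finite_subset)
  show "BPD n w \<subseteq> grid n \<rightarrow>\<^sub>E {Elbow_BR, Elbow_TL, Horizontal, Vertical, Crossing, Blank}"
    by (auto simp: BPD_def is_bpd_def)
  show "finite (grid n \<rightarrow>\<^sub>E {Elbow_BR, Elbow_TL, Horizontal, Vertical, Crossing, Blank})"
    by (intro finite_PiE) (auto simp: grid_def)
qed

end

theory Submission
  imports Defs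
begin

text \<open>
  Label the pipes of a bumpless pipe dream by their exit rows and cut it into rows. Read from the top,
  the co-BPD applies to the staircase monomial one isobaric operator \<open>\<pi>\<^bsub>j\<^esub> f = \<partial>\<^bsub>j\<^esub> ((1 - x\<^bsub>j+1\<^esub>) f)\<close> for
  every horizontal tile of the BPD, so the sum over all stacks of \<open>r\<close> rows with a given word of
  labels at the bottom can be computed row by row. It equals \<open>\<partial>\<^bsub>v\<^esub> G\<^bsub>u\<^esub>\<close>, where \<open>u\<close> lists the occupied
  columns decreasingly and then the free ones decreasingly, and \<open>v\<close> sorts the labels; for
  \<open>r = n\<close> this is the Schubert polynomial.

  The induction on \<open>r\<close> has two parts. Exchanging two consecutive labels below a row corresponds to
  \<open>\<partial>\<^bsub>i\<^esub>\<close>, because the terms in which the two pipes cross in that row are killed by \<open>\<partial>\<^bsub>i\<^esub>\<close>. This leaves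
  the case in which all labels but the new one are sorted. It is an identity between products of
  the operators, proved column by column from
  \<open>\<partial>\<^bsub>i\<^esub> \<pi>\<^bsub>i+1\<^esub> = \<pi>\<^bsub>i\<^esub> \<partial>\<^bsub>i+1\<^esub> + \<partial>\<^bsub>i\<^esub>\<close>, \<open>\<partial>\<^bsub>i+1\<^esub> \<partial>\<^bsub>i\<^esub> \<pi>\<^bsub>i+1\<^esub> = \<pi>\<^bsub>i\<^esub> \<partial>\<^bsub>i+1\<^esub> \<partial>\<^bsub>i\<^esub>\<close> and \<open>\<partial>\<^bsub>i\<^esub> \<pi>\<^bsub>i+1\<^esub> \<pi>\<^bsub>i\<^esub> = \<pi>\<^bsub>i+1\<^esub> \<pi>\<^bsub>i\<^esub> \<partial>\<^bsub>i+1\<^esub>\<close>.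
\<close>

subsection \<open>Divided differences\<close>

text \<open>Being reduced is a global condition, which stands in the way of summing row by row. With
  pipes named by their exit rows it becomes local: at every crossing the vertical pipe has the
  smaller label. Planarity justifies this, by way of the analogous condition on entry columns. On
  the other side the co-BPD may cross the same pipes repeatedly. Its rule of sorting labels is the
  0-Hecke action; as the idempotent \<open>\<pi> j\<close> fixes a Grothendieck polynomial at an
  ascent, every crossing may be read as an application of \<open>\<pi> j\<close>. Words run from
  right to left because the co-BPD then starts from the word n, ..., 1 of w_0, and the index j of a
  crossing is one more than the number of pipes already gone plus the number entering from above to
  its right. The induction over rows needs all words of labels. The value at an unsorted word is
  described by a descending chain from the sorted one, and the exchange property makes it
  independent of the chain.\<close>

lemma swap_vars_Suc: "swap_vars i = Poly_Mapping.map_key (Poly_Mapping.map_key (transpose i (Suc i)))"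
  by (simp add: swap_vars_def)

lemma inj_map_key_transpose:
  "inj (Poly_Mapping.map_key (transpose i (Suc i)) :: (nat \<Rightarrow>\<^sub>0 nat) \<Rightarrow> _)"
  by (rule inj_on_inverseI[where g = "Poly_Mapping.map_key (transpose i (Suc i))"])
    (simp add: map_key_compose comp_def map_key_id)

lemma map_key_transpose_twice [simp]:
  "Poly_Mapping.map_key (transpose i (Suc i)) (Poly_Mapping.map_key (transpose i (Suc i)) m) = m"
  by (simp add: map_key_compose comp_def map_key_id)

lemma swap_vars_add: "swap_vars i (f + g) = swap_vars i f + swap_vars i g"
  unfolding swap_vars_Suc by (rule map_key_plus[OF inj_map_key_transpose])

lemma swap_vars_0 [simp]: "swap_vars i 0 = 0"
  unfolding swap_vars_Suc by (rule map_key_zero[OF inj_map_key_transpose])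

lemma swap_vars_diff: "swap_vars i (f - g) = swap_vars i f - swap_vars i g"
  by (metis swap_vars_add add_diff_cancel_right' diff_add_cancel)

lemma swap_vars_single:
  "swap_vars i (Poly_Mapping.single m c)
   = Poly_Mapping.single (Poly_Mapping.map_key (transpose i (Suc i)) m) c"
  using map_key_single[OF inj_map_key_transpose, of i "Poly_Mapping.map_key (transpose i (Suc i)) m" c]
  unfolding swap_vars_Suc map_key_transpose_twice .

lemma swap_vars_swap_vars [simp]: "swap_vars i (swap_vars i f) = f"
  unfolding swap_vars_Suc
  by (simp add: map_key_compose[OF inj_map_key_transpose inj_map_key_transpose] comp_def map_key_id)

lemma ipoly_induct [case_names zero monomial diff]:
  fixes f :: ipoly
  assumes "P 0" "\<And>m. P (Poly_Mapping.single m 1)" "\<And>f g. P f \<Longrightarrow> P g \<Longrightarrow> P (f - g)"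
  shows "P f"
proof (rule frag_induction[of f UNIV])
qed (use assms in auto)

lemma swap_vars_mult: "swap_vars i (f * g) = swap_vars i f * swap_vars i g"
proof (induction f rule: ipoly_induct)
  case (monomial m)
  show ?case
  proof (induction g rule: ipoly_induct)
    case (monomial m')
    show ?case
      by (simp add: mult_single swap_vars_single map_key_plus)
  qed (simp_all add: algebra_simps swap_vars_diff)
qed (simp_all add: algebra_simps swap_vars_diff)

lemma swap_vars_1 [simp]: "swap_vars i 1 = 1"
  by (simp flip: single_one add: swap_vars_single)

lemma swap_vars_power: "swap_vars i (f ^ k) = swap_vars i f ^ k"
  by (induction k) (simp_all add: swap_vars_mult)

lemma swap_vars_X [simp]: "swap_vars i (X j) = X (transpose i (Suc i) j)"
proof -
  have "Poly_Mapping.map_key (transpose i (Suc i)) (Poly_Mapping.single j 1)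
      = (Poly_Mapping.single (transpose i (Suc i) j) 1 :: nat \<Rightarrow>\<^sub>0 nat)"
    using map_key_single[of "transpose i (Suc i)" "transpose i (Suc i) j" "1::nat"]
    by (simp del: One_nat_def)
  then show ?thesis
    unfolding X_def swap_vars_single by (simp del: One_nat_def)
qed

lemma X_inject [simp]: "X i = X j \<longleftrightarrow> i = j"
proof
  assume "X i = X j"
  then have "Poly_Mapping.single i (1::nat) = Poly_Mapping.single j 1"
    by (auto simp: X_def frag_of_eq)
  then show "i = j"
    by (metis lookup_single_eq lookup_single_not_eq zero_neq_one)
qed simp

text \<open>Linearity reduces this to monomials, and the twisted product rule fg - s(fg) = (f - sf)g
  + sf(g - sg) to powers of one variable. It makes the quotient in \<open>divided_difference\<close>
  exist.\<close>

lemma X_diff_dvd: "X i - X (Suc i) dvd f - swap_vars i f"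
proof (induction f rule: ipoly_induct)
  case zero
  then show ?case by simp
next
  case (diff f g)
  have "f - g - swap_vars i (f - g) = (f - swap_vars i f) - (g - swap_vars i g)"
    by (simp add: swap_vars_diff)
  with diff show ?case by (metis dvd_diff)
next
  case (monomial m)
  show ?case
  proof (induction m rule: update_induct)
    case const
    then show ?case by simp
  next
    case (update m j k)
    let ?A = "Poly_Mapping.single m 1 :: ipoly" and ?B = "Poly_Mapping.single (Poly_Mapping.single j k) 1 :: ipoly"
    have "Poly_Mapping.update j k m = m + Poly_Mapping.single j k"
      by (rule poly_mapping_eqI)
        (use update(1) in \<open>auto simp: lookup_update lookup_add lookup_single when_def in_keys_iff\<close>)
    then have AB: "Poly_Mapping.single (Poly_Mapping.update j k m) 1 = ?A * ?B"
      by (simp add: mult_single)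
    have B: "?B = X j ^ k"
    proof (induction k)
      case (Suc k)
      have "Poly_Mapping.single (Poly_Mapping.single j (Suc k)) 1 = X j * Poly_Mapping.single (Poly_Mapping.single j k) 1"
        by (simp only: X_def mult_single flip: single_add) simp
      with Suc show ?case by simp
    qed simp
    have "X j - swap_vars i (X j) \<in> {X i - X (Suc i), - (X i - X (Suc i)), 0}"
      by (auto simp: transpose_def)
    then have dvd_X: "X i - X (Suc i) dvd X j - swap_vars i (X j)"
      by (metis dvd_0_right dvd_minus_iff dvd_refl empty_iff insert_iff)
    have "X j - swap_vars i (X j) dvd X j ^ k - swap_vars i (X j) ^ k"
      by (metis dvd_triv_left power_diff_sumr2)
    with dvd_X have "X i - X (Suc i) dvd ?B - swap_vars i ?B"
      unfolding B swap_vars_power by (rule dvd_trans)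
    then have "X i - X (Suc i) dvd (?A - swap_vars i ?A) * ?B + swap_vars i ?A * (?B - swap_vars i ?B)"
      using update(3) by (intro dvd_add dvd_mult[of _ _ "swap_vars i ?A"] dvd_mult2[of _ _ ?B])
    then show ?case unfolding AB swap_vars_mult by (simp add: algebra_simps)
  qed
qed

abbreviation dd :: "nat \<Rightarrow> ipoly \<Rightarrow> ipoly" ("\<partial>") where
  "\<partial> \<equiv> divided_difference"

definition \<pi> :: "nat \<Rightarrow> ipoly \<Rightarrow> ipoly" where
  "\<pi> i f = \<partial> i ((1 - X (Suc i)) * f)"

lemma \<pi>_plus1: "\<partial> i ((1 - X (i + 1)) * f) = \<pi> i f"
  by (simp add: \<pi>_def)

text \<open>Cancellation in the domain \<open>ipoly\<close> resolves the definite
  description.\<close>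

lemma dd_eqI:
  assumes "(X i - X (Suc i)) * g = f - swap_vars i f"
  shows "\<partial> i f = g"
proof -
  have ne: "X i - X (Suc i) \<noteq> 0"
    by (simp add: right_minus_eq)
  have "g' = g" if "(X i - X (Suc i)) * g' = f - swap_vars i f" for g'
    using mult_left_cancel[OF ne, of g' g] unfolding that assms by (rule iffD1) (rule refl)
  with assms show ?thesis
    unfolding divided_difference_def Suc_eq_plus1 by (rule the_equality)
qed

lemma dd_mult: "(X i - X (Suc i)) * \<partial> i f = f - swap_vars i f"
proof -
  obtain g where "f - swap_vars i f = (X i - X (Suc i)) * g"
    using X_diff_dvd by (rule dvdE)
  then show ?thesis using dd_eqI[OF sym] by metis
qed

lemma swap_vars_eq: "swap_vars i f = f - (X i - X (Suc i)) * \<partial> i f"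
  unfolding dd_mult by simp

lemma dd_0 [simp]: "\<partial> i 0 = 0"
  by (rule dd_eqI) simp

lemma dd_add: "\<partial> i (f + g) = \<partial> i f + \<partial> i g"
  by (rule dd_eqI) (simp add: distrib_left dd_mult swap_vars_add)

lemma dd_diff: "\<partial> i (f - g) = \<partial> i f - \<partial> i g"
  by (rule dd_eqI) (simp add: right_diff_distrib dd_mult swap_vars_diff)

lemma dd_sum: "\<partial> i (sum f A) = (\<Sum>a\<in>A. \<partial> i (f a))"
  by (induction A rule: infinite_finite_induct) (simp_all add: dd_add)

lemma dd_Leibniz: "\<partial> i (f * g) = \<partial> i f * g + swap_vars i f * \<partial> i g"
proof (rule dd_eqI)
  have "(X i - X (Suc i)) * (\<partial> i f * g + swap_vars i f * \<partial> i g)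
      = ((X i - X (Suc i)) * \<partial> i f) * g + swap_vars i f * ((X i - X (Suc i)) * \<partial> i g)"
    by (simp add: algebra_simps)
  also have "\<dots> = f * g - swap_vars i (f * g)"
    unfolding dd_mult by (simp add: algebra_simps swap_vars_mult)
  finally show "(X i - X (Suc i)) * (\<partial> i f * g + swap_vars i f * \<partial> i g) = f * g - swap_vars i (f * g)" .
qed

lemma dd_eq_0_iff: "\<partial> i f = 0 \<longleftrightarrow> swap_vars i f = f"
proof
  show "\<partial> i f = 0 \<Longrightarrow> swap_vars i f = f"
    using swap_vars_eq[of i f] by simp
  show "swap_vars i f = f \<Longrightarrow> \<partial> i f = 0"
    by (rule dd_eqI) simp
qed

lemma swap_vars_dd [simp]: "swap_vars i (\<partial> i f) = \<partial> i f"
proof -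
  have "swap_vars i ((X i - X (Suc i)) * \<partial> i f) = swap_vars i (f - swap_vars i f)"
    by (simp add: dd_mult)
  then have "(X (Suc i) - X i) * swap_vars i (\<partial> i f) = swap_vars i f - f"
    by (simp only: swap_vars_mult swap_vars_diff swap_vars_X swap_vars_swap_vars
        transpose_apply_first transpose_apply_second)
  then have "- ((X (Suc i) - X i) * swap_vars i (\<partial> i f)) = f - swap_vars i f"
    by (simp only: minus_diff_eq)
  then have "(X i - X (Suc i)) * swap_vars i (\<partial> i f) = f - swap_vars i f"
    by (simp only: minus_diff_eq flip: mult_minus_left)
  then show ?thesis
    by (rule dd_eqI[symmetric])
qed

lemma dd_dd [simp]: "\<partial> i (\<partial> i f) = 0"
  by (simp add: dd_eq_0_iff)

lemma dd_mult_invariant: "\<partial> i f = 0 \<Longrightarrow> \<partial> i (f * g) = f * \<partial> i g"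
  by (simp add: dd_Leibniz dd_eq_0_iff)

lemma dd_1 [simp]: "\<partial> i 1 = 0"
  by (simp add: dd_eq_0_iff)

lemma dd_X [simp]: "\<partial> i (X i) = 1" "\<partial> i (X (Suc i)) = -1"
  by (rule dd_eqI; simp)+

lemma dd_X_other: "j \<noteq> i \<Longrightarrow> j \<noteq> Suc i \<Longrightarrow> \<partial> i (X j) = 0"
  by (simp add: dd_eq_0_iff)

lemma dd_power_other: "j \<noteq> i \<Longrightarrow> j \<noteq> Suc i \<Longrightarrow> \<partial> i (X j ^ k) = 0"
  by (simp add: dd_eq_0_iff swap_vars_power)

lemma dd_power_mult:
  "j \<noteq> i \<Longrightarrow> j \<noteq> Suc i \<Longrightarrow> \<partial> i (X j ^ k * f) = X j ^ k * \<partial> i f"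
  by (simp add: dd_mult_invariant dd_power_other)

section \<open>Commutation and braid relations of the divided differences\<close>

lemma swap_vars_commute:
  assumes "i + 1 < j \<or> j + 1 < i"
  shows "swap_vars i (swap_vars j f) = swap_vars j (swap_vars i f)"
proof -
  have "transpose j (Suc j) \<circ> transpose i (Suc i) = transpose i (Suc i) \<circ> transpose j (Suc j)"
    using assms by (auto simp: fun_eq_iff transpose_def)
  then have *: "Poly_Mapping.map_key (transpose i (Suc i)) (Poly_Mapping.map_key (transpose j (Suc j)) m)
      = Poly_Mapping.map_key (transpose j (Suc j)) (Poly_Mapping.map_key (transpose i (Suc i)) m)"
    for m :: "nat \<Rightarrow>\<^sub>0 nat"
    by (simp add: map_key_compose)
  show ?thesis
    by (induction f rule: ipoly_induct) (simp_all add: swap_vars_single * swap_vars_diff)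
qed

lemma swap_vars_braid:
  "swap_vars i (swap_vars (Suc i) (swap_vars i f)) = swap_vars (Suc i) (swap_vars i (swap_vars (Suc i) f))"
proof -
  have "transpose i (Suc i) \<circ> transpose (Suc i) (Suc (Suc i)) \<circ> transpose i (Suc i)
      = transpose (Suc i) (Suc (Suc i)) \<circ> transpose i (Suc i) \<circ> transpose (Suc i) (Suc (Suc i))"
    by (auto simp: fun_eq_iff transpose_def)
  then have *: "Poly_Mapping.map_key (transpose i (Suc i)) (Poly_Mapping.map_key (transpose (Suc i) (Suc (Suc i)))
        (Poly_Mapping.map_key (transpose i (Suc i)) m))
      = Poly_Mapping.map_key (transpose (Suc i) (Suc (Suc i))) (Poly_Mapping.map_key (transpose i (Suc i))
        (Poly_Mapping.map_key (transpose (Suc i) (Suc (Suc i))) m))"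
    for m :: "nat \<Rightarrow>\<^sub>0 nat"
    by (simp add: map_key_compose inj_compose comp_assoc)
  show ?thesis
    by (induction f rule: ipoly_induct) (simp_all add: swap_vars_single * swap_vars_diff)
qed

lemma dd_commute:
  assumes "i + 1 < j \<or> j + 1 < i"
  shows "\<partial> i (\<partial> j f) = \<partial> j (\<partial> i f)"
proof (rule dd_eqI)
  have ne: "X j - X (Suc j) \<noteq> 0" by simp
  have sj: "swap_vars i (X j - X (Suc j)) = X j - X (Suc j)" "swap_vars j (X i - X (Suc i)) = X i - X (Suc i)"
    using assms by (auto simp: swap_vars_diff transpose_def)
  have "(X j - X (Suc j)) * ((X i - X (Suc i)) * \<partial> j (\<partial> i f))
      = (X i - X (Suc i)) * (\<partial> i f - swap_vars j (\<partial> i f))"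
    by (simp flip: dd_mult add: ac_simps)
  also have "\<dots> = (X i - X (Suc i)) * \<partial> i f - swap_vars j ((X i - X (Suc i)) * \<partial> i f)"
    by (simp only: right_diff_distrib swap_vars_mult sj)
  also have "\<dots> = f - swap_vars i f - swap_vars j f + swap_vars j (swap_vars i f)"
    by (simp add: dd_mult swap_vars_diff)
  also have "\<dots> = (X j - X (Suc j)) * \<partial> j f - swap_vars i ((X j - X (Suc j)) * \<partial> j f)"
    by (simp add: dd_mult swap_vars_diff swap_vars_commute[OF assms])
  also have "\<dots> = (X j - X (Suc j)) * (\<partial> j f - swap_vars i (\<partial> j f))"
    by (simp only: right_diff_distrib swap_vars_mult sj)
  finally show "(X i - X (Suc i)) * \<partial> j (\<partial> i f) = \<partial> j f - swap_vars i (\<partial> j f)"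
    using ne by simp
qed

text \<open>Multiplied by the Vandermonde product of the three variables, both sides become the
  alternating sum \<open>?F\<close> of f over S_3; then the product cancels.\<close>

lemma dd_braid: "\<partial> i (\<partial> (Suc i) (\<partial> i f)) = \<partial> (Suc i) (\<partial> i (\<partial> (Suc i) f))"
proof -
  let ?s = "swap_vars i" and ?t = "swap_vars (Suc i)"
  let ?a = "X i" and ?b = "X (Suc i)" and ?c = "X (Suc (Suc i))"
  let ?F = "f - ?s f - ?t f + ?s (?t f) + ?t (?s f) - ?s (?t (?s f))"
  have s: "(?a - ?b) * \<partial> i h = h - ?s h" and t: "(?b - ?c) * \<partial> (Suc i) h = h - ?t h" for h
    using dd_mult[of i h] dd_mult[of "Suc i" h] by simp_all
  have sX: "?s ?a = ?b" "?s ?b = ?a" "?s ?c = ?c" "?t ?a = ?a" "?t ?b = ?c" "?t ?c = ?b"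
    by (simp_all add: transpose_def)
  \<comment> \<open>Exchanging variables in the equation of the other operator turns its denominator
    into the third Vandermonde factor \<open>?a - ?c\<close>.\<close>
  have ts: "(?a - ?c) * ?t (\<partial> i h) = ?t h - ?t (?s h)" for h
    using arg_cong[OF s[of h], of ?t] by (simp add: swap_vars_mult swap_vars_diff sX)
  have st: "(?a - ?c) * ?s (\<partial> (Suc i) h) = ?s h - ?s (?t h)" for h
    using arg_cong[OF t[of h], of ?s] by (simp add: swap_vars_mult swap_vars_diff sX)
  have sts: "(?b - ?c) * ?s (?t (\<partial> i h)) = ?s (?t h) - ?s (?t (?s h))" for h
    using arg_cong[OF ts[of h], of ?s] by (simp add: swap_vars_mult swap_vars_diff sX)
  have tst: "(?a - ?b) * ?t (?s (\<partial> (Suc i) h)) = ?t (?s h) - ?t (?s (?t h))" for h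
    using arg_cong[OF st[of h], of ?t] by (simp add: swap_vars_mult swap_vars_diff sX)
  have L: "(?a - ?b) * (?b - ?c) * (?a - ?c) * \<partial> i (\<partial> (Suc i) (\<partial> i f)) = ?F"
  proof -
    let ?g = "\<partial> i f"
    have "(?a - ?b) * (?b - ?c) * (?a - ?c) * \<partial> i (\<partial> (Suc i) ?g)
        = (?a - ?c) * (?b - ?c) * (\<partial> (Suc i) ?g - ?s (\<partial> (Suc i) ?g))"
      by (simp flip: s add: ac_simps)
    also have "\<dots> = (?a - ?c) * ((?b - ?c) * \<partial> (Suc i) ?g) - (?b - ?c) * ((?a - ?c) * ?s (\<partial> (Suc i) ?g))"
      by (simp add: algebra_simps)
    also have "\<dots> = (?a - ?c) * (?g - ?t ?g) - (?b - ?c) * (?g - ?s (?t ?g))"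
      by (simp add: t st)
    also have "\<dots> = (?a - ?b) * ?g - (?a - ?c) * ?t ?g + (?b - ?c) * ?s (?t ?g)"
      by (simp add: algebra_simps)
    also have "\<dots> = ?F" by (simp add: s ts sts)
    finally show ?thesis .
  qed
  have R: "(?a - ?b) * (?b - ?c) * (?a - ?c) * \<partial> (Suc i) (\<partial> i (\<partial> (Suc i) f)) = ?F"
  proof -
    let ?g = "\<partial> (Suc i) f"
    have "(?a - ?b) * (?b - ?c) * (?a - ?c) * \<partial> (Suc i) (\<partial> i ?g)
        = (?a - ?c) * (?a - ?b) * (\<partial> i ?g - ?t (\<partial> i ?g))"
      by (simp flip: t add: ac_simps)
    also have "\<dots> = (?a - ?c) * ((?a - ?b) * \<partial> i ?g) - (?a - ?b) * ((?a - ?c) * ?t (\<partial> i ?g))"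
      by (simp add: algebra_simps)
    also have "\<dots> = (?a - ?c) * (?g - ?s ?g) - (?a - ?b) * (?g - ?t (?s ?g))"
      by (simp add: s ts)
    also have "\<dots> = (?b - ?c) * ?g - (?a - ?c) * ?s ?g + (?a - ?b) * ?t (?s ?g)"
      by (simp add: algebra_simps)
    also have "\<dots> = ?F" by (simp add: t st tst swap_vars_braid)
    finally show ?thesis .
  qed
  from L R have "(?a - ?b) * (?b - ?c) * (?a - ?c) * \<partial> i (\<partial> (Suc i) (\<partial> i f))
    = (?a - ?b) * (?b - ?c) * (?a - ?c) * \<partial> (Suc i) (\<partial> i (\<partial> (Suc i) f))" by simp
  then show ?thesis by simp
qed

subsection \<open>Relations between the two families of operators\<close>

text \<open>In terms of these factors the product rule only shifts an index and adds or subtracts f,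
  so simplification can move all of them to the left.\<close>

definition Y :: "nat \<Rightarrow> ipoly" where
  "Y i = 1 - X i"

lemma dd_Y: "\<partial> i (Y i * f) = Y (Suc i) * \<partial> i f - f"
  "\<partial> i (Y (Suc i) * f) = Y i * \<partial> i f + f"
  by (simp_all add: Y_def dd_Leibniz dd_diff swap_vars_diff)

lemma dd_Y_other: "j \<noteq> i \<Longrightarrow> j \<noteq> Suc i \<Longrightarrow> \<partial> i (Y j * f) = Y j * \<partial> i f"
  by (simp add: Y_def dd_mult_invariant dd_diff dd_X_other)

text \<open>In this form every relation involving \<open>\<pi>\<close> reduces to relations between
  divided differences.\<close>

lemma \<pi>_eq: "\<pi> i f = f + Y i * \<partial> i f"
  using dd_Y(2)[of i f] by (simp add: \<pi>_def Y_def)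

lemma \<pi>_0 [simp]: "\<pi> i 0 = 0"
  by (simp add: \<pi>_def)

lemma \<pi>_add: "\<pi> i (f + g) = \<pi> i f + \<pi> i g"
  by (simp add: \<pi>_def dd_add distrib_left)

lemma \<pi>_sum: "\<pi> i (sum f A) = (\<Sum>a\<in>A. \<pi> i (f a))"
  by (induction A rule: infinite_finite_induct) (simp_all add: \<pi>_add)

lemma dd_\<pi> [simp]: "\<partial> i (\<pi> i f) = 0"
  by (simp add: \<pi>_def)

lemma \<pi>_\<pi> [simp]: "\<pi> i (\<pi> i f) = \<pi> i f"
  by (simp add: \<pi>_eq[of i "\<pi> i f"])

lemma \<pi>_power_mult:
  assumes "j \<noteq> i" "j \<noteq> Suc i"
  shows "\<pi> i (X j ^ k * f) = X j ^ k * \<pi> i f"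
  using dd_power_mult[OF assms, of k f] by (simp add: \<pi>_eq algebra_simps)

lemma dd_\<pi>_commute:
  assumes "i + 1 < j \<or> j + 1 < i"
  shows "\<partial> i (\<pi> j f) = \<pi> j (\<partial> i f)"
proof -
  have "j \<noteq> i" "j \<noteq> Suc i" using assms by auto
  then show ?thesis
    by (simp add: \<pi>_eq dd_add dd_Y_other dd_commute[OF assms, of f])
qed

lemma \<pi>_commute:
  assumes "i + 1 < j \<or> j + 1 < i"
  shows "\<pi> i (\<pi> j f) = \<pi> j (\<pi> i f)"
proof -
  have "j \<noteq> i" "j \<noteq> Suc i" "i \<noteq> j" "i \<noteq> Suc j" using assms by auto
  then show ?thesis
    by (simp add: \<pi>_eq dd_add dd_Y_other dd_commute[OF assms, of f] algebra_simps)
qed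

lemma dd_\<pi>_Suc: "\<partial> i (\<pi> (Suc i) f) = \<pi> i (\<partial> (Suc i) f) + \<partial> i f"
  by (simp add: \<pi>_eq dd_add dd_Y)

lemma dd_dd_\<pi>: "\<partial> (Suc i) (\<partial> i (\<pi> (Suc i) f)) = \<pi> i (\<partial> (Suc i) (\<partial> i f))"
  by (simp add: \<pi>_eq dd_add dd_Y dd_Y_other dd_braid)

lemma dd_\<pi>_\<pi>: "\<partial> i (\<pi> (Suc i) (\<pi> i f)) = \<pi> (Suc i) (\<pi> i (\<partial> (Suc i) f))"
  by (simp add: \<pi>_eq dd_add dd_diff dd_Y dd_Y_other dd_braid algebra_simps)

lemma \<pi>_braid: "\<pi> i (\<pi> (Suc i) (\<pi> i f)) = \<pi> (Suc i) (\<pi> i (\<pi> (Suc i) f))"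
  by (simp add: \<pi>_eq dd_add dd_diff dd_Y dd_Y_other dd_braid algebra_simps)

subsection \<open>Runs of consecutive operators\<close>

primrec dds :: "nat \<Rightarrow> nat \<Rightarrow> ipoly \<Rightarrow> ipoly" where
  "dds a 0 f = f"
| "dds a (Suc k) f = \<partial> (a + k) (dds a k f)"

primrec \<pi>s :: "nat \<Rightarrow> nat \<Rightarrow> ipoly \<Rightarrow> ipoly" where
  "\<pi>s a 0 f = f"
| "\<pi>s a (Suc k) f = \<pi> (a + k) (\<pi>s a k f)"

text \<open>Unlike in \<open>\<pi>s\<close>, the factor of highest index acts first: operator
  indices grow towards the left, while the pipes of a co-BPD run to the right.\<close>

primrec \<pi>s_rev :: "nat \<Rightarrow> nat \<Rightarrow> ipoly \<Rightarrow> ipoly" where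
  "\<pi>s_rev a 0 f = f"
| "\<pi>s_rev a (Suc k) f = \<pi>s_rev a k (\<pi> (a + k) f)"

lemma \<pi>s_add: "\<pi>s a k (f + g) = \<pi>s a k f + \<pi>s a k g"
  by (induction k) (simp_all add: \<pi>_add)

lemma \<pi>s_0 [simp]: "\<pi>s a k 0 = 0"
  by (induction k) simp_all

lemma dds_0 [simp]: "dds a k 0 = 0"
  by (induction k) simp_all

lemma \<pi>s_rev_0 [simp]: "\<pi>s_rev a k 0 = 0"
  by (induction k) simp_all

lemma \<pi>s_sum: "\<pi>s a k (sum f A) = (\<Sum>x\<in>A. \<pi>s a k (f x))"
  by (induction A rule: infinite_finite_induct) (simp_all add: \<pi>s_add)

lemma \<pi>s_rev_Suc_left: "\<pi>s_rev a (Suc k) f = \<pi> a (\<pi>s_rev (Suc a) k f)"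
  by (induction k arbitrary: f) simp_all

lemma \<pi>s_Suc_right: "\<pi>s a (Suc k) f = \<pi>s (Suc a) k (\<pi> a f)"
  by (induction k) simp_all

lemma dds_Suc_right: "dds a (Suc k) f = dds (Suc a) k (\<partial> a f)"
  by (induction k) simp_all

lemma \<pi>s_append: "\<pi>s a (k + l) f = \<pi>s (a + k) l (\<pi>s a k f)"
  by (induction l) (simp_all add: add.assoc)

lemma dds_power_mult: "d < a \<Longrightarrow> dds a k (X d ^ m * f) = X d ^ m * dds a k f"
  by (induction k) (simp_all add: dd_power_mult)

lemma \<pi>s_power_mult: "d < a \<Longrightarrow> \<pi>s a k (X d ^ m * f) = X d ^ m * \<pi>s a k f"
  by (induction k) (simp_all add: \<pi>_power_mult)

lemma \<pi>s_rev_power_mult: "d < a \<Longrightarrow> \<pi>s_rev a k (X d ^ m * f) = X d ^ m * \<pi>s_rev a k f"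
  by (induction k arbitrary: f) (simp_all add: \<pi>_power_mult)

lemma dd_\<pi>s_commute: "i + 1 < a \<or> a + k < i \<Longrightarrow> \<partial> i (\<pi>s a k f) = \<pi>s a k (\<partial> i f)"
  by (induction k) (auto simp: dd_\<pi>_commute)

lemma dd_dds_commute: "i + 1 < a \<or> a + k < i \<Longrightarrow> \<partial> i (dds a k f) = dds a k (\<partial> i f)"
proof (induction k)
  case (Suc k)
  have "\<partial> i (\<partial> (a + k) (dds a k f)) = \<partial> (a + k) (\<partial> i (dds a k f))"
    by (rule dd_commute) (use Suc.prems in auto)
  with Suc show ?case by auto
qed simp

lemma \<pi>_\<pi>s_commute: "i + 1 < a \<or> a + k < i \<Longrightarrow> \<pi> i (\<pi>s a k f) = \<pi>s a k (\<pi> i f)"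
proof (induction k)
  case (Suc k)
  have "\<pi> i (\<pi> (a + k) (\<pi>s a k f)) = \<pi> (a + k) (\<pi> i (\<pi>s a k f))"
    by (rule \<pi>_commute) (use Suc.prems in auto)
  with Suc show ?case by auto
qed simp

lemma \<pi>_dds_commute: "i + 1 < a \<or> a + k < i \<Longrightarrow> \<pi> i (dds a k f) = dds a k (\<pi> i f)"
  by (induction k) (auto simp flip: dd_\<pi>_commute)

lemma dds_\<pi>s_commute: "a + k < b \<or> b + l < a \<Longrightarrow> dds a k (\<pi>s b l f) = \<pi>s b l (dds a k f)"
  by (induction k) (auto simp: dd_\<pi>s_commute)

lemma dds_dds_commute: "a + k < b \<or> b + l < a \<Longrightarrow> dds a k (dds b l f) = dds b l (dds a k f)"
  by (induction k) (auto simp: dd_dds_commute)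

lemma dd_\<pi>s_rev_commute: "i + 1 < a \<or> a + k < i \<Longrightarrow> \<partial> i (\<pi>s_rev a k f) = \<pi>s_rev a k (\<partial> i f)"
  by (induction k arbitrary: f) (auto simp: dd_\<pi>_commute)

lemma \<pi>s_\<pi>s_rev_commute: "a + k < b \<or> b + l < a \<Longrightarrow> \<pi>s a k (\<pi>s_rev b l f) = \<pi>s_rev b l (\<pi>s a k f)"
proof (induction l arbitrary: f)
  case (Suc l)
  have "\<pi>s a k (\<pi> (b + l) f) = \<pi> (b + l) (\<pi>s a k f)"
    by (rule \<pi>_\<pi>s_commute[symmetric]) (use Suc.prems in auto)
  with Suc show ?case by auto
qed simp

text \<open>All factors commute with the divided difference except the neighbours
  \<open>\<pi> j\<close> and \<open>\<pi> (Suc j)\<close>, where \<open>dd_\<pi>_\<pi>\<close>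
  lowers its index by one.\<close>

lemma \<pi>s_slide:
  assumes "a \<le> j" "Suc j < a + k"
  shows "\<pi>s a k (\<partial> (Suc j) f) = \<partial> j (\<pi>s a k f)"
  using assms(2)
proof (induction k)
  case (Suc k)
  show ?case
  proof (cases "Suc j < a + k")
    case True
    with Suc.IH show ?thesis by (simp add: dd_\<pi>_commute)
  next
    case False
    \<comment> \<open>Here \<open>a + k = Suc j\<close>, so the two outermost factors are
      \<open>\<pi> (Suc j)\<close> and \<open>\<pi> j\<close>.\<close>
    with Suc.prems assms(1) obtain l where k: "k = Suc l" "j = a + l"
      by (metis add_Suc_right le_Suc_ex less_antisym nat_add_left_cancel_less Suc_less_eq)
    have "\<pi>s a l (\<partial> (Suc j) f) = \<partial> (Suc j) (\<pi>s a l f)"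
      by (rule dd_\<pi>s_commute[symmetric]) (simp add: k)
    then show ?thesis by (simp add: k dd_\<pi>_\<pi>)
  qed
qed (use assms(1) in simp)

lemma \<pi>s_slide_dds:
  assumes "a \<le> b" "b + l < a + k"
  shows "\<pi>s a k (dds (Suc b) l f) = dds b l (\<pi>s a k f)"
  using assms(2)
proof (induction l)
  case (Suc l)
  have "\<pi>s a k (\<partial> (Suc (b + l)) (dds (Suc b) l f)) = \<partial> (b + l) (\<pi>s a k (dds (Suc b) l f))"
    by (rule \<pi>s_slide) (use assms Suc.prems in auto)
  with Suc show ?case by simp
qed simp

text \<open>Between two copies of \<open>\<partial> i\<close> the correction term of
  \<open>dd_\<pi>_Suc\<close> vanishes, because \<open>\<partial> i\<close> squares to zero;
  \<open>dd_dd_\<pi>\<close> then brings the remaining term into the form on the right.\<close>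

lemma dds_\<pi>s_dd: "dds a k (\<pi>s (Suc a) k (\<partial> a f)) = dds a (Suc k) (\<pi>s (Suc a) k f)"
proof (induction k)
  case (Suc k)
  let ?Z = "dds a k (\<pi>s (Suc a) k f)"
  have c: "dds a k (\<pi> (Suc (a + k)) g) = \<pi> (Suc (a + k)) (dds a k g)" for g
    by (rule \<pi>_dds_commute[symmetric]) simp
  have "dds a (Suc k) (\<pi>s (Suc a) (Suc k) (\<partial> a f)) = \<partial> (a + k) (\<pi> (Suc (a + k)) (\<partial> (a + k) ?Z))"
    using Suc by (simp add: c)
  also have "\<dots> = \<pi> (a + k) (\<partial> (Suc (a + k)) (\<partial> (a + k) ?Z))"
    by (simp add: dd_\<pi>_Suc)
  also have "\<dots> = dds a (Suc (Suc k)) (\<pi>s (Suc a) (Suc k) f)"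
    by (simp add: c dd_dd_\<pi>)
  finally show ?case .
qed simp

text \<open>Each step of the run splits by \<open>dd_\<pi>_Suc\<close> into a main term and a
  correction. The summand \<open>a\<close> collects the choices whose last correction is at index
  \<open>d + a\<close>; whatever acted before it stays unexpanded.\<close>

lemma dds_\<pi>s_expand:
  "dds d R (\<pi>s (Suc d) R G) = \<pi>s d R (dds (Suc d) R G) +
     (\<Sum>a<R. \<pi>s (Suc (d + a)) (R - Suc a) (dds (Suc (Suc (d + a))) (R - Suc a) (dds d (Suc a) (\<pi>s (Suc d) a G))))"
proof (induction R)
  case (Suc R)
  let ?t = "\<lambda>R a. \<pi>s (Suc (d + a)) (R - Suc a) (dds (Suc (Suc (d + a))) (R - Suc a) (dds d (Suc a) (\<pi>s (Suc d) a G)))"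
  let ?Y = "dds d R (\<pi>s (Suc d) R G)"
  have 1: "\<pi> (d + R) (\<partial> (Suc (d + R)) (?t R a)) = ?t (Suc R) a" if "a < R" for a
  proof -
    obtain l where l: "R = Suc (a + l)" using \<open>a < R\<close> less_iff_Suc_add by auto
    have "\<partial> (Suc (d + R)) (\<pi>s (Suc (d + a)) l g) = \<pi>s (Suc (d + a)) l (\<partial> (Suc (d + R)) g)" for g
      by (rule dd_\<pi>s_commute) (simp add: l)
    then show ?thesis by (simp add: l add_ac)
  qed
  have 2: "\<partial> (Suc (d + R)) (\<pi>s d R g) = \<pi>s d R (\<partial> (Suc (d + R)) g)" for g
    by (rule dd_\<pi>s_commute) simp
  have "dds d (Suc R) (\<pi>s (Suc d) (Suc R) G) = \<partial> (d + R) (\<pi> (Suc (d + R)) ?Y)"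
    using \<pi>_dds_commute[of "Suc (d + R)" d R "\<pi>s (Suc d) R G"] by simp
  also have "\<dots> = \<pi> (d + R) (\<partial> (Suc (d + R)) ?Y) + \<partial> (d + R) ?Y"
    by (rule dd_\<pi>_Suc)
  also have "\<pi> (d + R) (\<partial> (Suc (d + R)) ?Y) = \<pi>s d (Suc R) (dds (Suc d) (Suc R) G) + (\<Sum>a<R. ?t (Suc R) a)"
  proof -
    have "(\<Sum>a<R. \<pi> (d + R) (\<partial> (Suc (d + R)) (?t R a))) = (\<Sum>a<R. ?t (Suc R) a)"
      by (rule sum.cong) (use 1 in auto)
    then show ?thesis
      unfolding Suc.IH dd_add \<pi>_add dd_sum \<pi>_sum 2 by simp
  qed
  also have "\<partial> (d + R) ?Y = ?t (Suc R) R"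
    by simp
  finally show ?case
    by (simp add: add.assoc del: dds.simps \<pi>s.simps)
qed simp

subsection \<open>Polynomials of words\<close>

abbreviation cntT :: "bool list \<Rightarrow> nat" where "cntT \<omega> \<equiv> count_list \<omega> True"
abbreviation cntF :: "bool list \<Rightarrow> nat" where "cntF \<omega> \<equiv> count_list \<omega> False"

text \<open>
  \<open>word_poly d \<omega>\<close> is the Grothendieck polynomial in \<open>x\<^bsub>d\<^esub>, x\<^bsub>d+1\<^esub>, \<dots>\<close> of the permutation that
  lists the marked columns of a row decreasingly and then the others decreasingly. The word is read
  from the last column, and \<open>True\<close> marks a column that is occupied by a pipe.
\<close>

fun word_poly :: "nat \<Rightarrow> bool list \<Rightarrow> ipoly" where
  "word_poly d [] = 1"
| "word_poly d (True # \<omega>) = X d ^ length \<omega> * word_poly (Suc d) \<omega>"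
| "word_poly d (False # \<omega>) = \<pi>s d (cntT \<omega>) (X d ^ length \<omega> * word_poly (Suc d) \<omega>)"

text \<open>
  The contribution of a row whose columns \<open>\<tau>\<close> are settled (marked if there is a pipe at the top)
  while no pipe is carried to the right from the remaining columns \<open>\<omega>\<close> (marked if there is a pipe
  at the bottom). In the last equation the next column receives no pipe, or the pipe of column \<open>k\<close>,
  which crosses the pipes in between.
\<close>

function row_poly :: "nat \<Rightarrow> bool list \<Rightarrow> bool list \<Rightarrow> ipoly" where
  "row_poly d (True # \<tau>) \<omega> = X d ^ (length \<tau> + length \<omega>) * row_poly (Suc d) \<tau> \<omega>"
| "row_poly d (False # \<tau>) \<omega> = \<pi>s d (cntT \<tau> + cntT \<omega>) (X d ^ (length \<tau> + length \<omega>) * row_poly (Suc d) \<tau> \<omega>)"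
| "row_poly d [] [] = 1"
| "row_poly d [] (True # \<omega>) = row_poly d [True] \<omega>"
| "row_poly d [] (False # \<omega>) = row_poly d [False] \<omega> +
     (\<Sum>k\<in>{k. k < length \<omega> \<and> \<omega> ! k}. dds d (cntT (take k \<omega>)) (\<pi>s_rev (d + cntT \<omega>) (cntF (take k \<omega>))
        (row_poly d (True # take k \<omega> @ [False]) (drop (Suc k) \<omega>))))"
  by pat_completeness auto
termination
  by (relation "measures [\<lambda>(d, \<tau>, \<omega>). length \<omega>, \<lambda>(d, \<tau>, \<omega>). length \<tau>]") auto

lemma row_poly_Nil: "row_poly d \<tau> [] = word_poly d \<tau>"
  by (induction d \<tau> rule: word_poly.induct) simp_all

lemma row_poly_True: "row_poly d \<tau> (True # \<omega>) = row_poly d (\<tau> @ [True]) \<omega>"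
proof (induction \<tau> arbitrary: d)
  case (Cons b \<tau>)
  then show ?case by (cases b) simp_all
qed simp

lemma cntT_split: "k < length \<omega> \<Longrightarrow> \<omega> ! k \<Longrightarrow> cntT (take k \<omega>) + cntT (drop (Suc k) \<omega>) + 1 = cntT \<omega>"
  using arg_cong[OF id_take_nth_drop[of k \<omega>], of cntT] by simp

lemma cntT_take_less: "k < length \<omega> \<Longrightarrow> \<omega> ! k \<Longrightarrow> cntT (take k \<omega>) < cntT \<omega>"
  using cntT_split[of k \<omega>] by simp

text \<open>\<open>row_poly\<close> consumes \<tau> from the front, but a row extends \<tau> at its
  end. The run contributed by a free settled column passes the divided differences by
  \<open>\<pi>s_slide_dds\<close>, lowering their index, and commutes with
  \<open>\<pi>s_rev\<close>, whose indices lie beyond it.\<close>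

lemma row_poly_False: "row_poly d \<tau> (False # \<omega>) = row_poly d (\<tau> @ [False]) \<omega> +
     (\<Sum>k\<in>{k. k < length \<omega> \<and> \<omega> ! k}. dds (d + cntT \<tau>) (cntT (take k \<omega>))
        (\<pi>s_rev (d + cntT \<tau> + cntT \<omega> + cntF \<tau>) (cntF (take k \<omega>))
        (row_poly d (\<tau> @ True # take k \<omega> @ [False]) (drop (Suc k) \<omega>))))"
proof (induction \<tau> arbitrary: d)
  case (Cons b \<tau>)
  let ?L = "Suc (length \<tau> + length \<omega>)"
  let ?x = "\<lambda>k. row_poly (Suc d) (\<tau> @ True # take k \<omega> @ [False]) (drop (Suc k) \<omega>)"
  let ?N = "\<lambda>d k. dds (d + cntT \<tau>) (cntT (take k \<omega>))"
  let ?P = "\<lambda>d k. \<pi>s_rev (d + cntT \<tau> + cntT \<omega> + cntF \<tau>) (cntF (take k \<omega>))"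
  have e: "X d ^ ?L * row_poly (Suc d) \<tau> (False # \<omega>) = X d ^ ?L * row_poly (Suc d) (\<tau> @ [False]) \<omega> +
      (\<Sum>k\<in>{k. k < length \<omega> \<and> \<omega> ! k}. ?N (Suc d) k (?P (Suc d) k (X d ^ ?L * ?x k)))"
    unfolding Cons
    by (simp add: distrib_left sum_distrib_left dds_power_mult \<pi>s_rev_power_mult del: power_Suc)
  have len: "length (\<tau> @ True # take k \<omega> @ [False]) + length (drop (Suc k) \<omega>) = ?L" if "k < length \<omega>" for k
    using that by simp
  show ?case
  proof (cases b)
    case True
    have x1: "row_poly d (True # \<tau> @ True # take k \<omega> @ [False]) (drop (Suc k) \<omega>) = X d ^ ?L * ?x k"
      if "k < length \<omega>" for k
      unfolding row_poly.simps len[OF that] ..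
    then have "(\<Sum>k\<in>{k. k < length \<omega> \<and> \<omega> ! k}. ?N (Suc d) k (?P (Suc d) k
          (row_poly d (True # \<tau> @ True # take k \<omega> @ [False]) (drop (Suc k) \<omega>))))
        = (\<Sum>k\<in>{k. k < length \<omega> \<and> \<omega> ! k}. ?N (Suc d) k (?P (Suc d) k (X d ^ ?L * ?x k)))"
      by (intro sum.cong refl) (simp only: x1 mem_Collect_eq)
    then show ?thesis
      using e True by (simp del: power_Suc)
  next
    case False
    let ?R = "cntT \<tau> + cntT \<omega>"
    have m: "\<pi>s d ?R (?N (Suc d) k (?P (Suc d) k f)) = ?N d k (?P (Suc d) k (\<pi>s d ?R f))"
      if "k < length \<omega>" "\<omega> ! k" for k f
    proof -
      have "\<pi>s d ?R (?N (Suc d) k g) = ?N d k (\<pi>s d ?R g)" for g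
        using \<pi>s_slide_dds[of d "d + cntT \<tau>" "cntT (take k \<omega>)" ?R g] cntT_take_less[OF that] by simp
      moreover have "\<pi>s d ?R (?P (Suc d) k f) = ?P (Suc d) k (\<pi>s d ?R f)"
        by (rule \<pi>s_\<pi>s_rev_commute) simp
      ultimately show ?thesis by simp
    qed
    have R: "cntT (\<tau> @ True # take k \<omega> @ [False]) + cntT (drop (Suc k) \<omega>) = ?R" if "k < length \<omega>" "\<omega> ! k" for k
      using cntT_split[OF that] by simp
    have x1: "row_poly d (False # \<tau> @ True # take k \<omega> @ [False]) (drop (Suc k) \<omega>) = \<pi>s d ?R (X d ^ ?L * ?x k)"
      if "k < length \<omega>" "\<omega> ! k" for k
      unfolding row_poly.simps len[OF that(1)] R[OF that] ..
    then have "(\<Sum>k\<in>{k. k < length \<omega> \<and> \<omega> ! k}. ?N d k (?P (Suc d) k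
          (row_poly d (False # \<tau> @ True # take k \<omega> @ [False]) (drop (Suc k) \<omega>))))
        = (\<Sum>k\<in>{k. k < length \<omega> \<and> \<omega> ! k}. \<pi>s d ?R (?N (Suc d) k (?P (Suc d) k (X d ^ ?L * ?x k))))"
      by (intro sum.cong refl) (simp only: x1 m mem_Collect_eq)
    then show ?thesis
      using arg_cong[OF e, of "\<pi>s d ?R"] False
      by (simp add: \<pi>s_add \<pi>s_sum del: power_Suc)
  qed
qed simp

section \<open>The identity between runs of divided differences and row polynomials\<close>

lemma sum_cntT_take:
  "(\<Sum>a<cntT \<omega>. g a) = (\<Sum>k\<in>{k. k < length \<omega> \<and> \<omega> ! k}. g (cntT (take k \<omega>)))"
proof (induction \<omega> arbitrary: g)
  case (Cons b \<omega>)
  have set: "{k. k < length (b # \<omega>) \<and> (b # \<omega>) ! k}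
      = (if b then {0} else {}) \<union> Suc ` {k. k < length \<omega> \<and> \<omega> ! k}"
    by (auto simp: less_Suc_eq_0_disj)
  have "(\<Sum>k\<in>{k. k < length (b # \<omega>) \<and> (b # \<omega>) ! k}. g (cntT (take k (b # \<omega>))))
     = (if b then g 0 else 0) + (\<Sum>k\<in>{k. k < length \<omega> \<and> \<omega> ! k}. g (cntT (b # take k \<omega>)))"
    unfolding set by (subst sum.union_disjoint) (auto simp: sum.reindex)
  also have "\<dots> = (\<Sum>a<cntT (b # \<omega>). g a)"
  proof (cases b)
    case True
    then show ?thesis
      using Cons[of "\<lambda>a. g (Suc a)"] by (simp add: sum.lessThan_Suc_shift del: sum.lessThan_Suc)
  next
    case False
    then show ?thesis using Cons[of g] by simp
  qed
  finally show ?case by simp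
qed simp

lemma dd_word_poly: "Suc i < d \<Longrightarrow> \<partial> i (word_poly d \<omega>) = 0"
proof (induction d \<omega> rule: word_poly.induct)
  case (3 d \<omega>)
  then show ?case
    by (subst word_poly.simps, subst dd_\<pi>s_commute) (auto simp: dd_power_mult)
qed (simp_all add: dd_power_mult)

text \<open>The argument is x_d times a factor symmetric in x_d and x_(d+1). Both operators just
  strip x_d from it, so that one may later replace the other.\<close>

lemma dd_staircase:
  assumes "\<partial> d g = 0"
  shows "\<partial> d (X d ^ Suc L * (X (Suc d) ^ L * g)) = X d ^ L * (X (Suc d) ^ L * g)"
    and "\<pi> d (X d ^ Suc L * (X (Suc d) ^ L * g)) = X d ^ L * (X (Suc d) ^ L * g)"
proof -
  define h where "h = X d ^ L * (X (Suc d) ^ L * g)"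
  have h: "\<partial> d h = 0"
    using assms by (simp add: h_def dd_eq_0_iff swap_vars_mult swap_vars_power mult_ac)
  have eq: "X d ^ Suc L * (X (Suc d) ^ L * g) = h * X d"
    by (simp add: h_def mult_ac)
  show "\<partial> d (X d ^ Suc L * (X (Suc d) ^ L * g)) = X d ^ L * (X (Suc d) ^ L * g)"
    unfolding eq h_def[symmetric] by (simp add: dd_mult_invariant[OF h])
  then show "\<pi> d (X d ^ Suc L * (X (Suc d) ^ L * g)) = X d ^ L * (X (Suc d) ^ L * g)"
    unfolding eq h_def[symmetric] by (simp add: \<pi>_eq Y_def algebra_simps)
qed

text \<open>The identity for \<omega> is a premise because the induction that proves it uses this
  extension for shorter words. The marked column is where a pipe turns to the right; each free
  column of \<sigma> that it passes adds an operator.\<close>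

lemma dds_word_poly_marked:
  assumes main: "\<And>d. dds d (cntT \<omega>) (X d ^ length \<omega> * word_poly (Suc d) \<omega>) = row_poly d [False] \<omega>"
  shows "dds (d + cntT \<sigma>) (cntT \<omega>) (word_poly d (\<sigma> @ True # \<omega>))
     = \<pi>s_rev (d + cntT \<sigma> + cntT \<omega>) (cntF \<sigma>) (row_poly d (\<sigma> @ [False]) \<omega>)"
proof (induction \<sigma> arbitrary: d)
  case Nil
  then show ?case using main[of d] by simp
next
  case (Cons b \<sigma>)
  let ?L = "Suc (length \<sigma> + length \<omega>)"
  note IH = arg_cong[OF Cons[of "Suc d"], of "\<lambda>f. X d ^ ?L * f"]
  have IH': "dds (Suc (d + cntT \<sigma>)) (cntT \<omega>) (X d ^ ?L * word_poly (Suc d) (\<sigma> @ True # \<omega>))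
     = \<pi>s_rev (Suc (d + cntT \<sigma> + cntT \<omega>)) (cntF \<sigma>) (X d ^ ?L * row_poly (Suc d) (\<sigma> @ [False]) \<omega>)"
    using IH by (simp add: dds_power_mult \<pi>s_rev_power_mult del: power_Suc)
  show ?case
  proof (cases b)
    case True
    then show ?thesis using IH' by (simp del: power_Suc)
  next
    case False
    let ?R = "cntT \<sigma> + cntT \<omega>"
    let ?X = "X d ^ ?L * row_poly (Suc d) (\<sigma> @ [False]) \<omega>"
    \<comment> \<open>The marked column lengthens the run by one; this outermost factor, of index
      \<open>d + ?R\<close>, extends \<open>\<pi>s_rev\<close> at its lower end.\<close>
    have "dds (d + cntT \<sigma>) (cntT \<omega>) (\<pi>s d (Suc ?R) (X d ^ ?L * word_poly (Suc d) (\<sigma> @ True # \<omega>)))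
        = \<pi>s d (Suc ?R) (dds (Suc (d + cntT \<sigma>)) (cntT \<omega>) (X d ^ ?L * word_poly (Suc d) (\<sigma> @ True # \<omega>)))"
      by (rule \<pi>s_slide_dds[symmetric]) auto
    also have "\<dots> = \<pi> (d + ?R) (\<pi>s d ?R (\<pi>s_rev (Suc (d + cntT \<sigma> + cntT \<omega>)) (cntF \<sigma>) ?X))"
      unfolding IH' by simp
    also have "\<pi>s d ?R (\<pi>s_rev (Suc (d + cntT \<sigma> + cntT \<omega>)) (cntF \<sigma>) ?X)
        = \<pi>s_rev (Suc (d + cntT \<sigma> + cntT \<omega>)) (cntF \<sigma>) (\<pi>s d ?R ?X)"
      by (rule \<pi>s_\<pi>s_rev_commute) simp
    also have "\<pi> (d + ?R) \<dots> = \<pi>s_rev (d + cntT \<sigma> + cntT \<omega>) (Suc (cntF \<sigma>)) (\<pi>s d ?R ?X)"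
      unfolding \<pi>s_rev_Suc_left by (simp add: add.assoc)
    finally show ?thesis using False by (simp del: power_Suc \<pi>s.simps \<pi>s_rev.simps)
  qed
qed

text \<open>Both sides peel off the first column of \<omega>. If it is marked, each side strips one
  x_d by the staircase rule. If it is free, the expansion \<open>dds_\<pi>s_expand\<close> has as
  many terms as the row recursion: the main term leaves the column empty, and the correction
  \<open>a\<close> brings in the pipe of the marked column that has \<open>a\<close> marked ones
  before it.\<close>

theorem dds_word_poly: "dds d (cntT \<omega>) (X d ^ length \<omega> * word_poly (Suc d) \<omega>) = row_poly d [False] \<omega>"
proof (induction "length \<omega>" arbitrary: \<omega> d rule: less_induct)
  case less
  show ?case
  proof (cases \<omega>)
    case Nil
    then show ?thesis by simp
  next
    case (Cons b \<omega>')
    let ?L = "length \<omega>'" and ?R = "cntT \<omega>'"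
    let ?G0 = "X d ^ Suc ?L * (X (Suc d) ^ ?L * word_poly (Suc (Suc d)) \<omega>')"
    have IH: "dds d ?R (X d ^ ?L * word_poly (Suc d) \<omega>') = row_poly d [False] \<omega>'" for d
      using less[of \<omega>' d] Cons by simp
    show ?thesis
    proof (cases b)
      case True
      have "dds d (Suc ?R) ?G0 = dds (Suc d) ?R (\<partial> d ?G0)"
        by (rule dds_Suc_right)
      also have "\<partial> d ?G0 = X d ^ ?L * (X (Suc d) ^ ?L * word_poly (Suc (Suc d)) \<omega>')"
        by (rule dd_staircase) (simp add: dd_word_poly)
      also have "dds (Suc d) ?R \<dots> = X d ^ ?L * row_poly (Suc d) [False] \<omega>'"
        by (simp only: dds_power_mult[OF lessI] IH)
      also have "\<dots> = row_poly d [False] (True # \<omega>')"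
      proof -
        let ?g = "row_poly (Suc (Suc d)) [] \<omega>'"
        have g: "\<partial> d ?g = 0"
        proof -
          have "\<partial> i (row_poly e \<tau> \<omega>) = 0" if "Suc i < e" for i e \<tau> \<omega>
            using that
          proof (induction e \<tau> \<omega> arbitrary: i rule: row_poly.induct)
            case (2 d \<tau> \<omega>)
            then show ?case
              by (subst row_poly.simps, subst dd_\<pi>s_commute) (auto simp: dd_power_mult)
          next
            case (5 d \<omega>)
            then show ?case
              by (simp add: dd_add dd_sum dd_dds_commute dd_\<pi>s_rev_commute)
          qed (simp_all add: dd_power_mult)
          then show ?thesis by simp
        qed
        have "row_poly d [False] (True # \<omega>') = \<pi>s d (Suc ?R) (X d ^ Suc ?L * (X (Suc d) ^ ?L * ?g))"
          by (simp add: del: power_Suc \<pi>s.simps)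
        also have "\<dots> = \<pi>s (Suc d) ?R (X d ^ ?L * (X (Suc d) ^ ?L * ?g))"
          by (simp only: \<pi>s_Suc_right dd_staircase(2)[OF g])
        also have "\<dots> = X d ^ ?L * row_poly (Suc d) [False] \<omega>'"
          by (simp add: \<pi>s_power_mult)
        finally show ?thesis by simp
      qed
      finally show ?thesis using Cons True by (simp del: dds.simps power_Suc)
    next
      case False
      let ?t = "\<lambda>a. \<pi>s (Suc (d + a)) (?R - Suc a) (dds (Suc (Suc (d + a))) (?R - Suc a) (dds d (Suc a) (\<pi>s (Suc d) a ?G0)))"
      let ?u = "\<lambda>k. dds (Suc d) (cntT (take k \<omega>')) (\<pi>s_rev (Suc d + ?R) (cntF (take k \<omega>'))
        (row_poly (Suc d) (True # take k \<omega>' @ [False]) (drop (Suc k) \<omega>')))"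
      \<comment> \<open>Splitting \<open>\<omega>'\<close> at the marked column that belongs to the
        correction makes the induction hypothesis available for the suffix
        \<open>?\<beta>\<close>.\<close>
      have t: "?t (cntT (take k \<omega>')) = \<pi>s d ?R (X d ^ Suc ?L * ?u k)" if k: "k < ?L" "\<omega>' ! k" for k
      proof -
        let ?\<alpha> = "take k \<omega>'" and ?\<beta> = "drop (Suc k) \<omega>'"
        let ?a = "cntT ?\<alpha>"
        have split: "\<omega>' = ?\<alpha> @ True # ?\<beta>"
          using k id_take_nth_drop[of k \<omega>'] by simp
        have R: "?R = Suc (?a + cntT ?\<beta>)"
          using cntT_split[OF k] by simp
        have len: "length ?\<beta> < length \<omega>"
          using Cons by simp
        let ?Gk = "dds (Suc (Suc d) + ?a) (cntT ?\<beta>) (word_poly (Suc (Suc d)) \<omega>')"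
        let ?G' = "X d ^ Suc ?L * (X (Suc d) ^ ?L * ?Gk)"
        have Gk: "?Gk = \<pi>s_rev (Suc d + ?R) (cntF ?\<alpha>) (row_poly (Suc (Suc d)) (?\<alpha> @ [False]) ?\<beta>)"
          using dds_word_poly_marked[of ?\<beta> "Suc (Suc d)" ?\<alpha>, folded split] less[OF len] by (simp add: R add.assoc)
        have G': "dds (Suc (Suc (d + ?a))) (cntT ?\<beta>) ?G0 = ?G'"
          by (simp add: dds_power_mult del: power_Suc)
        have "\<partial> d ?Gk = 0"
          by (subst dd_dds_commute) (simp_all add: dd_word_poly)
        note st = dd_staircase[OF this, of ?L]
        have "dds (Suc (Suc (d + ?a))) (cntT ?\<beta>) (dds d (Suc ?a) (\<pi>s (Suc d) ?a ?G0))
            = dds d (Suc ?a) (\<pi>s (Suc d) ?a ?G')"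
        proof -
          have "dds (Suc (Suc (d + ?a))) (cntT ?\<beta>) (dds d (Suc ?a) g) = dds d (Suc ?a) (dds (Suc (Suc (d + ?a))) (cntT ?\<beta>) g)" for g
            by (rule dds_dds_commute) simp
          moreover have "dds (Suc (Suc (d + ?a))) (cntT ?\<beta>) (\<pi>s (Suc d) ?a g) = \<pi>s (Suc d) ?a (dds (Suc (Suc (d + ?a))) (cntT ?\<beta>) g)" for g
            by (rule dds_\<pi>s_commute) simp
          ultimately show ?thesis unfolding G'[symmetric] by simp
        qed
        \<comment> \<open>The innermost \<open>\<partial> d\<close> becomes free and may be traded
          for \<open>\<pi> d\<close>, since \<open>?G'\<close> has the staircase shape; the run of
          \<open>\<pi>\<close> then starts at d.\<close>
        also have "\<dots> = dds d ?a (\<pi>s (Suc d) ?a (\<partial> d ?G'))"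
          by (simp only: dds_\<pi>s_dd)
        also have "\<dots> = dds d ?a (\<pi>s d (Suc ?a) ?G')"
          by (simp only: \<pi>s_Suc_right st)
        finally have "?t ?a = \<pi>s (Suc (d + ?a)) (cntT ?\<beta>) (dds d ?a (\<pi>s d (Suc ?a) ?G'))"
          by (simp add: R del: \<pi>s.simps dds.simps power_Suc)
        also have "\<dots> = dds d ?a (\<pi>s (d + Suc ?a) (cntT ?\<beta>) (\<pi>s d (Suc ?a) ?G'))"
          by (subst dds_\<pi>s_commute) simp_all
        also have "\<dots> = dds d ?a (\<pi>s d ?R ?G')"
          by (simp only: \<pi>s_append[symmetric] R add_Suc)
        also have "\<dots> = \<pi>s d ?R (dds (Suc d) ?a ?G')"
          by (rule \<pi>s_slide_dds[symmetric]) (simp_all add: R)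
        also have "dds (Suc d) ?a ?G' = X d ^ Suc ?L * ?u k"
        proof -
          have "length ?\<alpha> + Suc (length ?\<beta>) = ?L" "0 < ?R" using k R by simp_all
          then show ?thesis
            unfolding Gk
            by (simp add: dds_power_mult \<pi>s_rev_power_mult del: power_Suc length_take length_drop)
        qed
        finally show ?thesis .
      qed
      have "dds d ?R (X d ^ Suc ?L * word_poly (Suc d) \<omega>) = dds d ?R (\<pi>s (Suc d) ?R ?G0)"
        using Cons False by (simp add: \<pi>s_power_mult del: power_Suc)
      also have "\<dots> = \<pi>s d ?R (dds (Suc d) ?R ?G0) + (\<Sum>a<?R. ?t a)"
        by (rule dds_\<pi>s_expand)
      also have "dds (Suc d) ?R ?G0 = X d ^ Suc ?L * row_poly (Suc d) [False] \<omega>'"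
        by (simp only: dds_power_mult[OF lessI] IH)
      also have "(\<Sum>a<?R. ?t a) = \<pi>s d ?R (X d ^ Suc ?L * (\<Sum>k\<in>{k. k < ?L \<and> \<omega>' ! k}. ?u k))"
        unfolding sum_cntT_take sum_distrib_left \<pi>s_sum by (rule sum.cong) (use t in auto)
      also have "\<pi>s d ?R (X d ^ Suc ?L * row_poly (Suc d) [False] \<omega>') + \<dots> = row_poly d [False] (False # \<omega>')"
        by (simp add: distrib_left \<pi>s_add del: power_Suc \<pi>s.simps)
      finally show ?thesis using Cons False by (simp del: word_poly.simps power_Suc)
    qed
  qed
qed

corollary dds_word_poly_general:
  "dds (d + cntT \<sigma>) (cntT \<omega>) (word_poly d (\<sigma> @ True # \<omega>))
     = \<pi>s_rev (d + cntT \<sigma> + cntT \<omega>) (cntF \<sigma>) (row_poly d (\<sigma> @ [False]) \<omega>)"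
  by (rule dds_word_poly_marked) (rule dds_word_poly)

subsection \<open>Descending chains of operators\<close>

text \<open>Operator, bound and start are parameters, so that one notion serves both families of
  polynomials as well as label words. The length is recorded for the induction in the exchange
  property.\<close>

inductive chain :: "(nat \<Rightarrow> 'a \<Rightarrow> 'a) \<Rightarrow> nat \<Rightarrow> (nat \<Rightarrow> nat) \<Rightarrow> 'a \<Rightarrow> nat \<Rightarrow> (nat \<Rightarrow> nat) \<Rightarrow> 'a \<Rightarrow> bool"
  for D m w\<^sub>0 f\<^sub>0 where
  start: "chain D m w\<^sub>0 f\<^sub>0 0 w\<^sub>0 f\<^sub>0"
| step: "chain D m w\<^sub>0 f\<^sub>0 (Suc k) (w \<circ> transpose i (Suc i)) (D i f)"
    if "chain D m w\<^sub>0 f\<^sub>0 k w f" "1 \<le> i" "i < m" "w (Suc i) < w i"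

definition decreasing :: "nat \<Rightarrow> (nat \<Rightarrow> nat) \<Rightarrow> bool" where
  "decreasing m w \<longleftrightarrow> (\<forall>i. 1 \<le> i \<and> i < m \<longrightarrow> w (Suc i) < w i)"

lemma comp_transpose_twice [simp]: "w \<circ> transpose i j \<circ> transpose i j = w"
  by (simp add: comp_assoc)

text \<open>Exchange property: at an ascent i the chain may be chosen to end with the step i. If it
  ends with j, the relation between the operators i and j rebuilds its end; the empty chain is
  excluded because \<open>w\<^sub>0\<close> has no ascent.\<close>

lemma chain_exchange:
  fixes D :: "nat \<Rightarrow> 'a \<Rightarrow> 'a"
  assumes comm: "\<And>i j f. i + 1 < j \<or> j + 1 < i \<Longrightarrow> D i (D j f) = D j (D i f)"
    and braid: "\<And>i f. D i (D (Suc i) (D i f)) = D (Suc i) (D i (D (Suc i) f))"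
    and dec: "decreasing m w\<^sub>0"
  shows "chain D m w\<^sub>0 f\<^sub>0 k w f \<Longrightarrow> 1 \<le> i \<Longrightarrow> i < m \<Longrightarrow> w i < w (Suc i) \<Longrightarrow>
    \<exists>l g. k = Suc l \<and> f = D i g \<and> chain D m w\<^sub>0 f\<^sub>0 l (w \<circ> transpose i (Suc i)) g"
proof (induction k arbitrary: w f i rule: less_induct)
  case (less k)
  let ?s = "\<lambda>i. transpose i (Suc i)"
  from less.prems(1) show ?case
  proof cases
    case start
    then show ?thesis using dec less.prems unfolding decreasing_def by (meson less_asym)
  next
    case (step k1 w1 f1 j)
    have w1: "w1 = w \<circ> ?s j" using step by simp
    consider "i = j" | "i + 1 < j \<or> j + 1 < i" | "j = Suc i \<or> i = Suc j" by linarith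
    then show ?thesis
    proof cases
      case 1
      show ?thesis
      proof (intro exI conjI)
        show "k = Suc k1" "f = D i f1" using step 1 by simp_all
        show "chain D m w\<^sub>0 f\<^sub>0 k1 (w \<circ> ?s i) f1"
          using step(4) 1 by (simp only: step(2) comp_transpose_twice)
      qed
    next
      case 2
      then have "w1 i < w1 (Suc i)"
        using less.prems by (auto simp: w1 transpose_def)
      then obtain l g where g: "k1 = Suc l" "f1 = D i g" "chain D m w\<^sub>0 f\<^sub>0 l (w1 \<circ> ?s i) g"
        using less.IH[of k1 w1 f1 i] step(1,4) less.prems(2,3) by blast
      have "(w1 \<circ> ?s i) (Suc j) < (w1 \<circ> ?s i) j"
        using 2 step(7) by (auto simp: transpose_def)
      from chain.step[OF g(3) step(5,6) this]
      have "chain D m w\<^sub>0 f\<^sub>0 (Suc l) (w1 \<circ> ?s i \<circ> ?s j) (D j g)" .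
      moreover have "w1 \<circ> ?s i \<circ> ?s j = w \<circ> ?s i"
        using 2 by (auto simp: w1 fun_eq_iff transpose_def)
      ultimately show ?thesis
        using g(1,2) step(1,3) comm[OF 2, of g] by metis
    next
      case 3
      \<comment> \<open>As w increases along three consecutive positions, two uses of the hypothesis
        strip i and j from the chain, which is then rebuilt along the other side of the braid
        relation.\<close>
      have "w1 i < w1 (Suc i)"
        using less.prems step(7) 3 by (auto simp: w1 transpose_def)
      then obtain l g where g: "k1 = Suc l" "f1 = D i g" "chain D m w\<^sub>0 f\<^sub>0 l (w1 \<circ> ?s i) g"
        using less.IH[of k1 w1 f1 i] step(1,4) less.prems(2,3) by blast
      have lk: "l < k" using g(1) step(1) by simp
      have "(w1 \<circ> ?s i) j < (w1 \<circ> ?s i) (Suc j)"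
        using less.prems step(7) 3 by (auto simp: w1 transpose_def)
      then obtain l' h where h: "l = Suc l'" "g = D j h" "chain D m w\<^sub>0 f\<^sub>0 l' (w1 \<circ> ?s i \<circ> ?s j) h"
        using less.IH[OF lk g(3) step(5,6)] by blast
      have "chain D m w\<^sub>0 f\<^sub>0 (Suc l') (w1 \<circ> ?s i \<circ> ?s j \<circ> ?s i) (D i h)"
        by (rule chain.step[OF h(3)]) (use less.prems step(7) 3 in \<open>auto simp: w1 transpose_def\<close>)
      then have "chain D m w\<^sub>0 f\<^sub>0 (Suc (Suc l')) (w1 \<circ> ?s i \<circ> ?s j \<circ> ?s i \<circ> ?s j) (D j (D i h))"
        by (rule chain.step) (use less.prems step(5-7) 3 in \<open>auto simp: w1 transpose_def\<close>)
      moreover have "w1 \<circ> ?s i \<circ> ?s j \<circ> ?s i \<circ> ?s j = w \<circ> ?s i"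
        using 3 by (elim disjE) (simp_all add: w1 fun_eq_iff transpose_def)
      moreover have "D j (D i (D j h)) = D i (D j (D i h))"
        using 3 braid[of i h] braid[of j h] by auto
      ultimately show ?thesis
        using g(1,2) h(1,2) step(1,3) by metis
    qed
  qed
qed

text \<open>By the exchange property a second chain may be taken to end with the same step as the
  first.\<close>

lemma chain_unique:
  fixes D :: "nat \<Rightarrow> 'a \<Rightarrow> 'a"
  assumes comm: "\<And>i j f. i + 1 < j \<or> j + 1 < i \<Longrightarrow> D i (D j f) = D j (D i f)"
    and braid: "\<And>i f. D i (D (Suc i) (D i f)) = D (Suc i) (D i (D (Suc i) f))"
    and dec: "decreasing m w\<^sub>0"
  shows "chain D m w\<^sub>0 f\<^sub>0 k w f \<Longrightarrow> chain D m w\<^sub>0 f\<^sub>0 l w g \<Longrightarrow> f = g"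
proof (induction k w f arbitrary: l g rule: chain.induct)
  case start
  then show ?case
  proof cases
    case (step k w f i)
    have "w\<^sub>0 i < w\<^sub>0 (Suc i)"
      unfolding step(2) using step(7) by simp
    with dec step(5,6) show ?thesis unfolding decreasing_def by (meson less_asym)
  qed simp
next
  case (step k w f i)
  have "(w \<circ> transpose i (Suc i)) i < (w \<circ> transpose i (Suc i)) (Suc i)"
    using step by simp
  with chain_exchange[OF comm braid dec step.prems step.hyps(2,3)]
  obtain l' g' where g': "g = D i g'" "chain D m w\<^sub>0 f\<^sub>0 l' (w \<circ> transpose i (Suc i) \<circ> transpose i (Suc i)) g'"
    by blast
  from step.IH[OF g'(2)[unfolded comp_transpose_twice]] g'(1) show ?case by simp
qed

text \<open>The columns of a label word agree with a permutation only on the labels, so chains have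
  to be transported between functions that differ elsewhere.\<close>

lemma chain_cong:
  assumes "chain D m w\<^sub>0 f\<^sub>0 k w f" "\<And>i. i \<in> {1..m} \<Longrightarrow> v\<^sub>0 i = w\<^sub>0 i"
  obtains v where "chain D m v\<^sub>0 f\<^sub>0 k v f" "\<And>i. i \<in> {1..m} \<Longrightarrow> v i = w i" "\<And>i. i \<notin> {1..m} \<Longrightarrow> v i = v\<^sub>0 i"
proof -
  from assms have "\<exists>v. chain D m v\<^sub>0 f\<^sub>0 k v f \<and> (\<forall>i\<in>{1..m}. v i = w i) \<and> (\<forall>i. i \<notin> {1..m} \<longrightarrow> v i = v\<^sub>0 i)"
  proof (induction rule: chain.induct)
    case start
    then show ?case by (auto intro: chain.start)
  next
    case (step k w f i)
    then obtain v where v: "chain D m v\<^sub>0 f\<^sub>0 k v f" "\<forall>i\<in>{1..m}. v i = w i" "\<forall>i. i \<notin> {1..m} \<longrightarrow> v i = v\<^sub>0 i"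
      by blast
    have "chain D m v\<^sub>0 f\<^sub>0 (Suc k) (v \<circ> transpose i (Suc i)) (D i f)"
      by (rule chain.step[OF v(1)]) (use step v in auto)
    moreover have "(v \<circ> transpose i (Suc i)) j = (w \<circ> transpose i (Suc i)) j" if "j \<in> {1..m}" for j
      using v step that by (auto simp: transpose_def)
    moreover have "(v \<circ> transpose i (Suc i)) j = v\<^sub>0 j" if "j \<notin> {1..m}" for j
      using v step that by (auto simp: transpose_def)
    ultimately show ?case
      by blast
  qed
  with that show ?thesis by blast
qed

text \<open>Swapping an ascent lowers the sum of i w(i), so the induction ends at a decreasing
  function. An invariant Q takes the place of permutations, because functions giving the columns of
  labels are sorted too.\<close>

lemma bubble_sort_induct [consumes 1, case_names inj swap decreasing ascent]:
  assumes "Q w"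
    and inj: "\<And>w. Q w \<Longrightarrow> inj_on w {1..m}"
    and swap: "\<And>w i. Q w \<Longrightarrow> 1 \<le> i \<Longrightarrow> i < m \<Longrightarrow> Q (w \<circ> transpose i (Suc i))"
    and decreasing: "\<And>w. Q w \<Longrightarrow> decreasing m w \<Longrightarrow> P w"
    and ascent: "\<And>w i. Q w \<Longrightarrow> 1 \<le> i \<Longrightarrow> i < m \<Longrightarrow> w i < w (Suc i) \<Longrightarrow> P (w \<circ> transpose i (Suc i)) \<Longrightarrow> P w"
  shows "P w"
  using \<open>Q w\<close>
proof (induction "\<Sum>i\<in>{1..m}. i * w i" arbitrary: w rule: less_induct)
  case less
  show ?case
  proof (cases "decreasing m w")
    case True
    then show ?thesis using decreasing less by blast
  next
    case False
    then obtain i where i: "1 \<le> i" "i < m" "\<not> w (Suc i) < w i"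
      by (auto simp: decreasing_def)
    have "w i \<noteq> w (Suc i)"
      using inj_onD[OF inj[OF less.prems], of i "Suc i"] i by auto
    with i have asc: "w i < w (Suc i)" by simp
    let ?v = "w \<circ> transpose i (Suc i)"
    have split: "{1..m} = insert i (insert (Suc i) ({1..m} - {i, Suc i}))"
      using i by auto
    have "(\<Sum>j\<in>{1..m} - {i, Suc i}. j * ?v j) = (\<Sum>j\<in>{1..m} - {i, Suc i}. j * w j)"
      by (rule sum.cong) (auto simp: transpose_def)
    moreover have "i * ?v i + Suc i * ?v (Suc i) < i * w i + Suc i * w (Suc i)"
      using asc by (simp add: algebra_simps)
    ultimately have "(\<Sum>j\<in>{1..m}. j * ?v j) < (\<Sum>j\<in>{1..m}. j * w j)"
      by (subst (1 2) split) simp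
    with less.hyps[OF this] swap[OF less.prems i(1,2)] ascent[OF less.prems i(1,2) asc]
    show ?thesis by blast
  qed
qed

subsection \<open>Schubert and Grothendieck polynomials are well defined\<close>

lemma decreasing_longest_perm: "decreasing n (longest_perm n)"
  by (auto simp: decreasing_def longest_perm_def)

lemma decreasing_permutes:
  assumes "w permutes {1..n}" "decreasing n w"
  shows "w = longest_perm n"
proof
  fix i
  have lower: "i \<in> {1..n} \<Longrightarrow> w i \<ge> n + 1 - i" for i
  proof (induction "n - i" arbitrary: i)
    case 0
    then show ?case using permutes_in_image[OF assms(1), of i] by auto
  next
    case (Suc k)
    then have "w (Suc i) \<ge> n + 1 - Suc i"
      by (intro Suc.hyps(1)) auto
    moreover have "w (Suc i) < w i"
      using assms(2) Suc by (auto simp: decreasing_def)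
    ultimately show ?case by simp
  qed
  have upper: "i \<in> {1..n} \<Longrightarrow> w i \<le> n + 1 - i" for i
  proof (induction i)
    case (Suc i)
    show ?case
    proof (cases "i = 0")
      case True
      then show ?thesis using permutes_in_image[OF assms(1), of "Suc i"] Suc.prems by auto
    next
      case False
      then have "w i \<le> n + 1 - i" "w (Suc i) < w i"
        using assms(2) Suc by (auto simp: decreasing_def)
      then show ?thesis by simp
    qed
  qed simp
  show "w i = longest_perm n i"
  proof (cases "i \<in> {1..n}")
    case True
    then show ?thesis using lower[OF True] upper[OF True] by (simp add: longest_perm_def)
  next
    case False
    then show ?thesis using permutes_not_in[OF assms(1) False] by (auto simp: longest_perm_def)
  qed
qed

lemma permutes_comp_transpose:
  "w permutes {1..n} \<Longrightarrow> 1 \<le> i \<Longrightarrow> i < n \<Longrightarrow> w \<circ> transpose i (Suc i) permutes {1..n}"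
  by (rule permutes_compose[OF permutes_swap_id]) auto

lemma chain_exists:
  assumes "w permutes {1..n}"
  shows "\<exists>k f. chain D n (longest_perm n) f\<^sub>0 k w f"
  using assms
proof (induction w rule: bubble_sort_induct[where m = n])
  case (inj w)
  then show ?case by (meson permutes_inj inj_on_subset subset_UNIV)
next
  case (swap w i)
  then show ?case by (rule permutes_comp_transpose)
next
  case (decreasing w)
  then show ?case using decreasing_permutes chain.start by metis
next
  case (ascent w i)
  then obtain k f where "chain D n (longest_perm n) f\<^sub>0 k (w \<circ> transpose i (Suc i)) f" by blast
  from chain.step[OF this ascent(2,3)] ascent(4)
  have "chain D n (longest_perm n) f\<^sub>0 (Suc k) w (D i f)" by simp
  then show ?case by blast
qed

lemma is_schubert_iff_chain:
  "is_schubert n w f \<longleftrightarrow> (\<exists>k. chain \<partial> n (longest_perm n) (staircase n) k w f)"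
proof
  show "is_schubert n w f \<Longrightarrow> \<exists>k. chain \<partial> n (longest_perm n) (staircase n) k w f"
  proof (induction rule: is_schubert.induct)
    case (descend w f i)
    then show ?case by (metis Suc_eq_plus1 chain.step)
  qed (intro exI, rule chain.start)
  have "chain \<partial> n (longest_perm n) (staircase n) k w f \<Longrightarrow> is_schubert n w f" for k
  proof (induction rule: chain.induct)
    case (step k w f i)
    then show ?case using is_schubert.descend[of n w f i] by (simp only: Suc_eq_plus1)
  qed (rule is_schubert.longest)
  then show "\<exists>k. chain \<partial> n (longest_perm n) (staircase n) k w f \<Longrightarrow> is_schubert n w f"
    by blast
qed

lemma is_grothendieck_iff_chain:
  "is_grothendieck n w f \<longleftrightarrow> (\<exists>k. chain \<pi> n (longest_perm n) (staircase n) k w f)"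
proof
  show "is_grothendieck n w f \<Longrightarrow> \<exists>k. chain \<pi> n (longest_perm n) (staircase n) k w f"
  proof (induction rule: is_grothendieck.induct)
    case (descend w f i)
    then show ?case unfolding \<pi>_plus1 by (metis Suc_eq_plus1 chain.step)
  qed (intro exI, rule chain.start)
  have "chain \<pi> n (longest_perm n) (staircase n) k w f \<Longrightarrow> is_grothendieck n w f" for k
  proof (induction rule: chain.induct)
    case (step k w f i)
    then show ?case using is_grothendieck.descend[of n w f i] unfolding \<pi>_plus1 by (simp only: Suc_eq_plus1)
  qed (rule is_grothendieck.longest)
  then show "\<exists>k. chain \<pi> n (longest_perm n) (staircase n) k w f \<Longrightarrow> is_grothendieck n w f"
    by blast
qed

lemma chain_dd_unique:
  assumes "decreasing m w\<^sub>0" "chain \<partial> m w\<^sub>0 f\<^sub>0 k w f" "chain \<partial> m w\<^sub>0 f\<^sub>0 l w g"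
  shows "f = g"
  by (rule chain_unique[OF dd_commute dd_braid assms])

lemma chain_\<pi>_unique:
  assumes "chain \<pi> n (longest_perm n) f\<^sub>0 k w f" "chain \<pi> n (longest_perm n) f\<^sub>0 l w g"
  shows "f = g"
  by (rule chain_unique[OF \<pi>_commute \<pi>_braid decreasing_longest_perm assms])

lemma chain_\<pi>_exchange:
  assumes "chain \<pi> n (longest_perm n) f\<^sub>0 k w f" "1 \<le> i" "i < n" "w i < w (Suc i)"
  shows "\<exists>l g. k = Suc l \<and> f = \<pi> i g \<and> chain \<pi> n (longest_perm n) f\<^sub>0 l (w \<circ> transpose i (Suc i)) g"
  by (rule chain_exchange[OF \<pi>_commute \<pi>_braid decreasing_longest_perm assms])

lemma schubert_eqI:
  assumes "chain \<partial> n (longest_perm n) (staircase n) k w f"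
  shows "schubert n w = f"
  unfolding schubert_def is_schubert_iff_chain
  using assms chain_dd_unique[OF decreasing_longest_perm] by (intro the_equality) blast+

lemma chain_grothendieck:
  assumes "w permutes {1..n}"
  obtains k where "chain \<pi> n (longest_perm n) (staircase n) k w (grothendieck n w)"
proof -
  obtain k f where f: "chain \<pi> n (longest_perm n) (staircase n) k w f"
    using chain_exists[OF assms, of \<pi> "staircase n"] by blast
  then have "grothendieck n w = f"
    unfolding grothendieck_def is_grothendieck_iff_chain
    using chain_\<pi>_unique by (intro the_equality) blast+
  with f show thesis by (intro that) simp
qed

lemma grothendieck_longest: "grothendieck n (longest_perm n) = staircase n"
proof -
  have "chain \<pi> n (longest_perm n) (staircase n) 0 (longest_perm n) (staircase n)"
    by (rule chain.start)
  then show ?thesis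
    unfolding grothendieck_def is_grothendieck_iff_chain
    using chain_\<pi>_unique by (intro the_equality) blast+
qed

text \<open>At an ascent the polynomial lies in the image of the idempotent \<open>\<pi> i\<close>
  and is fixed. Thus \<open>\<pi> i\<close> acts exactly as a crossing that sorts its two
  labels.\<close>

lemma \<pi>_grothendieck:
  assumes w: "w permutes {1..n}" and i: "1 \<le> i" "i < n"
  shows "\<pi> i (grothendieck n w) = grothendieck n (if w (Suc i) < w i then w \<circ> transpose i (Suc i) else w)"
proof (cases "w (Suc i) < w i")
  case True
  obtain k where "chain \<pi> n (longest_perm n) (staircase n) k w (grothendieck n w)"
    using chain_grothendieck[OF w] .
  from chain.step[OF this i True]
  have "chain \<pi> n (longest_perm n) (staircase n) (Suc k) (w \<circ> transpose i (Suc i)) (\<pi> i (grothendieck n w))" .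
  moreover obtain l where "chain \<pi> n (longest_perm n) (staircase n) l (w \<circ> transpose i (Suc i)) (grothendieck n (w \<circ> transpose i (Suc i)))"
    using chain_grothendieck[OF permutes_comp_transpose[OF w i]] .
  ultimately show ?thesis using True chain_\<pi>_unique by auto
next
  case False
  have "w i \<noteq> w (Suc i)"
    using permutes_inj[OF w] by (simp add: inj_eq)
  with False have "w i < w (Suc i)" by simp
  moreover obtain k where "chain \<pi> n (longest_perm n) (staircase n) k w (grothendieck n w)"
    using chain_grothendieck[OF w] .
  ultimately obtain g where "grothendieck n w = \<pi> i g"
    using chain_\<pi>_exchange i by blast
  with False show ?thesis by simp
qed

subsection \<open>Row transfer on words of labels\<close>

abbreviation cnt0 :: "nat list \<Rightarrow> nat" where "cnt0 \<tau> \<equiv> count_list \<tau> 0"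

text \<open>
  A word lists the exit rows of the pipes along a line, from right to left, with \<open>0\<close> for an edge without
  a pipe. The columns \<open>\<tau>\<close> of row \<open>r + 1\<close> are settled, the pipe \<open>h\<close> (if any) has to reach them from the
  left, and \<open>\<omega>\<close> is the word at the bottom of the remaining columns. A horizontal tile is a
  crossing of the co-BPD and contributes an operator \<open>\<pi>\<close>.
\<close>

fun transfer :: "nat \<Rightarrow> (nat list \<Rightarrow> ipoly) \<Rightarrow> nat list \<Rightarrow> nat \<Rightarrow> nat list \<Rightarrow> ipoly" where
  "transfer r F \<tau> h [] = (if h = 0 then F \<tau> else 0)"
| "transfer r F \<tau> h (b # \<omega>) =
    (if h = 0 then
       if b = 0 then transfer r F (\<tau> @ [0]) 0 \<omega> + (\<Sum>i\<in>set \<omega> - {0}. transfer r F (\<tau> @ [i]) i \<omega>)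
       else transfer r F (\<tau> @ [b]) 0 \<omega>
     else if b = 0 then \<pi> (Suc (r + cnt0 \<tau>)) (transfer r F (\<tau> @ [0]) h \<omega>)
     else if b = h then transfer r F (\<tau> @ [0]) 0 \<omega>
     else if b < h then transfer r F (\<tau> @ [b]) h \<omega>
     else 0)"

text \<open>Labels are exit rows, so the right edge of row \<open>r + 1\<close> carries
  \<open>r + 1\<close>. The base value is the Grothendieck polynomial of w_0.\<close>

fun stack_poly :: "nat \<Rightarrow> nat \<Rightarrow> nat list \<Rightarrow> ipoly" where
  "stack_poly n 0 \<xi> = staircase n"
| "stack_poly n (Suc r) \<xi> = transfer r (stack_poly n r) [] (Suc r) \<xi>"

definition nz :: "nat list \<Rightarrow> nat list" where
  "nz = filter (\<lambda>x. x \<noteq> 0)"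

lemma nz_simps [simp]:
  "nz [] = []" "nz (x # xs) = (if x = 0 then nz xs else x # nz xs)" "nz (xs @ ys) = nz xs @ nz ys"
  "set (nz xs) = set xs - {0}"
  by (auto simp: nz_def)

definition labels :: "nat \<Rightarrow> nat list \<Rightarrow> bool" where
  "labels r \<xi> \<longleftrightarrow> mset (nz \<xi>) = mset [1..<Suc r]"

text \<open>A travelling pipe \<open>h \<le> r\<close> is listed twice, at its exit in \<tau> and at
  its entry in \<omega>; the pipe \<open>r + 1\<close> leaves on the right and is listed
  once.\<close>

definition wf_state :: "nat \<Rightarrow> nat list \<Rightarrow> nat \<Rightarrow> nat list \<Rightarrow> bool" where
  "wf_state r \<tau> h \<omega> \<longleftrightarrow> mset (nz (\<tau> @ \<omega>)) = mset [1..<Suc r] + (if h = 0 then {#} else {#h#})"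

abbreviation restr :: "nat \<Rightarrow> nat list \<Rightarrow> nat list" where
  "restr i \<equiv> filter (\<lambda>x. x = i \<or> x = Suc i)"

abbreviation sw :: "nat \<Rightarrow> nat \<Rightarrow> nat" where "sw i \<equiv> transpose i (Suc i)"

lemma image_mset_sw:
  assumes "1 \<le> i" "Suc i \<le> r"
  shows "image_mset (sw i) (mset [1..<Suc r]) = mset [1..<Suc r]"
proof -
  have "sw i permutes {1..<Suc r}"
    by (rule permutes_swap_id) (use assms in auto)
  then show ?thesis
    by (metis atLeastLessThan_upt distinct_upt image_mset_mset_set mset_set_set permutes_image permutes_inj_on)
qed

lemma sw_0 [simp]: "1 \<le> i \<Longrightarrow> sw i x = 0 \<longleftrightarrow> x = 0"
  by (auto simp: transpose_def)

lemma nz_map_sw: "1 \<le> i \<Longrightarrow> nz (map (sw i) xs) = map (sw i) (nz xs)"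
  by (induction xs) auto

lemma labels_map_sw:
  assumes "1 \<le> i" "Suc i \<le> r" "labels r \<xi>"
  shows "labels r (map (sw i) \<xi>)"
proof -
  have "mset (nz (map (sw i) \<xi>)) = image_mset (sw i) (mset (nz \<xi>))"
    using assms(1) by (simp add: nz_map_sw)
  with assms show ?thesis
    unfolding labels_def using image_mset_sw[OF assms(1,2)] by (simp del: upt_Suc mset_upt)
qed

lemma wf_state_map_sw:
  assumes "1 \<le> i" "Suc i \<le> r" "wf_state r \<tau> h \<omega>"
  shows "wf_state r (map (sw i) \<tau>) (sw i h) (map (sw i) \<omega>)"
proof -
  have "mset (nz (map (sw i) \<tau> @ map (sw i) \<omega>)) = image_mset (sw i) (mset (nz (\<tau> @ \<omega>)))"
    using assms(1) by (simp add: nz_map_sw)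
  also have "\<dots> = mset [1..<Suc r] + (if sw i h = 0 then {#} else {#sw i h#})"
    using assms image_mset_sw[OF assms(1,2)] unfolding wf_state_def by (simp del: upt_Suc mset_upt)
  finally show ?thesis unfolding wf_state_def .
qed

lemma cnt0_map_sw: "1 \<le> i \<Longrightarrow> cnt0 (map (sw i) xs) = cnt0 xs"
  by (induction xs) auto

lemma map_sw_map_sw [simp]: "map (sw i) (map (sw i) xs) = xs"
  by (simp add: comp_def)

lemma restr_map_sw: "restr i (map (sw i) xs) = map (sw i) (restr i xs)"
  by (induction xs) (auto simp: transpose_def)

text \<open>
  The position of the horizontal pipe \<open>h\<close> is that of its occurrence in \<open>\<tau>\<close>, where it leaves the row;
  the last alternative is the pair that crosses in the row.
\<close>

definition in_order :: "nat \<Rightarrow> nat list \<Rightarrow> nat \<Rightarrow> nat list \<Rightarrow> bool" where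
  "in_order i \<tau> h \<omega> \<longleftrightarrow>
     h \<noteq> i \<and> h \<noteq> Suc i \<and> restr i (\<tau> @ \<omega>) = [i, Suc i] \<or>
     h = i \<and> restr i \<tau> = [i] \<and> restr i \<omega> = [i, Suc i] \<or>
     h = i \<and> restr i \<tau> = [i, Suc i] \<and> restr i \<omega> = [i] \<or>
     h = Suc i \<and> restr i \<tau> = [i, Suc i] \<and> restr i \<omega> = [Suc i] \<or>
     h = Suc i \<and> restr i \<tau> = [Suc i] \<and> restr i \<omega> = [i, Suc i]"

text \<open>The column rules see labels only through equality, zero and the comparison
  \<open>b < h\<close>. The exchange of i and i + 1 respects these unless the two labels meet, so
  only the case \<open>pair\<close> needs more than transport.\<close>

lemma transfer_swap:
  assumes i: "1 \<le> i" "Suc i \<le> r"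
    and F: "\<And>\<xi>. length \<xi> = n \<Longrightarrow> labels r \<xi> \<Longrightarrow> restr i \<xi> = [i, Suc i] \<Longrightarrow> F (map (sw i) \<xi>) = \<partial> i (F \<xi>)"
  shows "length \<tau> + length \<omega> = n \<Longrightarrow> wf_state r \<tau> h \<omega> \<Longrightarrow> in_order i \<tau> h \<omega> \<Longrightarrow>
    transfer r F (map (sw i) \<tau>) (sw i h) (map (sw i) \<omega>) = \<partial> i (transfer r F \<tau> h \<omega>)"
proof (induction "length \<omega>" arbitrary: \<tau> h \<omega> rule: less_induct)
  case less
  let ?s = "sw i"
  show ?case
  proof (cases \<omega>)
    case Nil
    then show ?thesis
      using less.prems F[of \<tau>] i by (auto simp: wf_state_def labels_def in_order_def)
  next
    case (Cons b \<omega>')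
    note IH = less.hyps[of \<omega>', unfolded Cons, simplified]
    have len: "length (\<tau> @ [x]) + length \<omega>' = n" for x
      using less.prems(1) Cons by simp
    have nz0: "i \<noteq> 0" using i by simp
    consider (turn) "h = 0" "b = 0" | (vertical) "h = 0" "b \<noteq> 0" | (horizontal) "h \<noteq> 0" "b = 0"
      | (source) "h \<noteq> 0" "b = h" | (pair) "h = Suc i" "b = i" | (blocked) "h = i" "b = Suc i"
      | (cross) "h \<noteq> 0" "b \<noteq> 0" "b \<noteq> h" "\<not> (h \<in> {i, Suc i} \<and> b \<in> {i, Suc i})" by auto
    then show ?thesis
    proof cases
      case turn
      have 1: "transfer r F (map ?s (\<tau> @ [0])) (?s 0) (map ?s \<omega>') = \<partial> i (transfer r F (\<tau> @ [0]) 0 \<omega>')"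
        by (rule IH) (use less.prems turn Cons nz0 in \<open>auto simp: wf_state_def in_order_def\<close>)
      have 2: "transfer r F (map ?s (\<tau> @ [j])) (?s j) (map ?s \<omega>') = \<partial> i (transfer r F (\<tau> @ [j]) j \<omega>')"
        if "j \<in> set \<omega>' - {0}" for j
      proof (rule IH[OF len])
        show "wf_state r (\<tau> @ [j]) j \<omega>'"
          using less.prems(2) turn Cons that by (auto simp: wf_state_def)
        have o: "restr i \<tau> @ restr i \<omega>' = [i, Suc i]"
          using less.prems(3) turn Cons nz0 by (auto simp: in_order_def)
        define R where "R = restr i \<omega>'"
        have "j = i \<Longrightarrow> i \<in> set R" "j = Suc i \<Longrightarrow> Suc i \<in> set R"
          using that by (auto simp: R_def)
        then show "in_order i (\<tau> @ [j]) j \<omega>'"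
          using o unfolding in_order_def filter_append R_def[symmetric]
          by (cases "restr i \<tau>"; cases "tl (restr i \<tau>)") (auto split: if_splits)
      qed
      have "(\<Sum>j\<in>set (map ?s \<omega>') - {0}. transfer r F (map ?s \<tau> @ [j]) j (map ?s \<omega>'))
          = (\<Sum>j\<in>?s ` (set \<omega>' - {0}). transfer r F (map ?s \<tau> @ [j]) j (map ?s \<omega>'))"
        by (rule sum.cong) (use i in \<open>auto simp: image_iff\<close>)
      also have "\<dots> = (\<Sum>j\<in>set \<omega>' - {0}. transfer r F (map ?s \<tau> @ [?s j]) (?s j) (map ?s \<omega>'))"
        by (subst sum.reindex) (auto intro: inj_on_subset[OF inj_transpose])
      also have "\<dots> = \<partial> i (\<Sum>j\<in>set \<omega>' - {0}. transfer r F (\<tau> @ [j]) j \<omega>')"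
        unfolding dd_sum by (rule sum.cong) (use 2 in auto)
      finally show ?thesis
        using 1 turn Cons i by (simp add: dd_add)
    next
      case vertical
      have "transfer r F (map ?s (\<tau> @ [b])) (?s 0) (map ?s \<omega>') = \<partial> i (transfer r F (\<tau> @ [b]) 0 \<omega>')"
        by (rule IH) (use less.prems vertical Cons nz0 in \<open>auto simp: wf_state_def in_order_def\<close>)
      then show ?thesis using vertical Cons i by simp
    next
      case horizontal
      have "transfer r F (map ?s (\<tau> @ [0])) (?s h) (map ?s \<omega>') = \<partial> i (transfer r F (\<tau> @ [0]) h \<omega>')"
        by (rule IH) (use less.prems horizontal Cons nz0 in \<open>auto simp: wf_state_def in_order_def\<close>)
      \<comment> \<open>The operator has index at least \<open>r + 1 > i + 1\<close> and commutes
        with \<open>\<partial> i\<close>; zeros are kept by the exchange, hence so is the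
        index.\<close>
      then show ?thesis
        using horizontal Cons i by (simp add: cnt0_map_sw dd_\<pi>_commute)
    next
      case source
      have "transfer r F (map ?s (\<tau> @ [0])) (?s 0) (map ?s \<omega>') = \<partial> i (transfer r F (\<tau> @ [0]) 0 \<omega>')"
        by (rule IH) (use less.prems source Cons nz0 in \<open>auto simp: wf_state_def in_order_def\<close>)
      then show ?thesis using source Cons i by simp
    next
      case pair
      have w: "wf_state r (\<tau> @ [i]) (Suc i) \<omega>'"
        using less.prems(2) pair Cons by (auto simp: wf_state_def)
      have o: "restr i \<tau> = [Suc i]" "restr i \<omega>' = [Suc i]"
        using less.prems(3) pair Cons by (auto simp: in_order_def)
      \<comment> \<open>With exchanged labels the pipe is blocked and the value is 0. The crossing
        term itself is a value of \<open>\<partial> i\<close>, by the hypothesis for the exchanged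
        state, and is killed as \<open>\<partial> i\<close> squares to zero.\<close>
      have "transfer r F (map ?s (map ?s (\<tau> @ [i]))) (?s i) (map ?s (map ?s \<omega>'))
          = \<partial> i (transfer r F (map ?s (\<tau> @ [i])) i (map ?s \<omega>'))"
      proof (rule less.hyps)
        show "wf_state r (map ?s (\<tau> @ [i])) i (map ?s \<omega>')"
          using wf_state_map_sw[OF i w] by simp
        show "in_order i (map ?s (\<tau> @ [i])) i (map ?s \<omega>')"
          using o unfolding in_order_def by (simp add: restr_map_sw del: map_append)
      qed (use Cons less.prems(1) in auto)
      then have "\<partial> i (transfer r F (\<tau> @ [i]) (Suc i) \<omega>') = 0"
        by simp
      then show ?thesis using pair Cons i by simp
    next
      case blocked
      then show ?thesis using less.prems(3) Cons by (auto simp: in_order_def)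
    next
      case cross
      have "?s b < ?s h \<longleftrightarrow> b < h" "?s b \<noteq> ?s h"
        using cross by (auto simp: transpose_def)
      moreover have "transfer r F (map ?s (\<tau> @ [b])) (?s h) (map ?s \<omega>') = \<partial> i (transfer r F (\<tau> @ [b]) h \<omega>')"
      proof (rule IH[OF len])
        show "wf_state r (\<tau> @ [b]) h \<omega>'"
          using less.prems(2) Cons by (simp add: wf_state_def)
        have "restr i ((\<tau> @ [b]) @ \<omega>') = restr i (\<tau> @ \<omega>)"
          by (simp add: Cons)
        moreover have "h \<in> {i, Suc i} \<Longrightarrow> restr i (\<tau> @ [b]) = restr i \<tau> \<and> restr i \<omega> = restr i \<omega>'"
          using cross(4) by (auto simp: Cons)
        ultimately show "in_order i (\<tau> @ [b]) h \<omega>'"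
          using less.prems(3) unfolding in_order_def by (elim disjE) simp_all
      qed
      ultimately show ?thesis using cross Cons i by simp
    qed
  qed
qed

text \<open>Labels below h cannot stop the pipe, so the tiles up to its elbow are forced: crossings
  at occupied columns, horizontal tiles with their operators at free ones.\<close>

lemma transfer_walk:
  assumes "h \<noteq> 0" "\<And>x. x \<in> set \<alpha> \<Longrightarrow> x < h"
  shows "transfer r F \<tau> h (\<alpha> @ h # \<beta>) = \<pi>s_rev (Suc (r + cnt0 \<tau>)) (cnt0 \<alpha>) (transfer r F (\<tau> @ \<alpha> @ [0]) 0 \<beta>)"
  using assms(2)
proof (induction \<alpha> arbitrary: \<tau>)
  case Nil
  then show ?case using assms(1) by simp
next
  case (Cons x \<alpha>)
  have IH: "transfer r F (\<tau> @ [x]) h (\<alpha> @ h # \<beta>)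
      = \<pi>s_rev (Suc (r + cnt0 (\<tau> @ [x]))) (cnt0 \<alpha>) (transfer r F (\<tau> @ x # \<alpha> @ [0]) 0 \<beta>)"
    using Cons.IH[of "\<tau> @ [x]"] Cons.prems by simp
  have "x < h" using Cons.prems by simp
  then show ?case
    using IH assms(1) by (cases "x = 0") (simp_all add: \<pi>s_rev_Suc_left del: \<pi>s_rev.simps(2))
qed

section \<open>Sorted label words and cyclic relabelling\<close>

fun lab :: "nat \<Rightarrow> bool list \<Rightarrow> nat list" where
  "lab k [] = []"
| "lab k (True # \<omega>) = k # lab (Suc k) \<omega>"
| "lab k (False # \<omega>) = 0 # lab k \<omega>"

lemma length_lab [simp]: "length (lab k \<omega>) = length \<omega>"
  by (induction k \<omega> rule: lab.induct) auto

lemma lab_append: "lab k (\<sigma> @ \<omega>) = lab k \<sigma> @ lab (k + cntT \<sigma>) \<omega>"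
  by (induction k \<sigma> rule: lab.induct) auto

lemma cnt0_lab: "k \<noteq> 0 \<Longrightarrow> cnt0 (lab k \<omega>) = cntF \<omega>"
  by (induction k \<omega> rule: lab.induct) auto

lemma nz_lab: "k \<noteq> 0 \<Longrightarrow> nz (lab k \<omega>) = [k..<k + cntT \<omega>]"
proof (induction k \<omega> rule: lab.induct)
  case (2 k \<omega>)
  then show ?case by (simp add: upt_conv_Cons)
qed auto

lemma set_lab: "k \<noteq> 0 \<Longrightarrow> set (lab k \<omega>) - {0} = {k..<k + cntT \<omega>}"
  using arg_cong[OF nz_lab, of k set \<omega>] by auto

lemma lab_nz: "nz xs = [k..<m] \<Longrightarrow> xs = lab k (map (\<lambda>x. x \<noteq> 0) xs)"
proof (induction xs arbitrary: k)
  case (Cons x xs)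
  show ?case
  proof (cases "x = 0")
    case True
    then show ?thesis using Cons by simp
  next
    case False
    with Cons.prems have "k < m" "x = k" "nz xs = [Suc k..<m]"
      using upt_eq_Cons_conv[of k m x "nz xs"] by auto
    with False Cons.IH show ?thesis by simp
  qed
qed simp

lemma map_neq_lab: "k \<noteq> 0 \<Longrightarrow> map (\<lambda>x. x \<noteq> 0) (lab k \<omega>) = \<omega>"
  by (induction k \<omega> rule: lab.induct) auto

lemma labels_lab: "cntT \<omega> = r \<Longrightarrow> labels r (lab 1 \<omega>)"
  by (simp add: labels_def nz_lab del: upt_Suc mset_upt)

text \<open>The cycle s_(k+t-1) ... s_k, which is performed one exchange at a time at the price of
  one divided difference each.\<close>

definition rot :: "nat \<Rightarrow> nat \<Rightarrow> nat \<Rightarrow> nat" where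
  "rot k t x = (if x = k then k + t else if k < x \<and> x \<le> k + t then x - 1 else x)"

lemma rot_0 [simp]: "rot k 0 = id"
  by (auto simp: rot_def fun_eq_iff)

lemma sw_rot: "sw (k + t) (rot k t x) = rot k (Suc t) x"
  by (auto simp: rot_def transpose_def)

lemma map_rot_Suc: "map (sw (k + t)) (map (rot k t) xs) = map (rot k (Suc t)) xs"
  by (simp add: sw_rot)

lemma restr_pair:
  assumes "nz xs = [a..<m]" "a \<le> p" "p < q" "q < m" "p \<noteq> 0"
  shows "filter (\<lambda>x. x = p \<or> x = q) xs = [p, q]"
proof -
  have "filter (\<lambda>x. x = p \<or> x = q) xs = filter (\<lambda>x. x = p \<or> x = q) (nz xs)"
    unfolding nz_def filter_filter by (rule filter_cong) (use assms in auto)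
  also have "nz xs = [a..<p] @ p # [Suc p..<q] @ q # [Suc q..<m]"
    unfolding assms(1) using assms(2-) upt_add_eq_append[of a p "m - p"] upt_add_eq_append[of "Suc p" q "m - q"]
    by (simp add: upt_conv_Cons del: upt_Suc)
  finally show ?thesis
    using assms(2-) by (auto simp: filter_empty_conv)
qed

text \<open>In the sorted word the two labels were k and k + t + 1; hence the next exchange of the
  cycle meets them in increasing order.\<close>

lemma restr_rot:
  assumes "nz xs = [1..<Suc m]" "1 \<le> k" "k + Suc t \<le> m"
  shows "restr (k + t) (map (rot k t) xs) = [k + t, Suc (k + t)]"
proof -
  have "restr (k + t) (map (rot k t) xs) = map (rot k t) (filter (\<lambda>x. x = k \<or> x = Suc (k + t)) xs)"
    by (simp add: filter_map comp_def) (intro arg_cong[of _ _ "map (rot k t)"] filter_cong; auto simp: rot_def)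
  also have "filter (\<lambda>x. x = k \<or> x = Suc (k + t)) xs = [k, Suc (k + t)]"
    by (rule restr_pair[OF assms(1)]) (use assms in auto)
  also have "map (rot k t) [k, Suc (k + t)] = [k + t, Suc (k + t)]"
    by (simp add: rot_def)
  finally show ?thesis .
qed

lemma map_rot_lab:
  "k + t < j \<Longrightarrow> map (rot k t) (lab j xs) = lab j xs" if "1 \<le> k"
  using that by (induction j xs rule: lab.induct) (auto simp: rot_def)

lemma map_rot_lab_less:
  "j + cntT xs \<le> k \<Longrightarrow> map (rot k t) (lab j xs) = lab j xs" if "1 \<le> k"
  using that by (induction j xs rule: lab.induct) (auto simp: rot_def)

lemma map_rot_lab_shift:
  "k < j \<Longrightarrow> j + cntT xs \<le> Suc (k + t) \<Longrightarrow> map (rot k t) (lab j xs) = lab (j - 1) xs" if "1 \<le> k"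
  using that
proof (induction j xs rule: lab.induct)
  case (2 j \<omega>)
  then have "map (rot k t) (lab (Suc j) \<omega>) = lab (Suc j - 1) \<omega>" by auto
  with 2 show ?case by (cases j) (auto simp: rot_def)
qed (auto simp: rot_def)

lemma dds_\<pi>s_rev_commute: "a + k < b \<Longrightarrow> dds a k (\<pi>s_rev b l f) = \<pi>s_rev b l (dds a k f)"
  by (induction k arbitrary: f) (auto simp: dd_\<pi>s_rev_commute)

lemma bij_cntT_take: "bij_betw (\<lambda>k. K + cntT (take k \<omega>)) {k. k < length \<omega> \<and> \<omega> ! k} {K..<K + cntT \<omega>}"
  (is "bij_betw ?h ?A ?B")
proof -
  have "inj_on ?h ?A"
  proof (rule linorder_inj_onI)
    fix k k' assume k: "k < k'" "k \<in> ?A"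
    then have "take k' \<omega> = take k (take k' \<omega>) @ take k' \<omega> ! k # drop (Suc k) (take k' \<omega>)"
      by (intro id_take_nth_drop) auto
    then have "cntT (take k' \<omega>) = cntT (take k (take k' \<omega>) @ take k' \<omega> ! k # drop (Suc k) (take k' \<omega>))"
      by (rule arg_cong)
    then have "cntT (take k \<omega>) < cntT (take k' \<omega>)"
      using k by (simp add: min_absorb1)
    then show "?h k \<noteq> ?h k'" by simp
  qed auto
  moreover have "?h ` ?A \<subseteq> ?B"
    using cntT_take_less by auto
  moreover have "card ?A = card ?B"
    using sum_cntT_take[of "\<lambda>_. 1 :: nat" \<omega>] by simp
  ultimately show ?thesis
    by (metis (no_types, lifting) bij_betw_def card_image card_subset_eq finite_atLeastLessThan)
qed

text \<open>F stands for the polynomials of stacks of r rows; the assumptions are what the induction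
  on r supplies.\<close>

context
  fixes n r :: nat and F :: "nat list \<Rightarrow> ipoly"
  assumes swap: "\<And>i \<xi>. 1 \<le> i \<Longrightarrow> Suc i \<le> r \<Longrightarrow> length \<xi> = n \<Longrightarrow> labels r \<xi> \<Longrightarrow> restr i \<xi> = [i, Suc i]
      \<Longrightarrow> F (map (sw i) \<xi>) = \<partial> i (F \<xi>)"
    and sorted: "\<And>\<tau>. length \<tau> = n \<Longrightarrow> cntT \<tau> = r \<Longrightarrow> F (lab 1 \<tau>) = word_poly 1 \<tau>"
begin

lemma transfer_rot:
  assumes "length \<tau> + length \<omega> = n" "nz (\<tau> @ \<omega>) = [1..<Suc r]" "1 \<le> k"
  shows "k + t \<le> r \<Longrightarrow> transfer r F (map (rot k t) \<tau>) 0 (map (rot k t) \<omega>) = dds k t (transfer r F \<tau> 0 \<omega>)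
    \<and> wf_state r (map (rot k t) \<tau>) 0 (map (rot k t) \<omega>)"
proof (induction t)
  case 0
  then show ?case using assms(2) by (simp add: wf_state_def)
next
  case (Suc t)
  let ?\<tau> = "map (rot k t) \<tau>" and ?\<omega> = "map (rot k t) \<omega>" and ?i = "k + t"
  have IH: "transfer r F ?\<tau> 0 ?\<omega> = dds k t (transfer r F \<tau> 0 \<omega>)" "wf_state r ?\<tau> 0 ?\<omega>"
    using Suc by auto
  have i: "1 \<le> ?i" "Suc ?i \<le> r"
    using Suc.prems assms(3) by auto
  have sw0: "sw ?i 0 = 0" using i by simp
  have "restr ?i (?\<tau> @ ?\<omega>) = [?i, Suc ?i]"
    using restr_rot[OF assms(2,3), of t] Suc.prems by simp
  then have o: "in_order ?i ?\<tau> 0 ?\<omega>"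
    using i by (auto simp: in_order_def)
  have "transfer r F (map (sw ?i) ?\<tau>) (sw ?i 0) (map (sw ?i) ?\<omega>) = \<partial> ?i (transfer r F ?\<tau> 0 ?\<omega>)"
    by (rule transfer_swap[where F = F and n = n, OF i swap[OF i]]) (use assms o IH(2) in auto)
  with wf_state_map_sw[OF i IH(2)] show ?case
    unfolding sw0 map_rot_Suc IH(1) by simp
qed

text \<open>A pipe turning into a free column puts its label before smaller ones, so the word is no
  longer sorted. Undoing this by a cycle produces the run \<open>dds\<close> in the recursion of
  \<open>row_poly\<close>.\<close>

lemma transfer_lab:
  "length \<tau> + length \<omega> = n \<Longrightarrow> cntT \<tau> + cntT \<omega> = r \<Longrightarrow>
    transfer r F (lab 1 \<tau>) 0 (lab (Suc (cntT \<tau>)) \<omega>) = row_poly 1 \<tau> \<omega>"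
proof (induction "length \<omega>" arbitrary: \<tau> \<omega> rule: less_induct)
  case less
  show ?case
  proof (cases \<omega>)
    case Nil
    then show ?thesis using less.prems sorted by (simp add: row_poly_Nil)
  next
    case (Cons b \<omega>')
    let ?K = "Suc (cntT \<tau>)"
    show ?thesis
    proof (cases b)
      case True
      then show ?thesis
        using less.hyps[of \<omega>' "\<tau> @ [True]"] less.prems Cons by (simp add: lab_append row_poly_True)
    next
      case False
      let ?S = "{k. k < length \<omega>' \<and> \<omega>' ! k}"
      have 1: "transfer r F (lab 1 \<tau> @ [0]) 0 (lab ?K \<omega>') = row_poly 1 (\<tau> @ [False]) \<omega>'"
        using less.hyps[of \<omega>' "\<tau> @ [False]"] less.prems Cons False by (simp add: lab_append)
      have 2: "transfer r F (lab 1 \<tau> @ [?K + cntT (take k \<omega>')]) (?K + cntT (take k \<omega>')) (lab ?K \<omega>')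
        = dds (1 + cntT \<tau>) (cntT (take k \<omega>')) (\<pi>s_rev (1 + cntT \<tau> + cntT \<omega>' + cntF \<tau>) (cntF (take k \<omega>'))
            (row_poly 1 (\<tau> @ True # take k \<omega>' @ [False]) (drop (Suc k) \<omega>')))"
        if k: "k \<in> ?S" for k
      proof -
        let ?\<alpha> = "take k \<omega>'" and ?\<beta> = "drop (Suc k) \<omega>'"
        let ?a = "cntT ?\<alpha>"
        let ?i = "?K + ?a"
        \<comment> \<open>The pattern after the turn: the present column receives the pipe, and the
          column it came from becomes free.\<close>
        let ?t = "\<tau> @ True # ?\<alpha> @ [False]"
        have "\<omega>' = ?\<alpha> @ True # ?\<beta>"
          using k id_take_nth_drop[of k \<omega>'] by simp
        from arg_cong[OF this, of "lab ?K"]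
        have l: "lab ?K \<omega>' = lab ?K ?\<alpha> @ ?i # lab (Suc ?i) ?\<beta>"
          by (simp add: lab_append)
        have cnt: "?a + cntT ?\<beta> + 1 = cntT \<omega>'"
          using cntT_split k by simp
        have r: "cntT \<tau> + cntT \<omega>' = r"
          using less.prems Cons False by simp
        have len: "length ?t + length ?\<beta> = n"
          using less.prems Cons k by auto
        have small: "x < ?i" if "x \<in> set (lab ?K ?\<alpha>)" for x
        proof -
          have "x = 0 \<or> x \<in> {?K..<?K + ?a}"
            using that unfolding set_lab[OF nat.distinct(2), symmetric] by blast
          then show ?thesis by auto
        qed
        have nz: "nz (lab 1 ?t @ lab (Suc ?i) ?\<beta>) = [1..<Suc r]"
        proof -
          have "lab 1 ?t @ lab (Suc ?i) ?\<beta> = lab 1 (?t @ ?\<beta>)"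
            by (simp add: lab_append)
          moreover have "1 + cntT (?t @ ?\<beta>) = Suc r"
            using cnt r by simp
          ultimately show ?thesis
            using nz_lab[of 1 "?t @ ?\<beta>"] by (simp only: one_neq_zero not_False_eq_True)
        qed
        have "transfer r F (map (rot ?K ?a) (lab 1 ?t)) 0 (map (rot ?K ?a) (lab (Suc ?i) ?\<beta>))
            = dds ?K ?a (transfer r F (lab 1 ?t) 0 (lab (Suc ?i) ?\<beta>))"
          using transfer_rot[OF _ nz, of ?K ?a] len cnt r by simp
        \<comment> \<open>The cycle gives the new column the label of the turned pipe and lowers the
          labels of \<open>?\<alpha>\<close> by one, to their values at the bottom edge.\<close>
        moreover have "map (rot ?K ?a) (lab 1 ?t) = lab 1 \<tau> @ ?i # lab ?K ?\<alpha> @ [0]"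
          by (simp add: lab_append map_rot_lab_less map_rot_lab_shift) (simp add: rot_def)
        moreover have "map (rot ?K ?a) (lab (Suc ?i) ?\<beta>) = lab (Suc ?i) ?\<beta>"
          by (simp add: map_rot_lab)
        moreover have "transfer r F (lab 1 ?t) 0 (lab (Suc ?i) ?\<beta>) = row_poly 1 ?t ?\<beta>"
          using less.hyps[of ?\<beta> ?t] len cnt r Cons by simp
        ultimately have "transfer r F (lab 1 \<tau> @ ?i # lab ?K ?\<alpha> @ [0]) 0 (lab (Suc ?i) ?\<beta>) = dds ?K ?a (row_poly 1 ?t ?\<beta>)"
          by simp
        then have "transfer r F (lab 1 \<tau> @ [?i]) ?i (lab ?K \<omega>')
            = \<pi>s_rev (Suc (r + cntF \<tau>)) (cntF ?\<alpha>) (dds ?K ?a (row_poly 1 ?t ?\<beta>))"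
          unfolding l using small by (subst transfer_walk) (auto simp: cnt0_lab)
        also have "\<dots> = dds ?K ?a (\<pi>s_rev (Suc (r + cntF \<tau>)) (cntF ?\<alpha>) (row_poly 1 ?t ?\<beta>))"
          by (rule dds_\<pi>s_rev_commute[symmetric]) (use cnt r in simp)
        finally show ?thesis using r by (simp add: add_ac)
      qed
      have "(\<Sum>i\<in>set (lab ?K \<omega>') - {0}. transfer r F (lab 1 \<tau> @ [i]) i (lab ?K \<omega>'))
          = (\<Sum>k\<in>?S. transfer r F (lab 1 \<tau> @ [?K + cntT (take k \<omega>')]) (?K + cntT (take k \<omega>')) (lab ?K \<omega>'))"
        unfolding set_lab[OF nat.distinct(2)]
        by (rule sum.reindex_bij_betw[OF bij_cntT_take, symmetric])
      also have "\<dots> = (\<Sum>k\<in>?S. dds (1 + cntT \<tau>) (cntT (take k \<omega>')) (\<pi>s_rev (1 + cntT \<tau> + cntT \<omega>' + cntF \<tau>) (cntF (take k \<omega>'))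
            (row_poly 1 (\<tau> @ True # take k \<omega>' @ [False]) (drop (Suc k) \<omega>'))))"
        by (rule sum.cong) (use 2 in auto)
      finally show ?thesis
        using 1 Cons False by (simp add: row_poly_False)
    qed
  qed
qed

text \<open>The new label \<open>r + 1\<close> exceeds all others, so its pipe reaches the right
  edge unhindered.\<close>

lemma transfer_row:
  assumes "length \<sigma> + length \<omega> + 1 = n" "cntT \<sigma> + cntT \<omega> = r"
  shows "transfer r F [] (Suc r) (lab 1 \<sigma> @ Suc r # lab (Suc (cntT \<sigma>)) \<omega>)
    = dds (Suc (cntT \<sigma>)) (cntT \<omega>) (word_poly 1 (\<sigma> @ True # \<omega>))"
proof -
  have "x < Suc r" if "x \<in> set (lab 1 \<sigma>)" for x
  proof -
    have "x = 0 \<or> x \<in> {1..<1 + cntT \<sigma>}"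
      using that unfolding set_lab[OF one_neq_zero, symmetric] by blast
    then show ?thesis using assms(2) by auto
  qed
  then have "transfer r F [] (Suc r) (lab 1 \<sigma> @ Suc r # lab (Suc (cntT \<sigma>)) \<omega>)
      = \<pi>s_rev (Suc r) (cntF \<sigma>) (transfer r F (lab 1 (\<sigma> @ [False])) 0 (lab (Suc (cntT \<sigma>)) \<omega>))"
    by (subst transfer_walk) (auto simp: cnt0_lab lab_append)
  also have "transfer r F (lab 1 (\<sigma> @ [False])) 0 (lab (Suc (cntT \<sigma>)) \<omega>) = row_poly 1 (\<sigma> @ [False]) \<omega>"
    using transfer_lab[of "\<sigma> @ [False]" \<omega>] assms by simp
  also have "\<pi>s_rev (Suc r) (cntF \<sigma>) \<dots> = dds (Suc (cntT \<sigma>)) (cntT \<omega>) (word_poly 1 (\<sigma> @ True # \<omega>))"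
    using dds_word_poly_general[of 1 \<sigma> \<omega>] assms(2) by simp
  finally show ?thesis .
qed

end

subsection \<open>The polynomials of label words are iterated divided differences\<close>

text \<open>Position p of a word, counted from 0, is column n - p; a label missing from a word of
  length n gets column 0.\<close>

definition col_of :: "nat \<Rightarrow> nat list \<Rightarrow> nat \<Rightarrow> nat" where
  "col_of n \<xi> i = n - length (takeWhile (\<lambda>x. x \<noteq> i) \<xi>)"

definition pattern :: "nat list \<Rightarrow> bool list" where
  "pattern = map (\<lambda>x. x \<noteq> 0)"

lemma pattern_simps [simp]:
  "pattern [] = []" "pattern (x # xs) = (x \<noteq> 0) # pattern xs" "pattern (xs @ ys) = pattern xs @ pattern ys"
  "length (pattern xs) = length xs" "k \<noteq> 0 \<Longrightarrow> pattern (lab k \<omega>) = \<omega>"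
  by (auto simp: pattern_def map_neq_lab[unfolded neq0_conv])

lemma col_of_map_sw: "col_of n (map (sw i) \<xi>) = col_of n \<xi> \<circ> sw i"
proof -
  have "sw i x \<noteq> j \<longleftrightarrow> x \<noteq> sw i j" for x j
    by (auto simp: transpose_def)
  then show ?thesis
    by (simp add: col_of_def fun_eq_iff takeWhile_map comp_def)
qed

lemma col_of_less:
  assumes "restr i \<xi> = [i, Suc i]" "length \<xi> \<le> n"
  shows "col_of n \<xi> (Suc i) < col_of n \<xi> i"
proof -
  have "length (takeWhile (\<lambda>x. x \<noteq> i) \<xi>) < length (takeWhile (\<lambda>x. x \<noteq> Suc i) \<xi>)
      \<and> length (takeWhile (\<lambda>x. x \<noteq> i) \<xi>) < length \<xi>"
    using assms(1) by (induction \<xi>) (auto split: if_splits)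
  with assms(2) show ?thesis by (auto simp: col_of_def)
qed

lemma restr_nz: "1 \<le> i \<Longrightarrow> restr i (nz xs) = restr i xs"
  by (induction xs) auto

lemma restr_labels:
  assumes "labels r \<xi>" "1 \<le> i" "Suc i \<le> r"
  shows "restr i \<xi> = [i, Suc i] \<or> restr i \<xi> = [Suc i, i]"
proof -
  have "mset (restr i \<xi>) = filter_mset (\<lambda>x. x = i \<or> x = Suc i) (mset (nz \<xi>))"
    using restr_nz[OF assms(2), of \<xi>] by (metis mset_filter)
  also have "\<dots> = mset (restr i [1..<Suc r])"
    using assms(1) unfolding labels_def by (simp del: upt_Suc mset_upt)
  also have "restr i [1..<Suc r] = [i, Suc i]"
    by (rule restr_pair[of "[1..<Suc r]" 1 "Suc r" i "Suc i"])
      (use assms in \<open>auto simp: nz_def intro!: filter_True\<close>)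
  finally have *: "mset (restr i \<xi>) = {#i, Suc i#}" by simp
  have "length (restr i \<xi>) = Suc (Suc 0)"
    using arg_cong[OF *, of size] unfolding size_mset by simp
  then obtain a b where "restr i \<xi> = [a, b]"
    by (auto simp: length_Suc_conv)
  with * show ?thesis by (auto simp: add_mset_eq_single add_eq_conv_ex)
qed

text \<open>A head larger than k would stand before its predecessor, against the order of that
  pair.\<close>

lemma eq_upt_if_restr:
  "distinct xs \<Longrightarrow> set xs = {k..<m} \<Longrightarrow> (\<And>i. k \<le> i \<Longrightarrow> Suc i < m \<Longrightarrow> restr i xs = [i, Suc i]) \<Longrightarrow> xs = [k..<m]"
proof (induction xs arbitrary: k)
  case Nil
  then show ?case by (metis atLeastLessThan_empty_iff list.set(1) not_less upt_conv_Nil)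
next
  case (Cons x xs)
  have x: "k \<le> x" "x < m" using Cons.prems(2) by auto
  have "x = k"
  proof (rule ccontr)
    assume "x \<noteq> k"
    then obtain y where y: "x = Suc y" "k \<le> y" using x by (cases x) auto
    with Cons.prems(3)[of y] x show False by simp
  qed
  moreover have "xs = [Suc k..<m]"
  proof (rule Cons.IH)
    show "distinct xs" using Cons.prems by simp
    have "set xs = {k..<m} - {k}"
      using Cons.prems(1) \<open>x = k\<close> unfolding Cons.prems(2)[symmetric] by auto
    also have "\<dots> = {Suc k..<m}" by auto
    finally show "set xs = {Suc k..<m}" .
    show "restr i xs = [i, Suc i]" if "Suc k \<le> i" "Suc i < m" for i
      using Cons.prems(3)[of i] that \<open>x = k\<close> by simp
  qed
  ultimately show ?case using x by (simp add: upt_conv_Cons)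
qed

lemma cntT_pattern: "cntT (pattern xs) = length (nz xs)"
  by (induction xs) auto

lemma length_nz_labels: "labels r \<xi> \<Longrightarrow> length (nz \<xi>) = r"
  unfolding labels_def by (drule arg_cong[where f = size]) (simp only: size_mset length_upt diff_Suc_1)

lemma cntT_labels: "labels r \<xi> \<Longrightarrow> cntT (pattern \<xi>) = r"
  by (simp add: cntT_pattern length_nz_labels)

lemma pattern_map_sw: "1 \<le> i \<Longrightarrow> pattern (map (sw i) \<xi>) = pattern \<xi>"
  unfolding pattern_def map_map comp_def by (rule map_cong) (simp_all del: neq0_conv)

lemma set_labels: "labels r \<xi> \<Longrightarrow> set \<xi> - {0} = {1..<Suc r}"
  unfolding labels_def by (drule mset_eq_setD) (simp only: nz_simps set_upt)

lemma distinct_labels: "labels r \<xi> \<Longrightarrow> distinct (nz \<xi>)"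
  unfolding labels_def by (drule mset_eq_imp_distinct_iff) (simp only: distinct_upt)

lemma decreasing_lab:
  assumes "length B = n" "cntT B = r"
  shows "decreasing r (col_of n (lab 1 B))"
  unfolding decreasing_def
proof safe
  fix i assume i: "1 \<le> i" "i < r"
  have "restr i (lab 1 B) = [i, Suc i]"
    by (rule restr_pair[OF nz_lab]) (use i assms in auto)
  then show "col_of n (lab 1 B) (Suc i) < col_of n (lab 1 B) i"
    by (rule col_of_less) (simp add: assms)
qed

lemma inj_on_col_of:
  assumes "length \<xi> = n"
  shows "inj_on (col_of n \<xi>) (set \<xi>)"
proof (rule inj_onI)
  fix x y assume x: "x \<in> set \<xi>" and y: "y \<in> set \<xi>" and eq: "col_of n \<xi> x = col_of n \<xi> y"
  have *: "length (takeWhile (\<lambda>z. z \<noteq> x) \<xi>) < n \<and> \<xi> ! length (takeWhile (\<lambda>z. z \<noteq> x) \<xi>) = x"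
    if "x \<in> set \<xi>" for x
    using that assms by (induction \<xi> arbitrary: n) auto
  from eq *[OF x] *[OF y] have "length (takeWhile (\<lambda>z. z \<noteq> x) \<xi>) = length (takeWhile (\<lambda>z. z \<noteq> y) \<xi>)"
    unfolding col_of_def by linarith
  with *[OF x] *[OF y] show "x = y" by metis
qed

text \<open>The divided difference of the sorting permutation is encoded by a chain from the sorted
  labelling of the same columns, which avoids choosing a reduced word.\<close>

definition label_chain :: "nat \<Rightarrow> nat \<Rightarrow> nat list \<Rightarrow> ipoly \<Rightarrow> bool" where
  "label_chain n r \<xi> f \<longleftrightarrow>
    (\<exists>k. chain \<partial> r (col_of n (lab 1 (pattern \<xi>))) (word_poly 1 (pattern \<xi>)) k (col_of n \<xi>) f)"

lemma label_chain_unique: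
  assumes "label_chain n r \<xi> f" "label_chain n r \<xi> g" "length \<xi> = n" "labels r \<xi>"
  shows "f = g"
  using assms chain_dd_unique decreasing_lab[OF _ cntT_labels] unfolding label_chain_def
  by (metis pattern_simps(4))

lemma label_chain_swap:
  assumes "label_chain n r \<xi> f" "length \<xi> = n" "1 \<le> i" "i < r" "restr i \<xi> = [i, Suc i]"
  shows "label_chain n r (map (sw i) \<xi>) (\<partial> i f)"
proof -
  obtain k where "chain \<partial> r (col_of n (lab 1 (pattern \<xi>))) (word_poly 1 (pattern \<xi>)) k (col_of n \<xi>) f"
    using assms(1) by (auto simp: label_chain_def)
  from chain.step[OF this assms(3,4) col_of_less[OF assms(5)]] assms(2) show ?thesis
    unfolding label_chain_def col_of_map_sw pattern_map_sw[OF assms(3)] by blast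
qed

lemma label_chain_sorted: "length \<omega> = n \<Longrightarrow> label_chain n r (lab 1 \<omega>) (word_poly 1 \<omega>)"
  unfolding label_chain_def by (auto intro!: exI[of _ 0] chain.start simp del: One_nat_def)

text \<open>All columns in decreasing order arise both without pipes and with every column occupied,
  the two ends r = 0 and r = n.\<close>

lemma word_poly_replicate: "word_poly d (replicate m b) = (\<Prod>i<m. X (d + i) ^ (m - Suc i))"
proof (induction m arbitrary: d)
  case (Suc m)
  have "word_poly d (replicate (Suc m) b) = X d ^ m * word_poly (Suc d) (replicate m b)"
    by (cases b) simp_all
  with Suc show ?case by (simp add: prod.lessThan_Suc_shift del: prod.lessThan_Suc)
qed simp

lemma word_poly_staircase: "word_poly 1 (replicate n b) = staircase n"
proof -
  have "(\<Prod>i<n. X (1 + i) ^ (n - Suc i)) = staircase n"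
    unfolding staircase_def
    by (rule prod.reindex_bij_witness[where i = "\<lambda>i. i - 1" and j = Suc]) auto
  then show ?thesis by (simp add: word_poly_replicate)
qed

lemma stack_poly_chain: "length \<xi> = n \<Longrightarrow> labels r \<xi> \<Longrightarrow> label_chain n r \<xi> (stack_poly n r \<xi>)"
proof (induction r arbitrary: \<xi>)
  case 0
  then have z: "\<xi> = replicate n 0"
    using set_labels[OF 0(2)] by (intro replicate_eqI) auto
  have "lab 1 (replicate n False) = replicate n 0"
    by (induction n) auto
  then have "lab 1 (pattern \<xi>) = \<xi>" by (simp add: z pattern_def)
  with chain.start show ?case
    unfolding label_chain_def by (metis stack_poly.simps(1) word_poly_staircase map_replicate pattern_def z)
next
  case (Suc r)
  note chain = Suc.IH
  have swap: "stack_poly n r (map (sw i) \<xi>) = \<partial> i (stack_poly n r \<xi>)"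
    if "1 \<le> i" "Suc i \<le> r" "length \<xi> = n" "labels r \<xi>" "restr i \<xi> = [i, Suc i]" for i \<xi>
    using label_chain_unique[OF chain label_chain_swap[OF chain[OF that(3,4)]]] that labels_map_sw[OF that(1,2,4)]
    by simp
  have sorted: "stack_poly n r (lab 1 \<tau>) = word_poly 1 \<tau>" if "length \<tau> = n" "cntT \<tau> = r" for \<tau>
    using label_chain_unique[OF chain label_chain_sorted[OF that(1)]] labels_lab[OF that(2)] that(1) by simp
  have swap_Suc: "stack_poly n (Suc r) (map (sw i) \<xi>) = \<partial> i (stack_poly n (Suc r) \<xi>)"
    if i: "1 \<le> i" "Suc i \<le> r" and "length \<xi> = n" "labels (Suc r) \<xi>" "restr i \<xi> = [i, Suc i]" for i \<xi>
  proof -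
    have s: "sw i (Suc r) = Suc r" using i by (simp add: transpose_def)
    have "transfer r (stack_poly n r) (map (sw i) []) (sw i (Suc r)) (map (sw i) \<xi>) = \<partial> i (transfer r (stack_poly n r) [] (Suc r) \<xi>)"
      by (rule transfer_swap[where F = "stack_poly n r" and n = n, OF i swap[OF i]])
        (use that in \<open>auto simp: wf_state_def labels_def in_order_def\<close>)
    then show ?thesis by (simp add: s)
  qed
  let ?B = "pattern \<xi>"
  let ?Q = "\<lambda>w. \<exists>\<xi>. length \<xi> = n \<and> labels (Suc r) \<xi> \<and> pattern \<xi> = ?B \<and> w = col_of n \<xi>"
  have "\<forall>\<xi>. length \<xi> = n \<and> labels (Suc r) \<xi> \<and> pattern \<xi> = ?B \<and> w = col_of n \<xi> \<longrightarrow> label_chain n (Suc r) \<xi> (stack_poly n (Suc r) \<xi>)"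
    if "?Q w" for w
    using that
  \<comment> \<open>The bound is r, not r + 1: \<open>transfer_swap\<close> covers exchanges among
    the first r labels, so in the base case the label \<open>r + 1\<close> may stand
    anywhere.\<close>
  proof (induction w rule: bubble_sort_induct[where m = r])
    case (inj w)
    then obtain \<xi> where \<xi>: "length \<xi> = n" "labels (Suc r) \<xi>" "w = col_of n \<xi>" by blast
    have "{1..r} \<subseteq> set \<xi> - {0}" unfolding set_labels[OF \<xi>(2)] by auto
    then have "{1..r} \<subseteq> set \<xi>" by blast
    with inj_on_col_of[OF \<xi>(1)] show ?case unfolding \<xi>(3) by (rule inj_on_subset)
  next
    case (swap w i)
    then obtain \<xi> where \<xi>: "length \<xi> = n" "labels (Suc r) \<xi>" "pattern \<xi> = ?B" "w = col_of n \<xi>" by blast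
    show ?case
      by (rule exI[of _ "map (sw i) \<xi>"])
        (use \<xi> swap labels_map_sw[of i "Suc r" \<xi>] in \<open>auto simp: col_of_map_sw pattern_map_sw\<close>)
  next
    case (ascent w i)
    show ?case
    proof safe
      fix \<xi> :: "nat list" assume \<xi>: "n = length \<xi>" "labels (Suc r) \<xi>" "pattern \<xi> = ?B" "w = col_of (length \<xi>) \<xi>"
      have "restr i \<xi> \<noteq> [i, Suc i]"
        using ascent(4) col_of_less[of i \<xi> n] \<xi> by auto
      then have "restr i \<xi> = [Suc i, i]"
        using restr_labels[OF \<xi>(2), of i] ascent by simp
      then have r: "restr i (map (sw i) \<xi>) = [i, Suc i]"
        unfolding restr_map_sw by simp
      have l: "labels (Suc r) (map (sw i) \<xi>)" "length (map (sw i) \<xi>) = n"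
        using labels_map_sw[of i "Suc r" \<xi>] ascent \<xi> by auto
      have "label_chain n (Suc r) (map (sw i) \<xi>) (stack_poly n (Suc r) (map (sw i) \<xi>))"
        using ascent \<xi> l by (simp add: col_of_map_sw pattern_map_sw)
      from label_chain_swap[OF this l(2) ascent(2) _ r] ascent(3)
      have "label_chain n (Suc r) \<xi> (\<partial> i (stack_poly n (Suc r) (map (sw i) \<xi>)))" by simp
      with swap_Suc[OF ascent(2) _ l(2,1) r] ascent(3)
      show "label_chain (length \<xi>) (Suc r) \<xi> (stack_poly (length \<xi>) (Suc r) \<xi>)"
        using \<xi>(1) by simp
    qed
  next
    case (decreasing w)
    show ?case
    proof safe
      fix \<xi> :: "nat list" assume \<xi>: "n = length \<xi>" "labels (Suc r) \<xi>" "pattern \<xi> = ?B" "w = col_of (length \<xi>) \<xi>"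
      have ord: "restr i \<xi> = [i, Suc i]" if i: "1 \<le> i" "Suc i \<le> r" for i
      proof (rule ccontr)
        assume "restr i \<xi> \<noteq> [i, Suc i]"
        then have "restr i \<xi> = [Suc i, i]"
          using restr_labels[OF \<xi>(2), of i] i by simp
        then have "restr i (map (sw i) \<xi>) = [i, Suc i]"
          unfolding restr_map_sw by simp
        from col_of_less[OF this, of n] \<xi>(1) have "w i < w (Suc i)"
          unfolding col_of_map_sw \<xi>(4) by simp
        moreover have "w (Suc i) < w i"
          using decreasing(2) i unfolding decreasing_def by simp
        ultimately show False by simp
      qed
      have "Suc r \<in> set \<xi> - {0}" unfolding set_labels[OF \<xi>(2)] by auto
      then have "Suc r \<in> set \<xi>" by blast
      then obtain \<alpha> \<beta> where split: "\<xi> = \<alpha> @ Suc r # \<beta>"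
        by (meson split_list)
      let ?xs = "nz \<alpha> @ nz \<beta>"
      have d: "distinct ?xs" "Suc r \<notin> set ?xs"
        using distinct_labels[OF \<xi>(2)] by (auto simp: split)
      have "set ?xs = (set \<xi> - {0}) - {Suc r}"
        using d(2) by (auto simp: split)
      also have "\<dots> = {1..<Suc r}"
        unfolding set_labels[OF \<xi>(2)] by auto
      finally have xs: "?xs = [1..<Suc r]"
      proof (rule eq_upt_if_restr[OF d(1)])
        fix i assume i: "1 \<le> i" "Suc i < Suc r"
        have "restr i ?xs = restr i \<xi>"
          using i by (simp add: split restr_nz)
        with ord i show "restr i ?xs = [i, Suc i]" by simp
      qed
      let ?\<sigma> = "pattern \<alpha>" and ?\<omega> = "pattern \<beta>"
      have ca: "nz \<alpha> = [1..<Suc (cntT ?\<sigma>)]" and cb: "nz \<beta> = [Suc (cntT ?\<sigma>)..<Suc r]"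
        and cnt: "cntT ?\<sigma> + cntT ?\<omega> = r"
      proof -
        have l: "length (nz \<alpha>) + length (nz \<beta>) = r"
          using arg_cong[OF xs, of length] by simp
        then show "cntT ?\<sigma> + cntT ?\<omega> = r" by (simp add: cntT_pattern)
        have "nz \<alpha> = take (length (nz \<alpha>)) [1..<Suc r]" "nz \<beta> = drop (length (nz \<alpha>)) [1..<Suc r]"
          unfolding xs[symmetric] by simp_all
        then show "nz \<alpha> = [1..<Suc (cntT ?\<sigma>)]" "nz \<beta> = [Suc (cntT ?\<sigma>)..<Suc r]"
          using l unfolding cntT_pattern by (simp_all add: take_upt drop_upt del: upt_Suc)
      qed
      have \<alpha>: "\<alpha> = lab 1 ?\<sigma>" and \<beta>: "\<beta> = lab (Suc (cntT ?\<sigma>)) ?\<omega>"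
        using lab_nz[OF ca] lab_nz[OF cb] unfolding pattern_def by simp_all
      have len: "length ?\<sigma> + length ?\<omega> + 1 = n" using \<xi>(1) by (simp add: split)
      let ?k = "Suc (cntT ?\<sigma>)" and ?t = "?\<sigma> @ True # ?\<omega>"
      have eq: "lab 1 ?\<sigma> @ Suc r # lab ?k ?\<omega> = \<xi>"
        by (simp only: \<alpha>[symmetric] \<beta>[symmetric] split)
      have stack_poly: "stack_poly n (Suc r) \<xi> = dds ?k (cntT ?\<omega>) (word_poly 1 ?t)"
        using transfer_row[where F = "stack_poly n r", OF swap sorted len cnt] unfolding eq stack_poly.simps .
      have lt: "length (lab 1 ?t) = n" "cntT ?t = Suc r" "nz (lab 1 ?t) = [1..<Suc (Suc r)]"
        using len cnt nz_lab[of 1 ?t] by (simp_all del: upt_Suc)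
      \<comment> \<open>The chain starts at the fully sorted labelling and raises the label
        \<open>?k\<close> of the new pipe to \<open>r + 1\<close>.\<close>
      have "label_chain n (Suc r) (map (rot ?k t) (lab 1 ?t)) (dds ?k t (word_poly 1 ?t))" if "?k + t \<le> Suc r" for t
        using that
      proof (induction t)
        case 0
        then show ?case using label_chain_sorted[of ?t n "Suc r"] lt(1) by simp
      next
        case (Suc t)
        have "label_chain n (Suc r) (map (sw (?k + t)) (map (rot ?k t) (lab 1 ?t))) (\<partial> (?k + t) (dds ?k t (word_poly 1 ?t)))"
        proof (rule label_chain_swap)
          show "restr (?k + t) (map (rot ?k t) (lab 1 ?t)) = [?k + t, Suc (?k + t)]"
            by (rule restr_rot[OF lt(3)]) (use Suc.prems in auto)
        qed (use Suc lt in auto)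
        then show ?case unfolding map_rot_Suc by simp
      qed
      from this[of "cntT ?\<omega>"] have "label_chain n (Suc r) (map (rot ?k (cntT ?\<omega>)) (lab 1 ?t)) (stack_poly n (Suc r) \<xi>)"
        using cnt stack_poly by simp
      moreover have "map (rot ?k (cntT ?\<omega>)) (lab 1 ?t) = \<xi>"
      proof -
        have "map (rot ?k (cntT ?\<omega>)) (lab 1 ?t) = lab 1 ?\<sigma> @ (?k + cntT ?\<omega>) # lab ?k ?\<omega>"
          by (simp add: lab_append map_rot_lab_less map_rot_lab_shift) (simp add: rot_def)
        also have "\<dots> = \<xi>" using cnt eq by simp
        finally show ?thesis .
      qed
      ultimately show "label_chain (length \<xi>) (Suc r) \<xi> (stack_poly (length \<xi>) (Suc r) \<xi>)"
        using \<xi>(1) by simp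
    qed
  qed
  with Suc.prems show ?case by blast
qed

lemma labels_inv:
  assumes "w permutes {1..n}"
  shows "labels n (map (inv w) (rev [1..<Suc n]))"
    and "pattern (map (inv w) (rev [1..<Suc n])) = replicate n True"
proof -
  let ?\<xi> = "map (inv w) (rev [1..<Suc n])"
  have inv: "inv w permutes {1..n}" by (rule permutes_inv[OF assms])
  have nz: "inv w c \<noteq> 0" if "c \<in> {1..n}" for c
    using permutes_in_image[OF inv, of c] that by auto
  have pat: "pattern ?\<xi> = replicate n True"
    unfolding pattern_def by (rule replicate_eqI) (use nz in auto)
  have "image_mset (inv w) (mset_set {1..n}) = mset_set {1..n}"
    using inv by (metis image_mset_mset_set permutes_image permutes_inj_on)
  moreover have "nz ?\<xi> = ?\<xi>"
    unfolding nz_def by (rule filter_True) (use nz in auto)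
  ultimately have lab: "labels n ?\<xi>"
    unfolding labels_def by (simp add: atLeastLessThanSuc_atLeastAtMost del: upt_Suc)
  show "labels n ?\<xi>" by (rule lab)
  show "pattern ?\<xi> = replicate n True" by (rule pat)
qed

text \<open>Along the bottom edge column c carries the exit row \<open>inv w c\<close>, so looking
  up the column of each label gives back w.\<close>

theorem schubert_eq_stack_poly:
  assumes "w permutes {1..n}"
  shows "schubert n w = stack_poly n n (map (inv w) (rev [1..<Suc n]))"
proof -
  let ?\<xi> = "map (inv w) (rev [1..<Suc n])"
  have inv_eq: "inv w c = i \<longleftrightarrow> c = w i" for c i
    using permutes_inverses[OF assms] by metis
  note pat = labels_inv(2)[OF assms]
  from stack_poly_chain[OF _ labels_inv(1)[OF assms]] obtain k where
    k: "chain \<partial> n (col_of n (lab 1 (replicate n True))) (staircase n) k (col_of n ?\<xi>) (stack_poly n n ?\<xi>)"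
    unfolding label_chain_def pat word_poly_staircase by (auto simp del: upt_Suc)
  have tw: "takeWhile (\<lambda>c. c \<noteq> p) (rev [1..<Suc n]) = rev [Suc p..<Suc n]" if "p \<in> {1..n}" for p
  proof -
    have "rev [1..<Suc n] = rev [Suc p..<Suc n] @ p # rev [1..<p]"
      using that upt_add_eq_append[of 1 p "Suc n - p"] by (simp add: upt_conv_Cons del: upt_Suc)
    then show ?thesis by (subst \<open>rev _ = _\<close>, subst takeWhile_append2) auto
  qed
  have col: "col_of n ?\<xi> i = w i" if "i \<in> {1..n}" for i
  proof -
    have p: "w i \<in> {1..n}" using permutes_in_image[OF assms] that by blast
    have "takeWhile (\<lambda>x. x \<noteq> i) ?\<xi> = map (inv w) (takeWhile (\<lambda>c. c \<noteq> w i) (rev [1..<Suc n]))"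
      by (simp add: takeWhile_map comp_def inv_eq del: upt_Suc)
    then show ?thesis
      using tw[OF p] p by (simp add: col_of_def del: upt_Suc)
  qed
  have long: "longest_perm n i = col_of n (lab 1 (replicate n True)) i" if "i \<in> {1..n}" for i
  proof -
    have "lab j (replicate m True) = [j..<j + m]" for j m
      by (induction m arbitrary: j) (simp_all add: upt_conv_Cons del: upt_Suc)
    moreover have "[1..<Suc n] = [1..<i] @ i # [Suc i..<Suc n]"
      using that upt_add_eq_append[of 1 i "Suc n - i"] by (simp add: upt_conv_Cons del: upt_Suc)
    then have "takeWhile (\<lambda>x. x \<noteq> i) [1..<Suc n] = [1..<i]"
      by (subst \<open>_ = _ @ _\<close>, subst takeWhile_append2) auto
    ultimately show ?thesis
      using that by (simp add: col_of_def longest_perm_def del: upt_Suc)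
  qed
  obtain v where v: "chain \<partial> n (longest_perm n) (staircase n) k v (stack_poly n n ?\<xi>)"
    "\<And>i. i \<in> {1..n} \<Longrightarrow> v i = col_of n ?\<xi> i" "\<And>i. i \<notin> {1..n} \<Longrightarrow> v i = longest_perm n i"
    using chain_cong[OF k long] by blast
  have "v i = w i" for i
  proof (cases "i \<in> {1..n}")
    case True
    then show ?thesis using v(2) col by simp
  next
    case False
    then show ?thesis
      using v(3) permutes_not_in[OF assms False] by (auto simp: longest_perm_def)
  qed
  then have "v = w" by auto
  with schubert_eqI[OF v(1)] show ?thesis by simp
qed

subsection \<open>Expanding the row transfer into tiles\<close>

definition push :: "'a \<Rightarrow> 'b \<Rightarrow> 'a list \<times> 'b list \<Rightarrow> 'a list \<times> 'b list" where
  "push x t = (\<lambda>(\<eta>, ts). (x # \<eta>, t # ts))"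

lemma inj_push: "inj_on (push x t) A"
  by (auto simp: push_def inj_on_def)

text \<open>The recursion of \<open>transfer\<close> stripped of polynomials; it keeps the top word
  together with the tiles.\<close>

fun Rows :: "nat \<Rightarrow> nat list \<Rightarrow> (nat list \<times> tile list) set" where
  "Rows h [] = (if h = 0 then {([], [])} else {})"
| "Rows h (b # \<omega>) =
    (if h = 0 then
       if b = 0 then push 0 Blank ` Rows 0 \<omega> \<union> (\<Union>i\<in>set \<omega> - {0}. push i Elbow_TL ` Rows i \<omega>)
       else push b Vertical ` Rows 0 \<omega>
     else if b = 0 then push 0 Horizontal ` Rows h \<omega>
     else if b = h then push 0 Elbow_BR ` Rows 0 \<omega>
     else if b < h then push b Crossing ` Rows h \<omega>
     else {})"

text \<open>Counts the co-BPD pipes entering the cell from above: the dual tile has a top edge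
  exactly where the BPD tile has none.\<close>

definition no_top :: "tile \<Rightarrow> nat" where
  "no_top t = (if Top \<in> tile_edges t then 0 else 1)"

fun row_op :: "nat \<Rightarrow> tile list \<Rightarrow> ipoly \<Rightarrow> ipoly" where
  "row_op j [] f = f"
| "row_op j (t # ts) f =
    (if t = Horizontal then \<pi> j (row_op (j + no_top t) ts f) else row_op (j + no_top t) ts f)"

lemma finite_Rows [simp]: "finite (Rows h \<omega>)"
  by (induction \<omega> arbitrary: h) auto

lemma row_op_sum: "row_op j ts (sum f A) = (\<Sum>x\<in>A. row_op j ts (f x))"
  by (induction ts arbitrary: j) (simp_all add: \<pi>_sum)

lemma transfer_Rows:
  "transfer r F \<tau> h \<omega> = (\<Sum>(\<eta>, ts)\<in>Rows h \<omega>. row_op (Suc (r + cnt0 \<tau>)) ts (F (\<tau> @ \<eta>)))"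
proof (induction \<omega> arbitrary: \<tau> h)
  case (Cons b \<omega>)
  let ?G = "\<lambda>\<tau> p. case p of (\<eta>, ts) \<Rightarrow> row_op (Suc (r + cnt0 \<tau>)) ts (F (\<tau> @ \<eta>))"
  have push: "(\<Sum>p\<in>push x t ` A. ?G \<tau> p)
      = (\<Sum>(\<eta>, ts)\<in>A. row_op (Suc (r + cnt0 \<tau>)) (t # ts) (F ((\<tau> @ [x]) @ \<eta>)))" for x t A
    by (subst sum.reindex[OF inj_push]) (auto simp: push_def intro!: sum.cong)
  have Union: "(\<Sum>p\<in>(\<Union>i\<in>set \<omega> - {0}. push i Elbow_TL ` Rows i \<omega>). ?G \<tau> p)
      = (\<Sum>i\<in>set \<omega> - {0}. \<Sum>p\<in>push i Elbow_TL ` Rows i \<omega>. ?G \<tau> p)"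
    by (rule sum.UNION_disjoint) (auto simp: push_def)
  have TL: "(\<Sum>p\<in>push i Elbow_TL ` Rows i \<omega>. ?G \<tau> p) = transfer r F (\<tau> @ [i]) i \<omega>" if "i \<noteq> 0" for i
    using that unfolding push Cons by (simp add: no_top_def)
  have Blank: "(\<Sum>p\<in>push 0 Blank ` Rows 0 \<omega>. ?G \<tau> p) = transfer r F (\<tau> @ [0]) 0 \<omega>"
    unfolding push Cons by (simp add: no_top_def)
  have "(\<Sum>p\<in>push 0 Blank ` Rows 0 \<omega> \<union> (\<Union>i\<in>set \<omega> - {0}. push i Elbow_TL ` Rows i \<omega>). ?G \<tau> p)
      = transfer r F (\<tau> @ [0]) 0 \<omega> + (\<Sum>i\<in>set \<omega> - {0}. transfer r F (\<tau> @ [i]) i \<omega>)"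
    by (subst sum.union_disjoint) (auto simp: push_def Blank[unfolded push_def] Union[unfolded push_def] TL[unfolded push_def])
  moreover have "b \<noteq> 0 \<Longrightarrow> (\<Sum>p\<in>push b Vertical ` Rows 0 \<omega>. ?G \<tau> p) = transfer r F (\<tau> @ [b]) 0 \<omega>"
    unfolding push Cons by (simp add: no_top_def)
  moreover have "(\<Sum>p\<in>push 0 Horizontal ` Rows h \<omega>. ?G \<tau> p)
      = \<pi> (Suc (r + cnt0 \<tau>)) (transfer r F (\<tau> @ [0]) h \<omega>)"
    unfolding push Cons \<pi>_sum by (auto simp: no_top_def intro!: sum.cong)
  moreover have "(\<Sum>p\<in>push 0 Elbow_BR ` Rows 0 \<omega>. ?G \<tau> p) = transfer r F (\<tau> @ [0]) 0 \<omega>"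
    unfolding push Cons by (simp add: no_top_def)
  moreover have "b \<noteq> 0 \<Longrightarrow> (\<Sum>p\<in>push b Crossing ` Rows h \<omega>. ?G \<tau> p) = transfer r F (\<tau> @ [b]) h \<omega>"
    unfolding push Cons by (simp add: no_top_def)
  ultimately show ?case
    by (simp del: append.simps)
qed simp

text \<open>
  The arguments after the tile are the labels at its top, right, bottom and left edge. For labels by
  exit rows, \<open>cell\<close> encodes reducedness: at a crossing the pipe that exits further up is the vertical one.
\<close>

definition straight_cell :: "tile \<Rightarrow> nat \<Rightarrow> nat \<Rightarrow> nat \<Rightarrow> nat \<Rightarrow> bool" where
  "straight_cell t x h b l \<longleftrightarrow>
     t = Blank \<and> x = 0 \<and> h = 0 \<and> b = 0 \<and> l = 0 \<or>
     t = Elbow_TL \<and> x = l \<and> l \<noteq> 0 \<and> h = 0 \<and> b = 0 \<or>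
     t = Vertical \<and> x = b \<and> b \<noteq> 0 \<and> h = 0 \<and> l = 0 \<or>
     t = Horizontal \<and> l = h \<and> h \<noteq> 0 \<and> x = 0 \<and> b = 0 \<or>
     t = Elbow_BR \<and> h = b \<and> b \<noteq> 0 \<and> x = 0 \<and> l = 0 \<or>
     t = Crossing \<and> x = b \<and> b \<noteq> 0 \<and> l = h \<and> h \<noteq> 0"

definition cell :: "tile \<Rightarrow> nat \<Rightarrow> nat \<Rightarrow> nat \<Rightarrow> nat \<Rightarrow> bool" where
  "cell t x h b l \<longleftrightarrow> straight_cell t x h b l \<and> (t = Crossing \<longrightarrow> b < h)"

lemma Rows_Cons_cell:
  assumes "(\<zeta>, us) \<in> Rows h (b # \<omega>)"
  obtains x t \<eta> ts l where "\<zeta> = x # \<eta>" "us = t # ts" "(\<eta>, ts) \<in> Rows l \<omega>" "cell t x h b l"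
proof -
  have "\<exists>x t \<eta> ts l. \<zeta> = x # \<eta> \<and> us = t # ts \<and> (\<eta>, ts) \<in> Rows l \<omega> \<and> cell t x h b l"
    using assms by (auto simp: push_def cell_def straight_cell_def split: if_splits)
  with that show thesis by blast
qed

lemma Rows_length: "(\<eta>, ts) \<in> Rows h \<omega> \<Longrightarrow> length \<eta> = length \<omega> \<and> length ts = length \<omega>"
  by (induction \<omega> arbitrary: h \<eta> ts) (auto elim!: Rows_Cons_cell simp del: Rows.simps(2) split: if_splits)

lemma Rows_mset: "(\<eta>, ts) \<in> Rows h \<omega> \<Longrightarrow> mset (nz \<omega>) = mset (nz \<eta>) + (if h = 0 then {#} else {#h#})"
proof (induction \<omega> arbitrary: h \<eta> ts)
  case (Cons b \<omega>)
  from Cons.prems obtain x t \<zeta> us l where "\<eta> = x # \<zeta>" "(\<zeta>, us) \<in> Rows l \<omega>" "cell t x h b l"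
    by (rule Rows_Cons_cell)
  with Cons.IH[of \<zeta> us l] show ?case by (auto simp: cell_def straight_cell_def)
qed (auto split: if_splits)

lemma Rows_ConsI:
  assumes "(\<eta>, ts) \<in> Rows l \<omega>" "cell t x h b l"
  shows "(x # \<eta>, t # ts) \<in> Rows h (b # \<omega>)"
proof -
  have "l \<in> set \<omega>" if "l \<noteq> 0"
  proof -
    have "l \<in># mset (nz \<omega>)" using Rows_mset[OF assms(1)] that by simp
    then show ?thesis by simp
  qed
  moreover have "(x # \<eta>, t # ts) \<in> push x t ` Rows l \<omega>"
    using assms(1) by (force simp: push_def)
  ultimately show ?thesis
    using assms(2) by (auto simp: cell_def straight_cell_def)
qed

lemma Rows_labels: "(\<eta>, ts) \<in> Rows (Suc r) \<omega> \<Longrightarrow> labels (Suc r) \<omega> \<Longrightarrow> labels r \<eta>"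
  using Rows_mset[of \<eta> ts "Suc r" \<omega>] by (auto simp: labels_def)

text \<open>From the left boundary on, tile, left and bottom label fix the rest of a cell. So each
  tiling is counted for one top word only.\<close>

lemma Rows_unique: "(\<eta>, ts) \<in> Rows h \<omega> \<Longrightarrow> (\<eta>', ts) \<in> Rows h' \<omega> \<Longrightarrow> \<eta> = \<eta>' \<and> h = h'"
proof (induction \<omega> arbitrary: h h' \<eta> \<eta>' ts)
  case (Cons b \<omega>)
  from Cons.prems(1) obtain x t \<zeta> us l where 1: "\<eta> = x # \<zeta>" "ts = t # us" "(\<zeta>, us) \<in> Rows l \<omega>" "cell t x h b l"
    by (rule Rows_Cons_cell)
  from Cons.prems(2) obtain x' t' \<zeta>' us' l' where 2: "\<eta>' = x' # \<zeta>'" "ts = t' # us'" "(\<zeta>', us') \<in> Rows l' \<omega>" "cell t' x' h' b l'"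
    by (rule Rows_Cons_cell)
  from Cons.IH[of \<zeta> us l \<zeta>' l'] 1 2 show ?case by (auto simp: cell_def straight_cell_def)
qed (auto split: if_splits)

lemma no_top_cell: "cell t x h b l \<Longrightarrow> no_top t = (if x = 0 then 1 else 0)"
  by (auto simp: cell_def straight_cell_def no_top_def)

text \<open>A pipe on a right edge has turned at an elbow further left, whose top is free. This
  keeps the operator indices below n.\<close>

lemma cnt0_Rows_pos: "(\<eta>, ts) \<in> Rows h \<omega> \<Longrightarrow> h \<noteq> 0 \<Longrightarrow> 1 \<le> cnt0 \<eta>"
proof (induction \<omega> arbitrary: h \<eta> ts)
  case (Cons b \<omega>)
  from Cons.prems(1) obtain x t \<zeta> us l where "\<eta> = x # \<zeta>" "(\<zeta>, us) \<in> Rows l \<omega>" "cell t x h b l"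
    by (rule Rows_Cons_cell)
  with Cons.IH[of \<zeta> us l] Cons.prems(2) show ?case by (auto simp: cell_def straight_cell_def)
qed (auto split: if_splits)

section \<open>Sorting along a row as a 0-Hecke action\<close>

definition sort2 :: "nat \<Rightarrow> (nat \<Rightarrow> nat) \<Rightarrow> nat \<Rightarrow> nat" where
  "sort2 j u = (if u (Suc j) < u j then u \<circ> sw j else u)"

fun row_sort :: "nat \<Rightarrow> tile list \<Rightarrow> (nat \<Rightarrow> nat) \<Rightarrow> nat \<Rightarrow> nat" where
  "row_sort j [] u = u"
| "row_sort j (t # ts) u =
    (if t = Horizontal then sort2 j (row_sort (j + no_top t) ts u) else row_sort (j + no_top t) ts u)"

lemma sort2_permutes: "u permutes {1..n} \<Longrightarrow> 1 \<le> j \<Longrightarrow> j < n \<Longrightarrow> sort2 j u permutes {1..n}"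
  by (simp add: sort2_def permutes_comp_transpose del: One_nat_def)

lemma grothendieck_row_sort:
  "(\<eta>, ts) \<in> Rows h \<omega> \<Longrightarrow> u permutes {1..n} \<Longrightarrow> 1 \<le> j \<Longrightarrow> j + cnt0 \<eta> \<le> Suc n \<Longrightarrow>
    row_sort j ts u permutes {1..n} \<and> grothendieck n (row_sort j ts u) = row_op j ts (grothendieck n u)"
proof (induction \<omega> arbitrary: h j \<eta> ts)
  case (Cons b \<omega>)
  from Cons.prems(1) obtain x t \<zeta> us l where *: "\<eta> = x # \<zeta>" "ts = t # us" "(\<zeta>, us) \<in> Rows l \<omega>" "cell t x h b l"
    by (rule Rows_Cons_cell)
  have IH: "row_sort (j + no_top t) us u permutes {1..n}"
    "grothendieck n (row_sort (j + no_top t) us u) = row_op (j + no_top t) us (grothendieck n u)"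
    using Cons.IH[OF *(3) Cons.prems(2), of "j + no_top t"] Cons.prems(3,4) *(1) no_top_cell[OF *(4)] by auto
  show ?case
  proof (cases "t = Horizontal")
    case True
    then have "x = 0" "l \<noteq> 0" using *(4) by (auto simp: cell_def straight_cell_def)
    \<comment> \<open>The free tops of the horizontal tile and of the elbow to its left make
      \<open>cnt0 \<eta>\<close> at least 2.\<close>
    then have "j < n"
      using cnt0_Rows_pos[OF *(3)] *(1) Cons.prems(4) by auto
    then show ?thesis
      using IH True *(2) Cons.prems(3) \<pi>_grothendieck[OF IH(1), of j]
        sort2_permutes[OF IH(1), of j]
      by (simp add: sort2_def del: One_nat_def)
  next
    case False
    then show ?thesis using IH *(2) by simp
  qed
qed (auto split: if_splits)

fun stacks :: "nat \<Rightarrow> nat list \<Rightarrow> tile list list set" where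
  "stacks 0 \<xi> = (if set \<xi> \<subseteq> {0} then {[]} else {})"
| "stacks (Suc r) \<xi> = (\<lambda>((\<eta>, ts), R). ts # R) ` (SIGMA p:Rows (Suc r) \<xi>. stacks r (fst p))"

text \<open>The head of a stack is its bottom row; as many pipes have left before it as there are
  rows above, so sorting starts one position later.\<close>

fun co_perm :: "nat \<Rightarrow> tile list list \<Rightarrow> nat \<Rightarrow> nat" where
  "co_perm n [] = longest_perm n"
| "co_perm n (ts # R) = row_sort (Suc (length R)) ts (co_perm n R)"

lemma finite_stacks [simp]: "finite (stacks r \<xi>)"
  by (induction r arbitrary: \<xi>) auto

lemma length_stacks: "R \<in> stacks r \<xi> \<Longrightarrow> length R = r"
  by (induction r arbitrary: \<xi> R) (auto split: if_splits)

lemma longest_perm_permutes: "longest_perm n permutes {1..n}"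
proof (rule bij_imp_permutes)
  show "bij_betw (longest_perm n) {1..n} {1..n}"
    by (rule bij_betw_byWitness[where f' = "longest_perm n"]) (auto simp: longest_perm_def)
qed (auto simp: longest_perm_def)

lemma cnt0_labels: "labels r \<xi> \<Longrightarrow> cnt0 \<xi> + r = length \<xi>"
proof -
  have "cnt0 \<xi> + length (nz \<xi>) = length \<xi>" by (induction \<xi>) auto
  then show "labels r \<xi> \<Longrightarrow> ?thesis" by (simp add: length_nz_labels)
qed

theorem sum_stacks:
  assumes "length \<xi> = n" "labels r \<xi>"
  shows "(\<Sum>R\<in>stacks r \<xi>. grothendieck n (co_perm n R)) = stack_poly n r \<xi>"
proof -
  have "(\<forall>R\<in>stacks r \<xi>. co_perm n R permutes {1..n}) \<and> (\<Sum>R\<in>stacks r \<xi>. grothendieck n (co_perm n R)) = stack_poly n r \<xi>"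
    using assms
  proof (induction r arbitrary: \<xi>)
    case 0
    have "set \<xi> - {0} = {}" using set_labels[OF 0(2)] by simp
    then show ?case using longest_perm_permutes by (auto simp: grothendieck_longest)
  next
    case (Suc r)
    have row: "length \<eta> = n" "labels r \<eta>" "Suc r + cnt0 \<eta> \<le> Suc n" if "(\<eta>, ts) \<in> Rows (Suc r) \<xi>" for \<eta> ts
      using Rows_length[OF that] Rows_labels[OF that Suc.prems(2)] Suc.prems(1) cnt0_labels[of r \<eta>] by auto
    have step: "co_perm n (ts # R) permutes {1..n} \<and>
        grothendieck n (co_perm n (ts # R)) = row_op (Suc r) ts (grothendieck n (co_perm n R))"
      if "(\<eta>, ts) \<in> Rows (Suc r) \<xi>" "R \<in> stacks r \<eta>" for \<eta> ts R
      using grothendieck_row_sort[OF that(1), of "co_perm n R" n "Suc r"] Suc.IH[OF row(1,2)[OF that(1)]]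
        row(3)[OF that(1)] that(2) length_stacks[OF that(2)] by simp
    have inj: "inj_on (\<lambda>((\<eta>, ts), R). ts # R) (SIGMA p:Rows (Suc r) \<xi>. stacks r (fst p))"
      using Rows_unique by (fastforce simp: inj_on_def)
    have "(\<Sum>R\<in>stacks (Suc r) \<xi>. grothendieck n (co_perm n R))
        = (\<Sum>((\<eta>, ts), R)\<in>(SIGMA p:Rows (Suc r) \<xi>. stacks r (fst p)). grothendieck n (co_perm n (ts # R)))"
      unfolding stacks.simps by (subst sum.reindex[OF inj]) (auto intro!: sum.cong)
    also have "\<dots> = (\<Sum>p\<in>Rows (Suc r) \<xi>. \<Sum>R\<in>stacks r (fst p). grothendieck n (co_perm n (snd p # R)))"
      by (subst sum.Sigma) (auto intro!: sum.cong)
    also have "\<dots> = (\<Sum>(\<eta>, ts)\<in>Rows (Suc r) \<xi>. row_op (Suc r) ts (stack_poly n r \<eta>))"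
    proof (rule sum.cong[OF refl])
      fix p assume p: "p \<in> Rows (Suc r) \<xi>"
      obtain \<eta> ts where [simp]: "p = (\<eta>, ts)" by fastforce
      have "(\<Sum>R\<in>stacks r \<eta>. grothendieck n (co_perm n (ts # R))) = row_op (Suc r) ts (\<Sum>R\<in>stacks r \<eta>. grothendieck n (co_perm n R))"
        unfolding row_op_sum by (rule sum.cong) (use step p in auto)
      then show "(\<Sum>R\<in>stacks r (fst p). grothendieck n (co_perm n (snd p # R))) = (case p of (\<eta>, ts) \<Rightarrow> row_op (Suc r) ts (stack_poly n r \<eta>))"
        using Suc.IH[OF row(1,2)] p by simp
    qed
    also have "\<dots> = stack_poly n (Suc r) \<xi>"
      by (simp add: transfer_Rows)
    finally show ?case using step by auto
  qed
  then show ?thesis by blast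
qed

subsection \<open>Pipes of a bumpless pipe dream\<close>

text \<open>
  \<open>V r c\<close> and \<open>H r c\<close> are the labels at the bottom and the right edge of the cell \<open>(r, c)\<close>;
  row \<open>0\<close> and column \<open>0\<close> stand for the top and the left boundary.
\<close>

locale bpd_flow =
  fixes n :: nat and T :: "nat \<times> nat \<Rightarrow> tile" and V H :: "nat \<Rightarrow> nat \<Rightarrow> nat"
  assumes cell: "r < n \<Longrightarrow> 1 \<le> c \<Longrightarrow> c \<le> n \<Longrightarrow>
      straight_cell (T (Suc r, c)) (V r c) (H (Suc r) c) (V (Suc r) c) (H (Suc r) (c - 1))"
    and H_left: "H r 0 = 0"
    and V_bottom: "V n c = c"
    and V_top: "1 \<le> c \<Longrightarrow> c \<le> n \<Longrightarrow> V 0 c = 0"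
begin

lemma trace_left:
  "r < n \<Longrightarrow> c \<le> n \<Longrightarrow> H (Suc r) c = y \<Longrightarrow> y \<noteq> 0 \<Longrightarrow>
    \<exists>b. 1 \<le> b \<and> b \<le> c \<and> V (Suc r) b = y \<and> T (Suc r, b) = Elbow_BR \<and>
      (\<forall>d. b < d \<and> d \<le> c \<longrightarrow> H (Suc r) (d - 1) = y \<and> T (Suc r, d) \<in> {Horizontal, Crossing})"
proof (induction c)
  case (Suc c)
  have c: "straight_cell (T (Suc r, Suc c)) (V r (Suc c)) y (V (Suc r) (Suc c)) (H (Suc r) c)"
    using cell[of r "Suc c"] Suc.prems by simp
  show ?case
  proof (cases "T (Suc r, Suc c) = Elbow_BR")
    case True
    then show ?thesis
      using c by (intro exI[of _ "Suc c"]) (auto simp: straight_cell_def)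
  next
    case False
    then have *: "H (Suc r) c = y" "T (Suc r, Suc c) \<in> {Horizontal, Crossing}"
      using c Suc.prems by (auto simp: straight_cell_def)
    then obtain b where "1 \<le> b" "b \<le> c" "V (Suc r) b = y" "T (Suc r, b) = Elbow_BR"
      "\<forall>d. b < d \<and> d \<le> c \<longrightarrow> H (Suc r) (d - 1) = y \<and> T (Suc r, d) \<in> {Horizontal, Crossing}"
      using Suc by auto
    with * show ?thesis
      by (intro exI[of _ b]) (auto simp: le_Suc_eq)
  qed
qed (simp add: H_left)

text \<open>The pipe \<open>y\<close> leaves row \<open>r + 1\<close> at the top of column \<open>c\<close>, or on the right if \<open>c = n + 1\<close>.\<close>

definition leaves :: "nat \<Rightarrow> nat \<Rightarrow> nat \<Rightarrow> bool" where
  "leaves r c y \<longleftrightarrow> 1 \<le> c \<and> c \<le> n \<and> V r c = y \<or> c = Suc n \<and> H (Suc r) n = y"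

lemma leaves_source:
  assumes "r < n" "leaves r c y" "y \<noteq> 0"
  obtains b where "1 \<le> b" "b \<le> n" "V (Suc r) b = y"
    "b = c \<and> T (Suc r, c) \<in> {Vertical, Crossing} \<or>
     b < c \<and> T (Suc r, b) = Elbow_BR \<and> (c \<le> n \<longrightarrow> T (Suc r, c) = Elbow_TL) \<and>
       (\<forall>d. b < d \<and> d < c \<longrightarrow> H (Suc r) (d - 1) = y \<and> T (Suc r, d) \<in> {Horizontal, Crossing})"
proof (cases "c \<le> n")
  case True
  then have c: "1 \<le> c" "V r c = y" using assms by (auto simp: leaves_def)
  note s = cell[OF assms(1) c(1) True, unfolded c(2)]
  show thesis
  proof (cases "T (Suc r, c) = Elbow_TL")
    case TL: True
    then have "H (Suc r) (c - 1) = y" using s by (auto simp: straight_cell_def)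
    moreover have "c - 1 \<le> n" using True by simp
    ultimately obtain b where
      "1 \<le> b" "b \<le> c - 1" "V (Suc r) b = y" "T (Suc r, b) = Elbow_BR"
      "\<forall>d. b < d \<and> d \<le> c - 1 \<longrightarrow> H (Suc r) (d - 1) = y \<and> T (Suc r, d) \<in> {Horizontal, Crossing}"
      using trace_left[OF assms(1) _ _ assms(3), of "c - 1"] by blast
    with TL True c(1) show thesis by (intro that[of b]) auto
  next
    case False
    then show thesis
      using s assms(3) True c by (intro that[of c]) (auto simp: straight_cell_def)
  qed
next
  case False
  then have "c = Suc n" "H (Suc r) n = y" using assms by (auto simp: leaves_def)
  with trace_left[OF assms(1) order_refl this(2) assms(3)] that show thesis
    by (metis Suc_n_not_le_n less_Suc_eq_le)
qed

text \<open>Both exits trace back to one bottom edge. The tile there decides whether the pipe turns,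
  and after turning it meets only horizontal and crossing tiles until it leaves. Injectivity below
  is a premise because \<open>V_inj\<close> climbs with it from row to row.\<close>

lemma leaves_unique_if:
  assumes inj: "\<And>b b'. 1 \<le> b \<Longrightarrow> b \<le> n \<Longrightarrow> 1 \<le> b' \<Longrightarrow> b' \<le> n \<Longrightarrow> V (Suc r) b = V (Suc r) b' \<Longrightarrow> V (Suc r) b \<noteq> 0 \<Longrightarrow> b = b'"
    and "r < n" "leaves r c y" "leaves r c' y" "y \<noteq> 0"
  shows "c = c'"
proof -
  have False if l: "leaves r c y" "leaves r c' y" and less: "c < c'" for c c'
  proof -
    have c: "1 \<le> c" "c \<le> n" using l less by (auto simp: leaves_def)
    obtain b where b: "1 \<le> b" "b \<le> n" "V (Suc r) b = y"
      "b = c \<and> T (Suc r, c) \<in> {Vertical, Crossing} \<or> b < c \<and> T (Suc r, b) = Elbow_BR \<and> T (Suc r, c) = Elbow_TL"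
      using leaves_source[OF \<open>r < n\<close> l(1) \<open>y \<noteq> 0\<close>] c by metis
    obtain b' where b': "1 \<le> b'" "b' \<le> n" "V (Suc r) b' = y"
      "b' = c' \<and> T (Suc r, c') \<in> {Vertical, Crossing} \<or> b' < c' \<and> T (Suc r, b') = Elbow_BR \<and>
       (\<forall>d. b' < d \<and> d < c' \<longrightarrow> T (Suc r, d) \<in> {Horizontal, Crossing})"
      using leaves_source[OF \<open>r < n\<close> l(2) \<open>y \<noteq> 0\<close>] by metis
    have "b = b'" using inj[of b b'] b b' \<open>y \<noteq> 0\<close> by simp
    with b(4) b'(4) less show False by auto
  qed
  then show ?thesis using assms by (metis linorder_neqE_nat)
qed

lemma V_inj:
  "r \<le> n \<Longrightarrow> 1 \<le> c \<Longrightarrow> c \<le> n \<Longrightarrow> 1 \<le> c' \<Longrightarrow> c' \<le> n \<Longrightarrow> V r c = V r c' \<Longrightarrow> V r c \<noteq> 0 \<Longrightarrow> c = c'"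
proof (induction arbitrary: c c' rule: inc_induct)
  case base
  then show ?case by (simp add: V_bottom)
next
  case (step r)
  show ?case
    by (rule leaves_unique_if[OF step.IH \<open>r < n\<close>, of c "V r c"]) (use step.prems in \<open>auto simp: leaves_def\<close>)
qed

lemma leaves_unique: "r < n \<Longrightarrow> leaves r c y \<Longrightarrow> leaves r c' y \<Longrightarrow> y \<noteq> 0 \<Longrightarrow> c = c'"
  by (rule leaves_unique_if[OF V_inj[of "Suc r"]]) auto

text \<open>Within a row pipes move only to the right. If y enters left of x but leaves to its
  right, it runs horizontally through the column where x enters, and that cell is a
  crossing.\<close>

lemma planar:
  assumes "r < n" "leaves r c x" "leaves r c' y" "c < c'" "x \<noteq> y" "x \<noteq> 0" "y \<noteq> 0"
  obtains b b' where "1 \<le> b" "b \<le> n" "1 \<le> b'" "b' \<le> n" "V (Suc r) b = x" "V (Suc r) b' = y"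
    "b < b' \<or> b' < b \<and> T (Suc r, b) = Crossing \<and> H (Suc r) (b - 1) = y"
proof -
  obtain b where b: "1 \<le> b" "b \<le> n" "V (Suc r) b = x" "b \<le> c"
    using leaves_source[OF assms(1,2,6)] by (metis less_or_eq_imp_le)
  obtain b' where b': "1 \<le> b'" "b' \<le> n" "V (Suc r) b' = y"
    "b' = c' \<and> T (Suc r, c') \<in> {Vertical, Crossing} \<or> b' < c' \<and>
     (\<forall>d. b' < d \<and> d < c' \<longrightarrow> H (Suc r) (d - 1) = y \<and> T (Suc r, d) \<in> {Horizontal, Crossing})"
    using leaves_source[OF assms(1,3,7)] by metis
  have "b \<noteq> b'" using b b' assms by auto
  moreover have "T (Suc r, b) = Crossing \<and> H (Suc r) (b - 1) = y" if "b' < b"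
  proof -
    have *: "H (Suc r) (b - 1) = y" "T (Suc r, b) \<in> {Horizontal, Crossing}"
      using b'(4) b(4) assms(4) that by auto
    then show ?thesis
      using cell[OF assms(1) b(1,2)] b(3) assms(6) by (auto simp: straight_cell_def)
  qed
  ultimately show thesis
    using that b b' by (metis linorder_neqE_nat)
qed

lemma H_leaves:
  assumes "r < n" "y \<noteq> 0"
  shows "c \<le> n \<Longrightarrow> H (Suc r) c = y \<Longrightarrow> \<exists>c'. c < c' \<and> leaves r c' y"
proof (induction c rule: inc_induct)
  case base
  then show ?case by (auto simp: leaves_def)
next
  case (step c)
  have "straight_cell (T (Suc r, Suc c)) (V r (Suc c)) (H (Suc r) (Suc c)) (V (Suc r) (Suc c)) y"
    using cell[OF assms(1), of "Suc c"] step by simp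
  then have "V r (Suc c) = y \<or> H (Suc r) (Suc c) = y"
    using assms(2) by (auto simp: straight_cell_def)
  then show ?case
  proof
    assume "V r (Suc c) = y"
    then show ?thesis using step.hyps by (intro exI[of _ "Suc c"]) (auto simp: leaves_def)
  next
    assume "H (Suc r) (Suc c) = y"
    with step.IH show ?thesis by (meson Suc_lessD)
  qed
qed

lemma V_present_below:
  "r \<le> r' \<Longrightarrow> r' \<le> n \<Longrightarrow> 1 \<le> c \<Longrightarrow> c \<le> n \<Longrightarrow> V r c = y \<Longrightarrow> y \<noteq> 0 \<Longrightarrow> \<exists>b. 1 \<le> b \<and> b \<le> n \<and> V r' b = y"
proof (induction r' rule: dec_induct)
  case (step r')
  then obtain b where "1 \<le> b" "b \<le> n" "V r' b = y" by auto
  then have "leaves r' b y" by (simp add: leaves_def)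
  with leaves_source[of r' b y] step show ?case by (metis Suc_le_lessD)
qed auto

lemma V_range: "r \<le> n \<Longrightarrow> 1 \<le> c \<Longrightarrow> c \<le> n \<Longrightarrow> V r c \<noteq> 0 \<Longrightarrow> V r c \<in> {1..n}"
  using V_present_below[of r n c "V r c"] by (auto simp: V_bottom)

lemma H_source:
  assumes "r < n" "c \<le> n" "H (Suc r) c \<noteq> 0"
  obtains b where "1 \<le> b" "b \<le> c" "V (Suc r) b = H (Suc r) c"
  using trace_left[OF assms(1,2) refl assms(3)] by blast

lemma Crossing_labels:
  assumes "r < n" "1 \<le> c" "c \<le> n" "T (Suc r, c) = Crossing"
  shows "H (Suc r) (c - 1) \<noteq> 0" "V (Suc r) c \<noteq> 0" "V r c = V (Suc r) c"
    "H (Suc r) c = H (Suc r) (c - 1)"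
    "\<exists>b. 1 \<le> b \<and> b < c \<and> V (Suc r) b = H (Suc r) (c - 1)"
    "H (Suc r) (c - 1) \<noteq> V (Suc r) c"
proof -
  show *: "H (Suc r) (c - 1) \<noteq> 0" "V (Suc r) c \<noteq> 0" "V r c = V (Suc r) c" "H (Suc r) c = H (Suc r) (c - 1)"
    using cell[OF assms(1-3)] assms(4) by (auto simp: straight_cell_def)
  obtain b where b: "1 \<le> b" "b \<le> c - 1" "V (Suc r) b = H (Suc r) (c - 1)"
    using H_source[OF assms(1) _ *(1)] assms(3) by (metis diff_le_self le_trans)
  then show "\<exists>b. 1 \<le> b \<and> b < c \<and> V (Suc r) b = H (Suc r) (c - 1)"
    using assms(2) by (intro exI[of _ b]) auto
  have "b < c" "b \<le> n" using b(2) assms(2,3) by linarith+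
  then show "H (Suc r) (c - 1) \<noteq> V (Suc r) c"
    using V_inj[of "Suc r" b c] b assms *(2) by auto
qed

section \<open>Reducedness as a local condition on crossings\<close>

definition crosses_at :: "nat \<Rightarrow> nat \<Rightarrow> nat \<Rightarrow> nat \<Rightarrow> bool" where
  "crosses_at x y r c \<longleftrightarrow> r < n \<and> 1 \<le> c \<and> c \<le> n \<and> T (Suc r, c) = Crossing \<and>
     {H (Suc r) (c - 1), V (Suc r) c} = {x, y}"

definition sorted_crossings :: bool where
  "sorted_crossings \<longleftrightarrow> (\<forall>r c. r < n \<and> 1 \<le> c \<and> c \<le> n \<and> T (Suc r, c) = Crossing \<longrightarrow> H (Suc r) (c - 1) < V (Suc r) c)"

text \<open>Entry labels increase along the bottom edge, so an inversion higher up stems from a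
  crossing below, where by \<open>planar\<close> the pipe y runs horizontally.\<close>

lemma crossed_below:
  "r \<le> n \<Longrightarrow> 1 \<le> c \<Longrightarrow> c < c' \<Longrightarrow> c' \<le> n \<Longrightarrow> V r c = x \<Longrightarrow> V r c' = y \<Longrightarrow> y < x \<Longrightarrow> y \<noteq> 0 \<Longrightarrow>
    \<exists>r' d. r \<le> r' \<and> crosses_at x y r' d \<and> H (Suc r') (d - 1) = y"
proof (induction arbitrary: c c' rule: inc_induct)
  case base
  then show ?case by (simp add: V_bottom)
next
  case (step r)
  have l: "leaves r c x" "leaves r c' y" using step.prems by (auto simp: leaves_def)
  obtain b b' where b: "1 \<le> b" "b \<le> n" "1 \<le> b'" "b' \<le> n" "V (Suc r) b = x" "V (Suc r) b' = y"
    "b < b' \<or> b' < b \<and> T (Suc r, b) = Crossing \<and> H (Suc r) (b - 1) = y"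
    using planar[OF \<open>r < n\<close> l] step.prems by (metis less_irrefl not_less_zero)
  from b(7) show ?case
  proof
    assume "b < b'"
    with step.IH[of b b'] b step.prems show ?thesis by (meson Suc_leD)
  next
    assume "b' < b \<and> T (Suc r, b) = Crossing \<and> H (Suc r) (b - 1) = y"
    with b step.hyps show ?thesis
      by (intro exI[of _ r] exI[of _ b]) (auto simp: crosses_at_def)
  qed
qed

text \<open>If the larger label enters a crossing from the left, the two pipes are inverted just
  below it and have crossed before.\<close>

lemma sorted_crossings_if_once:
  assumes once: "\<And>x y r c r' c'. x \<in> {1..n} \<Longrightarrow> y \<in> {1..n} \<Longrightarrow> x \<noteq> y \<Longrightarrow> crosses_at x y r c \<Longrightarrow> crosses_at x y r' c' \<Longrightarrow> r = r'"
  shows sorted_crossings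
  unfolding sorted_crossings_def
proof safe
  fix r c assume rc: "r < n" "1 \<le> c" "c \<le> n" "T (Suc r, c) = Crossing"
  note C = Crossing_labels[OF rc]
  let ?l = "H (Suc r) (c - 1)" and ?v = "V (Suc r) c"
  show "?l < ?v"
  proof (rule ccontr)
    assume "\<not> ?l < ?v"
    with C(6) have less: "?v < ?l" by simp
    obtain b where b: "1 \<le> b" "b < c" "V (Suc r) b = ?l" using C(5) by blast
    obtain r' d where r': "Suc r \<le> r'" "crosses_at ?l ?v r' d"
      using crossed_below[of "Suc r" b c ?l ?v] rc b less C(2) by auto
    have "crosses_at ?l ?v r c" using rc by (simp add: crosses_at_def)
    moreover have "?l \<in> {1..n}" "?v \<in> {1..n}"
      using V_range[of "Suc r" b] V_range[of "Suc r" c] rc b C(1,2) by auto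
    ultimately have "r = r'" using once[of ?l ?v r c r' d] r' less by auto
    with r'(1) show False by simp
  qed
qed

text \<open>Above the lower crossing y stays left of x, since reversing this takes a crossing with y
  horizontal, which is unsorted. A second sorted crossing would need x on the left again.\<close>

lemma once_if_sorted_crossings:
  assumes sorted: sorted_crossings and "x < y" "crosses_at x y r c" "crosses_at x y r' c'"
  shows "r = r' \<and> c = c'"
proof -
  have lv: "H (Suc r) (c - 1) = x \<and> V (Suc r) c = y" if "crosses_at x y r c" for r c
    using that sorted \<open>x < y\<close> unfolding crosses_at_def sorted_crossings_def doubleton_eq_iff
    by (metis less_asym)
  have rows: "\<not> r < r'" if C: "crosses_at x y r c" "crosses_at x y r' c'" for r c r' c'
  proof
    assume "r < r'"
    have rc: "r < n" "1 \<le> c" "c \<le> n" "T (Suc r, c) = Crossing"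
      and rc': "r' < n" "1 \<le> c'" "c' \<le> n" "T (Suc r', c') = Crossing"
      using C by (auto simp: crosses_at_def)
    note C1 = Crossing_labels[OF rc] and C2 = Crossing_labels[OF rc']
    have x0: "x \<noteq> 0" and y0: "y \<noteq> 0" using C1(1,2) lv[OF C(1)] by auto
    have order: "q < p" if "Suc r \<le> s" "1 \<le> p" "p \<le> n" "1 \<le> q" "q \<le> n" "V s p = x" "V s q = y" "s \<le> r'" for s p q
      using that(8,1-7)
    proof (induction arbitrary: p q rule: inc_induct)
      case base
      obtain p' where "c' - 1 < p'" "leaves r' p' x"
        using H_leaves[OF rc'(1) x0, of "c' - 1"] lv[OF C(2)] rc'(3) by (meson diff_le_self le_trans)
      moreover have "leaves r' p x" using base by (simp add: leaves_def)
      ultimately have "c' \<le> p" using leaves_unique[OF rc'(1) _ _ x0] rc' by (metis Suc_leI Suc_pred' less_le_trans zero_less_one)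
      moreover have "q = c'"
        using V_inj[of r' q c'] base rc' C2(3) lv[OF C(2)] y0 by auto
      moreover have "p \<noteq> q" using base \<open>x < y\<close> by auto
      ultimately show ?case by simp
    next
      case (step s)
      show ?case
      proof (rule ccontr)
        assume "\<not> q < p"
        moreover have "p \<noteq> q" using step.prems \<open>x < y\<close> by auto
        ultimately have "p < q" by simp
        have s: "s < n" using step.hyps rc' by simp
        have l: "leaves s p x" "leaves s q y" using step.prems by (auto simp: leaves_def)
        obtain b b' where b: "1 \<le> b" "b \<le> n" "1 \<le> b'" "b' \<le> n" "V (Suc s) b = x" "V (Suc s) b' = y"
          "b < b' \<or> b' < b \<and> T (Suc s, b) = Crossing \<and> H (Suc s) (b - 1) = y"
          using planar[OF s l \<open>p < q\<close> _ x0 y0] \<open>x < y\<close> by (metis less_irrefl)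
        have "b' < b" using step.IH[of b b'] b step.prems by simp
        with b(7) have "T (Suc s, b) = Crossing" "H (Suc s) (b - 1) = y" by auto
        with sorted s b have "y < x" unfolding sorted_crossings_def by metis
        with \<open>x < y\<close> show False by simp
      qed
    qed
    obtain b where "1 \<le> b" "b < c" "V (Suc r) b = x" using C1(5) lv[OF C(1)] by auto
    with order[of "Suc r" b c] rc lv[OF C(1)] \<open>r < r'\<close> show False by auto
  qed
  from assms rows have "r = r'" by (metis linorder_neqE_nat)
  moreover have "c = c'"
    using V_inj[of "Suc r" c c'] lv[OF assms(3)] lv[OF assms(4)] assms(3,4) Crossing_labels(2)[of r c] \<open>r = r'\<close>
    by (auto simp: crosses_at_def)
  ultimately show ?thesis by simp
qed

end

section \<open>Entry columns against exit rows\<close>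

locale bpd_flow_perm = bpd_flow +
  fixes w :: "nat \<Rightarrow> nat"
  assumes w: "w permutes {1..n}" and H_right: "r \<in> {1..n} \<Longrightarrow> H r n = w r"
begin

definition sorted_exits :: bool where
  "sorted_exits \<longleftrightarrow> (\<forall>r c. r < n \<and> 1 \<le> c \<and> c \<le> n \<and> T (Suc r, c) = Crossing \<longrightarrow>
     inv w (V (Suc r) c) < inv w (H (Suc r) (c - 1)))"

lemma w_inv: "w (inv w x) = x" "inv w (w x) = x"
  using permutes_inverses[OF w] by auto

lemma inv_range: "x \<in> {1..n} \<Longrightarrow> inv w x \<in> {1..n}"
  using permutes_in_image[OF permutes_inv[OF w]] by blast

text \<open>A pipe that leaves some row on the right cannot also leave through the top of that
  row.\<close>

lemma exit_above:
  assumes "r \<le> n" "1 \<le> c" "c \<le> n" "V r c = y" "y \<noteq> 0"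
  shows "inv w y \<le> r"
proof (rule ccontr)
  assume "\<not> inv w y \<le> r"
  have y: "y \<in> {1..n}" using V_range[OF assms(1-3)] assms(4,5) by simp
  obtain s where s: "inv w y = Suc s" "r \<le> s" "s < n"
    using \<open>\<not> inv w y \<le> r\<close> inv_range[OF y] by (cases "inv w y") auto
  obtain b where "1 \<le> b" "b \<le> n" "V s b = y"
    using V_present_below[OF s(2) _ assms(2-5)] s(3) by auto
  then have "leaves s b y" by (simp add: leaves_def)
  moreover have "leaves s (Suc n) y"
    using H_right[of "Suc s"] s w_inv(1)[of y] by (simp add: leaves_def)
  ultimately have "b = Suc n" by (rule leaves_unique[OF s(3) _ _ assms(5)])
  with \<open>b \<le> n\<close> show False by simp
qed

lemma exit_leaves:
  assumes "inv w y \<le> Suc r" "r < n" "y \<in> {1..n}"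
  obtains c where "leaves r c y" "c = Suc n \<longleftrightarrow> inv w y = Suc r"
proof -
  obtain s where s: "inv w y = Suc s" "s < n" using inv_range[OF assms(3)] by (cases "inv w y") auto
  have l: "leaves s (Suc n) y"
    using H_right[of "Suc s"] s w_inv(1)[of y] by (simp add: leaves_def)
  show thesis
  proof (cases "s = r")
    case True
    with l s that show thesis by blast
  next
    case False
    obtain b where b: "1 \<le> b" "b \<le> n" "V (Suc s) b = y"
      using leaves_source[OF s(2) l] assms(3) by (metis atLeastAtMost_iff not_one_le_zero)
    then obtain b' where "1 \<le> b'" "b' \<le> n" "V r b' = y"
      using V_present_below[of "Suc s" r b y] False s assms by auto
    then show thesis using False s(1) by (intro that[of b']) (auto simp: leaves_def)
  qed
qed

text \<open>In the row where x leaves on the right, y goes up and lies to its left. If x is left of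
  y further down, they crossed in between with x horizontal, and sortedness gives x < y.\<close>

lemma exit_order:
  assumes sorted: sorted_crossings and less: "inv w y < inv w x" and x: "x \<in> {1..n}" and y: "y \<in> {1..n}"
  shows "inv w x \<le> r \<Longrightarrow> r \<le> n \<Longrightarrow> 1 \<le> p \<Longrightarrow> p < q \<Longrightarrow> q \<le> n \<Longrightarrow> V r p = x \<Longrightarrow> V r q = y \<Longrightarrow> x < y"
proof (induction r arbitrary: p q)
  case 0
  then show ?case using inv_range[OF x] by simp
next
  case (Suc r)
  have xy: "x \<noteq> y" "x \<noteq> 0" "y \<noteq> 0" and r: "r < n" using less x y Suc.prems by auto
  obtain p' where p': "leaves r p' x" "p' = Suc n \<longleftrightarrow> inv w x = Suc r"
    using exit_leaves[OF Suc.prems(1) r x] .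
  obtain q' where q': "leaves r q' y" "q' = Suc n \<longleftrightarrow> inv w y = Suc r"
    using exit_leaves[OF _ r y] less Suc.prems(1) by (metis le_trans less_imp_le)
  have q'n: "1 \<le> q'" "q' \<le> n" "V r q' = y"
    using q' less Suc.prems(1) by (auto simp: leaves_def)
  show ?case
  proof (rule ccontr)
    assume "\<not> x < y"
    have "\<not> p' < q'"
    proof
      assume "p' < q'"
      then have "1 \<le> p'" "V r p' = x" "inv w x \<le> r"
        using p' q'n(2) Suc.prems(1) by (auto simp: leaves_def)
      with Suc.IH[of p' q'] \<open>p' < q'\<close> q'n r \<open>\<not> x < y\<close> show False by simp
    qed
    moreover have "p' \<noteq> q'" using p'(1) q'n xy by (auto simp: leaves_def)
    ultimately have "q' < p'" by simp
    obtain b b' where b: "1 \<le> b" "b \<le> n" "1 \<le> b'" "b' \<le> n" "V (Suc r) b = y" "V (Suc r) b' = x"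
      "b < b' \<or> b' < b \<and> T (Suc r, b) = Crossing \<and> H (Suc r) (b - 1) = x"
      using planar[OF r q'(1) p'(1) \<open>q' < p'\<close>] xy by metis
    have "b = q" "b' = p"
      using V_inj[of "Suc r" b q] V_inj[of "Suc r" b' p] b Suc.prems xy by auto
    with b(7) Suc.prems(4) have "T (Suc r, b) = Crossing" "H (Suc r) (b - 1) = x" by auto
    with sorted r b have "x < y" unfolding sorted_crossings_def by metis
    with \<open>\<not> x < y\<close> show False by simp
  qed
qed

lemma sorted_exits_if_sorted_crossings:
  assumes sorted_crossings
  shows sorted_exits
  unfolding sorted_exits_def
proof safe
  fix r c assume rc: "r < n" "1 \<le> c" "c \<le> n" "T (Suc r, c) = Crossing"
  note C = Crossing_labels[OF rc]
  let ?l = "H (Suc r) (c - 1)" and ?v = "V (Suc r) c"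
  have lv: "?l < ?v" using assms rc unfolding sorted_crossings_def by blast
  obtain b where b: "1 \<le> b" "b < c" "V (Suc r) b = ?l" using C(5) by blast
  have l: "?l \<in> {1..n}" using V_range[of "Suc r" b] b rc C(1) by auto
  have v: "?v \<in> {1..n}" using V_range[of "Suc r" c] rc C(2) by auto
  have ev: "inv w ?v \<le> r"
    using exit_above[of r c ?v] rc C by simp
  obtain c' where c': "c < c'" "leaves r c' ?l"
    using H_leaves[OF rc(1) C(1), of c] rc C(4) by auto
  show "inv w ?v < inv w ?l"
  proof (rule ccontr)
    assume "\<not> inv w ?v < inv w ?l"
    moreover have "inv w ?v \<noteq> inv w ?l"
      using w_inv(1) lv by (metis less_irrefl)
    ultimately have less: "inv w ?l < inv w ?v" by simp
    have "c' \<noteq> Suc n"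
    proof
      assume "c' = Suc n"
      then have "H (Suc r) n = ?l" using c'(2) by (auto simp: leaves_def)
      then have "inv w ?l = Suc r" using H_right[of "Suc r"] rc w_inv(2)[of "Suc r"] by auto
      with less ev show False by simp
    qed
    then have "c' \<le> n" "V r c' = ?l" using c'(2) by (auto simp: leaves_def)
    from exit_order[OF assms less v l ev _ rc(2) c'(1) this(1) C(3) this(2)] rc lv show False by simp
  qed
qed

text \<open>By \<open>crossed_below\<close> an unsorted crossing has a partner in which the same
  pipes exchange roles; the order of exits cannot suit both.\<close>

lemma sorted_crossings_if_sorted_exits:
  assumes sorted_exits
  shows sorted_crossings
  unfolding sorted_crossings_def
proof safe
  fix r c assume rc: "r < n" "1 \<le> c" "c \<le> n" "T (Suc r, c) = Crossing"
  note C = Crossing_labels[OF rc]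
  let ?l = "H (Suc r) (c - 1)" and ?v = "V (Suc r) c"
  obtain b where b: "1 \<le> b" "b < c" "V (Suc r) b = ?l" using C(5) by blast
  show "?l < ?v"
  proof (rule ccontr)
    assume "\<not> ?l < ?v"
    with C(6) have "?v < ?l" by simp
    then obtain r' d where *: "crosses_at ?l ?v r' d" "H (Suc r') (d - 1) = ?v"
      using crossed_below[of "Suc r" b c ?l ?v] rc b C(2) by auto
    then have "V (Suc r') d = ?l" using C(6) by (auto simp: crosses_at_def doubleton_eq_iff)
    with * assms have "inv w ?l < inv w ?v"
      unfolding sorted_exits_def crosses_at_def by metis
    moreover have "inv w ?v < inv w ?l"
      using assms rc unfolding sorted_exits_def by blast
    ultimately show False by simp
  qed
qed

end

subsection \<open>Bumpless pipe dreams as stacks of rows\<close>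

text \<open>Rows are read from right to left.\<close>

primrec rtl :: "(nat \<Rightarrow> 'a) \<Rightarrow> nat \<Rightarrow> 'a list" where
  "rtl f 0 = []"
| "rtl f (Suc c) = f (Suc c) # rtl f c"

lemma rtl_eq_map: "rtl f c = map f (rev [1..<Suc c])"
  by (induction c) auto

lemma length_rtl [simp]: "length (rtl f c) = c"
  by (induction c) auto

lemma rtl_cong: "(\<And>d. 1 \<le> d \<Longrightarrow> d \<le> c \<Longrightarrow> f d = g d) \<Longrightarrow> rtl f c = rtl g c"
  by (induction c) auto

lemma rtl_eq_iff: "rtl f c = rtl g c \<longleftrightarrow> (\<forall>d. 1 \<le> d \<and> d \<le> c \<longrightarrow> f d = g d)"
  by (induction c) (auto simp: le_Suc_eq)

lemma rtl_nth: "length xs = c \<Longrightarrow> rtl (\<lambda>d. xs ! (c - d)) c = xs"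
proof (induction c arbitrary: xs)
  case (Suc c)
  then obtain x ys where xs: "xs = x # ys" "length ys = c" by (cases xs) auto
  have "rtl (\<lambda>d. xs ! (Suc c - d)) c = rtl (\<lambda>d. ys ! (c - d)) c"
    by (rule rtl_cong) (simp add: xs Suc_diff_le)
  with Suc.IH[OF xs(2)] show ?case by (simp add: xs)
qed simp

lemma set_rtl: "set (rtl f c) = f ` {1..c}"
  by (induction c) (auto simp: atLeastAtMostSuc_conv)

lemma Rows_rtl:
  "(rtl x c, rtl t c) \<in> Rows h (rtl b c) \<longleftrightarrow>
    (\<exists>e. e 0 = 0 \<and> e c = h \<and> (\<forall>d. 1 \<le> d \<and> d \<le> c \<longrightarrow> cell (t d) (x d) (e d) (b d) (e (d - 1))))"
proof (induction c arbitrary: h)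
  case 0
  then show ?case by auto
next
  case (Suc c)
  show ?case
  proof
    assume "(rtl x (Suc c), rtl t (Suc c)) \<in> Rows h (rtl b (Suc c))"
    then obtain l where l: "(rtl x c, rtl t c) \<in> Rows l (rtl b c)" "cell (t (Suc c)) (x (Suc c)) h (b (Suc c)) l"
      by (auto elim!: Rows_Cons_cell simp del: Rows.simps)
    then obtain e where e: "e 0 = 0" "e c = l" "\<forall>d. 1 \<le> d \<and> d \<le> c \<longrightarrow> cell (t d) (x d) (e d) (b d) (e (d - 1))"
      using Suc.IH[of l] by blast
    show "\<exists>e. e 0 = 0 \<and> e (Suc c) = h \<and> (\<forall>d. 1 \<le> d \<and> d \<le> Suc c \<longrightarrow> cell (t d) (x d) (e d) (b d) (e (d - 1)))"
      by (rule exI[of _ "e(Suc c := h)"]) (use e l in \<open>auto simp: le_Suc_eq\<close>)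
  next
    assume "\<exists>e. e 0 = 0 \<and> e (Suc c) = h \<and> (\<forall>d. 1 \<le> d \<and> d \<le> Suc c \<longrightarrow> cell (t d) (x d) (e d) (b d) (e (d - 1)))"
    then obtain e where e: "e 0 = 0" "e (Suc c) = h" "\<And>d. 1 \<le> d \<Longrightarrow> d \<le> Suc c \<Longrightarrow> cell (t d) (x d) (e d) (b d) (e (d - 1))"
      by blast
    then have "(rtl x c, rtl t c) \<in> Rows (e c) (rtl b c)"
      unfolding Suc.IH by (intro exI[of _ e]) auto
    from Rows_ConsI[OF this] e(2) e(3)[of "Suc c"]
    show "(rtl x (Suc c), rtl t (Suc c)) \<in> Rows h (rtl b (Suc c))" by simp
  qed
qed

definition rows_of :: "nat \<Rightarrow> (nat \<times> nat \<Rightarrow> tile) \<Rightarrow> nat \<Rightarrow> tile list list" where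
  "rows_of n T r = rtl (\<lambda>\<rho>. rtl (\<lambda>c. T (\<rho>, c)) n) r"

definition labelled :: "nat \<Rightarrow> nat \<Rightarrow> (nat \<times> nat \<Rightarrow> tile) \<Rightarrow> (nat \<Rightarrow> nat \<Rightarrow> nat) \<Rightarrow> (nat \<Rightarrow> nat \<Rightarrow> nat) \<Rightarrow> bool" where
  "labelled n r T x e \<longleftrightarrow> (\<forall>c. 1 \<le> c \<and> c \<le> n \<longrightarrow> x 0 c = 0) \<and>
    (\<forall>\<rho><r. e (Suc \<rho>) 0 = 0 \<and> e (Suc \<rho>) n = Suc \<rho> \<and>
      (\<forall>c. 1 \<le> c \<and> c \<le> n \<longrightarrow> cell (T (Suc \<rho>, c)) (x \<rho> c) (e (Suc \<rho>) c) (x (Suc \<rho>) c) (e (Suc \<rho>) (c - 1))))"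

lemma stacks_rows_of:
  "rows_of n T r \<in> stacks r (rtl b n) \<longleftrightarrow> (\<exists>x e. labelled n r T x e \<and> (\<forall>c. 1 \<le> c \<and> c \<le> n \<longrightarrow> x r c = b c))"
proof (induction r arbitrary: b)
  case 0
  show ?case
  proof
    assume "rows_of n T 0 \<in> stacks 0 (rtl b n)"
    then have "\<forall>c. 1 \<le> c \<and> c \<le> n \<longrightarrow> b c = 0" by (auto simp: set_rtl image_subset_iff split: if_splits)
    then show "\<exists>x e. labelled n 0 T x e \<and> (\<forall>c. 1 \<le> c \<and> c \<le> n \<longrightarrow> x 0 c = b c)"
      by (intro exI[of _ "\<lambda>_. b"]) (auto simp: labelled_def)
  next
    assume "\<exists>x e. labelled n 0 T x e \<and> (\<forall>c. 1 \<le> c \<and> c \<le> n \<longrightarrow> x 0 c = b c)"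
    then show "rows_of n T 0 \<in> stacks 0 (rtl b n)"
      by (auto simp: labelled_def set_rtl rows_of_def)
  qed
next
  case (Suc r)
  let ?t = "\<lambda>c. T (Suc r, c)"
  have R: "rows_of n T (Suc r) = rtl ?t n # rows_of n T r" by (simp add: rows_of_def)
  show ?case
  proof
    assume "rows_of n T (Suc r) \<in> stacks (Suc r) (rtl b n)"
    then obtain \<eta> where \<eta>: "(\<eta>, rtl ?t n) \<in> Rows (Suc r) (rtl b n)" "rows_of n T r \<in> stacks r \<eta>"
      unfolding R by auto
    define y where "y c = \<eta> ! (n - c)" for c
    have y: "\<eta> = rtl y n" using Rows_length[OF \<eta>(1)] rtl_nth[of \<eta> n] by (simp add: y_def[abs_def])
    obtain f where f: "f 0 = 0" "f n = Suc r" "\<forall>d. 1 \<le> d \<and> d \<le> n \<longrightarrow> cell (?t d) (y d) (f d) (b d) (f (d - 1))"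
      using \<eta>(1) unfolding y Rows_rtl by blast
    obtain x e where xe: "labelled n r T x e" "\<forall>c. 1 \<le> c \<and> c \<le> n \<longrightarrow> x r c = y c"
      using \<eta>(2) unfolding y Suc.IH by blast
    show "\<exists>x e. labelled n (Suc r) T x e \<and> (\<forall>c. 1 \<le> c \<and> c \<le> n \<longrightarrow> x (Suc r) c = b c)"
      by (rule exI[of _ "x(Suc r := b)"], rule exI[of _ "e(Suc r := f)"])
        (use xe f in \<open>auto simp: labelled_def less_Suc_eq\<close>)
  next
    assume "\<exists>x e. labelled n (Suc r) T x e \<and> (\<forall>c. 1 \<le> c \<and> c \<le> n \<longrightarrow> x (Suc r) c = b c)"
    then obtain x e where xe: "labelled n (Suc r) T x e" "\<forall>c. 1 \<le> c \<and> c \<le> n \<longrightarrow> x (Suc r) c = b c" by blast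
    have "rows_of n T r \<in> stacks r (rtl (x r) n)"
      unfolding Suc.IH by (rule exI[of _ x], rule exI[of _ e]) (use xe in \<open>auto simp: labelled_def\<close>)
    moreover have "(rtl (x r) n, rtl ?t n) \<in> Rows (Suc r) (rtl b n)"
      unfolding Rows_rtl by (rule exI[of _ "e (Suc r)"]) (use xe in \<open>auto simp: labelled_def\<close>)
    ultimately show "rows_of n T (Suc r) \<in> stacks (Suc r) (rtl b n)"
      unfolding R by force
  qed
qed

lemma stacks_lengths: "R \<in> stacks r \<xi> \<Longrightarrow> ts \<in> set R \<Longrightarrow> length ts = length \<xi>"
proof (induction r arbitrary: R \<xi>)
  case (Suc r)
  then obtain \<eta> us R' where "(\<eta>, us) \<in> Rows (Suc r) \<xi>" "R' \<in> stacks r \<eta>" "R = us # R'" by auto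
  with Suc Rows_length show ?case by fastforce
qed (auto split: if_splits)

lemma stacks_surj:
  assumes "R \<in> stacks n (rtl b n)"
  obtains T where "T \<in> extensional (grid n)" "rows_of n T n = R"
proof
  let ?T = "restrict (\<lambda>(r, c). R ! (n - r) ! (n - c)) (grid n)"
  show "?T \<in> extensional (grid n)" by simp
  have "rows_of n ?T n = rtl (\<lambda>r. R ! (n - r)) n"
    unfolding rows_of_def
  proof (rule rtl_cong)
    fix r assume r: "1 \<le> r" "r \<le> n"
    then have "length (R ! (n - r)) = n"
      using stacks_lengths[OF assms, of "R ! (n - r)"] length_stacks[OF assms] by simp
    then have "rtl (\<lambda>c. R ! (n - r) ! (n - c)) n = R ! (n - r)" by (rule rtl_nth)
    moreover have "rtl (\<lambda>c. ?T (r, c)) n = rtl (\<lambda>c. R ! (n - r) ! (n - c)) n"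
      by (rule rtl_cong) (use r in \<open>auto simp: grid_def\<close>)
    ultimately show "rtl (\<lambda>c. ?T (r, c)) n = R ! (n - r)" by simp
  qed
  also have "\<dots> = R" by (rule rtl_nth) (rule length_stacks[OF assms])
  finally show "rows_of n ?T n = R" .
qed

lemma rows_of_inject:
  assumes "rows_of n T n = rows_of n T' n" "T \<in> extensional (grid n)" "T' \<in> extensional (grid n)"
  shows "T = T'"
proof (rule extensionalityI[OF assms(2,3)])
  fix p assume "p \<in> grid n"
  then show "T p = T' p"
    using assms(1) unfolding rows_of_def rtl_eq_iff by (auto simp: grid_def)
qed

definition bpd_tiles :: "tile set" where
  "bpd_tiles = {Elbow_BR, Elbow_TL, Horizontal, Vertical, Crossing, Blank}"

lemma straight_cell_exit:
  "t \<in> bpd_tiles \<Longrightarrow> b \<noteq> 0 \<longleftrightarrow> Bottom \<in> tile_edges t \<Longrightarrow> l \<noteq> 0 \<longleftrightarrow> Left \<in> tile_edges t \<Longrightarrow>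
    straight_cell t (fst (tile_exit go_straight t (l, b))) (snd (tile_exit go_straight t (l, b))) b l"
  by (cases t) (auto simp: straight_cell_def bpd_tiles_def go_straight_def)

lemma straight_cell_edges:
  assumes "straight_cell t x h b l"
  shows "Top \<in> tile_edges t \<longleftrightarrow> x \<noteq> 0" "Right \<in> tile_edges t \<longleftrightarrow> h \<noteq> 0"
    "Bottom \<in> tile_edges t \<longleftrightarrow> b \<noteq> 0" "Left \<in> tile_edges t \<longleftrightarrow> l \<noteq> 0"
  using assms by (auto simp: straight_cell_def)

lemma cell_relabel:
  assumes "straight_cell t x h b l" "t = Crossing \<Longrightarrow> g b < g h" "\<And>y. g y = 0 \<longleftrightarrow> y = 0"
  shows "cell t (g x) (g h) (g b) (g l)"
  using assms(1,2) unfolding cell_def straight_cell_def by (elim disjE conjE) (simp_all add: assms(3))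

text \<open>For positive n, row 0 gives the labels at the top boundary, because the recursion then
  reads the vertical exits of row 1.\<close>

definition bpd_V :: "nat \<Rightarrow> (nat \<times> nat \<Rightarrow> tile) \<Rightarrow> nat \<Rightarrow> nat \<Rightarrow> nat" where
  "bpd_V n T r c = snd (bpd_in go_straight n T r c)"

definition bpd_H :: "nat \<Rightarrow> (nat \<times> nat \<Rightarrow> tile) \<Rightarrow> nat \<Rightarrow> nat \<Rightarrow> nat" where
  "bpd_H n T r c = fst (bpd_in go_straight n T r (Suc c))"

lemma bpd_in_eq: "1 \<le> c \<Longrightarrow> bpd_in go_straight n T r c = (bpd_H n T r (c - 1), bpd_V n T r c)"
  by (simp add: bpd_H_def bpd_V_def)

lemma bpd_H_0 [simp]: "bpd_H n T r 0 = 0"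
  unfolding bpd_H_def by (subst bpd_in.simps) simp

lemma bpd_V_n [simp]: "bpd_V n T n c = c"
  unfolding bpd_V_def by (subst bpd_in.simps) simp

lemma bpd_H_rec: "1 \<le> c \<Longrightarrow> bpd_H n T r c = snd (tile_exit go_straight (T (r, c)) (bpd_H n T r (c - 1), bpd_V n T r c))"
  unfolding bpd_in_eq[symmetric] unfolding bpd_H_def by (subst bpd_in.simps) simp

lemma bpd_V_rec:
  "r < n \<Longrightarrow> 1 \<le> c \<Longrightarrow> bpd_V n T r c = fst (tile_exit go_straight (T (Suc r, c)) (bpd_H n T (Suc r) (c - 1), bpd_V n T (Suc r) c))"
  unfolding bpd_in_eq[symmetric] unfolding bpd_V_def by (subst bpd_in.simps) simp

lemma is_bpd_tiles: "is_bpd n T \<Longrightarrow> p \<in> grid n \<Longrightarrow> T p \<in> bpd_tiles"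
  unfolding is_bpd_def bpd_tiles_def by (meson PiE_mem)

lemma bpd_edges:
  assumes "is_bpd n T"
  shows "1 \<le> r \<Longrightarrow> r \<le> n \<Longrightarrow> 1 \<le> c \<Longrightarrow> c \<le> n \<Longrightarrow>
    (bpd_V n T r c \<noteq> 0 \<longleftrightarrow> Bottom \<in> tile_edges (T (r, c))) \<and> (bpd_H n T r (c - 1) \<noteq> 0 \<longleftrightarrow> Left \<in> tile_edges (T (r, c)))"
proof (induction "n - r + c" arbitrary: r c rule: less_induct)
  case less
  have match: "pipes_match n T" and bot: "\<And>c. c \<in> {1..n} \<Longrightarrow> Bottom \<in> tile_edges (T (n, c))"
    using assms by (auto simp: is_bpd_def)
  have sc: "straight_cell (T (r', c')) (fst (tile_exit go_straight (T (r', c')) (bpd_H n T r' (c' - 1), bpd_V n T r' c')))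
      (snd (tile_exit go_straight (T (r', c')) (bpd_H n T r' (c' - 1), bpd_V n T r' c'))) (bpd_V n T r' c') (bpd_H n T r' (c' - 1))"
    if "n - r' + c' < n - r + c" "1 \<le> r'" "r' \<le> n" "1 \<le> c'" "c' \<le> n" for r' c'
    by (rule straight_cell_exit) (use less.hyps[OF that] is_bpd_tiles[OF assms, of "(r', c')"] that in \<open>auto simp: grid_def\<close>)
  have "bpd_V n T r c \<noteq> 0 \<longleftrightarrow> Bottom \<in> tile_edges (T (r, c))"
  proof (cases "r = n")
    case True
    then show ?thesis using bot[of c] less.prems by simp
  next
    case False
    then have "r < n" using less.prems by simp
    then have "Bottom \<in> tile_edges (T (r, c)) \<longleftrightarrow> Top \<in> tile_edges (T (Suc r, c))"
      using match less.prems unfolding pipes_match_def by auto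
    with straight_cell_edges(1)[OF sc[of "Suc r" c]] \<open>r < n\<close> less.prems bpd_V_rec[of r n c T]
    show ?thesis by auto
  qed
  moreover have "bpd_H n T r (c - 1) \<noteq> 0 \<longleftrightarrow> Left \<in> tile_edges (T (r, c))"
  proof (cases "c = 1")
    case True
    then show ?thesis using match less.prems unfolding pipes_match_def by auto
  next
    case False
    then obtain d where d: "c = Suc d" "1 \<le> d" using less.prems by (cases c) auto
    then have "Right \<in> tile_edges (T (r, d)) \<longleftrightarrow> Left \<in> tile_edges (T (r, c))"
      using match less.prems unfolding pipes_match_def by auto
    with straight_cell_edges(2)[OF sc[of r d]] d less.prems bpd_H_rec[of d n T r]
    show ?thesis by auto
  qed
  ultimately show ?case ..
qed

lemma bpd_flow:
  assumes "is_bpd n T"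
  shows "bpd_flow n T (bpd_V n T) (bpd_H n T)"
proof
  fix r c assume rc: "r < n" "1 \<le> c" "c \<le> n"
  show *: "straight_cell (T (Suc r, c)) (bpd_V n T r c) (bpd_H n T (Suc r) c) (bpd_V n T (Suc r) c) (bpd_H n T (Suc r) (c - 1))"
    unfolding bpd_V_rec[OF rc(1,2)] bpd_H_rec[OF rc(2), of n T "Suc r"]
    by (rule straight_cell_exit) (use bpd_edges[OF assms, of "Suc r" c] is_bpd_tiles[OF assms, of "(Suc r, c)"] rc in \<open>auto simp: grid_def\<close>)
next
  fix c assume c: "1 \<le> c" "c \<le> n"
  then have n: "0 < n" by simp
  have "straight_cell (T (Suc 0, c)) (bpd_V n T 0 c) (bpd_H n T (Suc 0) c) (bpd_V n T (Suc 0) c) (bpd_H n T (Suc 0) (c - 1))"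
    unfolding bpd_V_rec[OF n c(1)] bpd_H_rec[OF c(1), of n T "Suc 0"]
    by (rule straight_cell_exit) (use bpd_edges[OF assms, of 1 c] is_bpd_tiles[OF assms, of "(1, c)"] c n in \<open>auto simp: grid_def\<close>)
  from straight_cell_edges(1)[OF this] show "bpd_V n T 0 c = 0"
    using assms c by (auto simp: is_bpd_def)
qed auto

lemma crosses_at_iff:
  assumes "is_bpd n T"
  shows "bpd_flow.crosses_at n T (bpd_V n T) (bpd_H n T) x y r c \<longleftrightarrow> r < n \<and> (Suc r, c) \<in> crossings n T x y"
proof -
  interpret bpd_flow n T "bpd_V n T" "bpd_H n T" by (rule bpd_flow[OF assms])
  show ?thesis
    unfolding crosses_at_def crossings_def
    by (auto simp: grid_def bpd_in_eq doubleton_eq_iff)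
qed

lemma reduced_iff:
  assumes "is_bpd n T"
  shows "reduced n T \<longleftrightarrow> bpd_flow.sorted_crossings n T (bpd_V n T) (bpd_H n T)"
proof -
  interpret bpd_flow n T "bpd_V n T" "bpd_H n T" by (rule bpd_flow[OF assms])
  note cross = crosses_at_iff[OF assms]
  have fin: "finite (crossings n T x y)" for x y
    by (rule finite_subset[of _ "grid n"]) (auto simp: crossings_def grid_def)
  show ?thesis
  proof
    assume red: "reduced n T"
    show sorted_crossings
    proof (rule sorted_crossings_if_once)
      fix x y r c r' c'
      assume xy: "x \<in> {1..n}" "y \<in> {1..n}" "x \<noteq> y" and C: "crosses_at x y r c" "crosses_at x y r' c'"
      have "card (crossings n T x y) \<le> 1"
        using red xy unfolding reduced_def by blast
      then have one: "\<forall>p\<in>crossings n T x y. \<forall>q\<in>crossings n T x y. p = q"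
        unfolding One_nat_def card_le_Suc0_iff_eq[OF fin] .
      have "(Suc r, c) \<in> crossings n T x y" "(Suc r', c') \<in> crossings n T x y"
        using C unfolding cross by auto
      then have "(Suc r, c) = (Suc r', c')"
        by (rule one[THEN bspec, THEN bspec])
      then show "r = r'" by simp
    qed
  next
    assume sorted: sorted_crossings
    have sub: "card (crossings n T x y) \<le> 1" if "x < y" for x y
    proof -
      have "p = q" if pq: "p \<in> crossings n T x y" "q \<in> crossings n T x y" for p q
      proof -
        have "\<exists>r c. p = (Suc r, c) \<and> r < n" if "p \<in> crossings n T x y" for p
        proof -
          obtain a c where p: "p = (a, c)" by fastforce
          then have "1 \<le> a" "a \<le> n"
            using that by (auto simp: crossings_def grid_def)
          with p show ?thesis by (cases a) auto
        qed
        then obtain r c r' c' where p: "p = (Suc r, c)" "r < n" and q: "q = (Suc r', c')" "r' < n"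
          using pq by metis
        have "crosses_at x y r c" "crosses_at x y r' c'"
          using pq p q unfolding cross by auto
        from once_if_sorted_crossings[OF sorted \<open>x < y\<close> this] show ?thesis using p q by simp
      qed
      then show ?thesis unfolding One_nat_def card_le_Suc0_iff_eq[OF fin] by blast
    qed
    have "crossings n T x y = crossings n T y x" for x y
      by (auto simp: crossings_def)
    with sub show "reduced n T"
      unfolding reduced_def by (metis linorder_neqE_nat)
  qed
qed

text \<open>At a sorted crossing maximum and minimum are the labels of the pipes going straight, so
  the two rules agree.\<close>

lemma bpd_in_sort:
  assumes "is_bpd n T" "bpd_flow.sorted_crossings n T (bpd_V n T) (bpd_H n T)"
  shows "1 \<le> r \<Longrightarrow> r \<le> n \<Longrightarrow> 1 \<le> c \<Longrightarrow> c \<le> n \<Longrightarrow> bpd_in sort_labels n T r c = bpd_in go_straight n T r c \<and>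
    tile_exit sort_labels (T (r, c)) (bpd_in sort_labels n T r c) = tile_exit go_straight (T (r, c)) (bpd_in go_straight n T r c)"
proof (induction "n - r + c" arbitrary: r c rule: less_induct)
  case less
  interpret bpd_flow n T "bpd_V n T" "bpd_H n T" by (rule bpd_flow[OF assms(1)])
  have "tile_exit sort_labels (T (Suc r, c)) (bpd_in sort_labels n T (Suc r) c)
      = tile_exit go_straight (T (Suc r, c)) (bpd_in go_straight n T (Suc r) c)" if "r < n"
    by (rule less.hyps[THEN conjunct2]) (use less.prems that in auto)
  moreover have "tile_exit sort_labels (T (r, c - 1)) (bpd_in sort_labels n T r (c - 1))
      = tile_exit go_straight (T (r, c - 1)) (bpd_in go_straight n T r (c - 1))" if "1 < c"
    by (rule less.hyps[THEN conjunct2]) (use less.prems that in auto)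
  ultimately have "bpd_in sort_labels n T r c = bpd_in go_straight n T r c"
    by (subst (1 2) bpd_in.simps) auto
  moreover have "tile_exit sort_labels (T (r, c)) (bpd_in go_straight n T r c) = tile_exit go_straight (T (r, c)) (bpd_in go_straight n T r c)"
  proof (cases "T (r, c) = Crossing")
    case True
    obtain s where s: "r = Suc s" using less.prems by (cases r) auto
    then have "bpd_H n T r (c - 1) < bpd_V n T r c"
      using assms(2) True less.prems unfolding sorted_crossings_def by auto
    then show ?thesis
      unfolding True bpd_in_eq[OF less.prems(3)] by (simp add: sort_labels_def go_straight_def)
  next
    case False
    then show ?thesis by (cases "T (r, c)") auto
  qed
  ultimately show ?case by simp
qed

lemma bpd_perm_eq:
  assumes "is_bpd n T" "bpd_flow.sorted_crossings n T (bpd_V n T) (bpd_H n T)" "r \<in> {1..n}"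
  shows "bpd_perm n T r = bpd_H n T r n"
proof -
  have r: "1 \<le> r" "r \<le> n" "1 \<le> n" using assms(3) by auto
  have "bpd_perm n T r = snd (tile_exit sort_labels (T (r, n)) (bpd_in sort_labels n T r n))"
    using assms(3) by (simp add: bpd_perm_def)
  also have "\<dots> = bpd_H n T r n"
    using bpd_in_sort[OF assms(1,2) r(1,2) r(3) order_refl, THEN conjunct2]
    unfolding bpd_H_rec[OF r(3)] bpd_in_eq[OF r(3), symmetric] by simp
  finally show ?thesis .
qed

text \<open>Composing the entry labels with \<open>inv w\<close> names pipes by exit rows, and
  sorted exits become the condition \<open>b < h\<close> of \<open>cell\<close>.\<close>

lemma labelled_if_BPD:
  assumes T: "T \<in> BPD n w" and w: "w permutes {1..n}"
  shows "\<exists>x e. labelled n n T x e \<and> (\<forall>c. 1 \<le> c \<and> c \<le> n \<longrightarrow> x n c = inv w c)"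
proof -
  have bpd: "is_bpd n T" and "reduced n T" and perm: "bpd_perm n T = w"
    using T by (auto simp: BPD_def)
  interpret bpd_flow n T "bpd_V n T" "bpd_H n T" by (rule bpd_flow[OF bpd])
  have sorted: sorted_crossings
    using \<open>reduced n T\<close> reduced_iff[OF bpd] by simp
  interpret bpd_flow_perm n T "bpd_V n T" "bpd_H n T" w
    by unfold_locales (use w bpd_perm_eq[OF bpd sorted] perm in auto)
  have exits: sorted_exits by (rule sorted_exits_if_sorted_crossings[OF sorted])
  \<comment> \<open>Relabelling keeps the mark 0 of an empty edge.\<close>
  have inv_0: "inv w 0 = 0" using permutes_not_in[OF permutes_inv[OF w]] by simp
  have inv_eq_0: "inv w y = 0 \<longleftrightarrow> y = 0" for y
    using inv_0 w_inv(1) by metis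
  show ?thesis
  proof (intro exI conjI allI impI)
    show "labelled n n T (\<lambda>r c. inv w (bpd_V n T r c)) (\<lambda>r c. inv w (bpd_H n T r c))"
      unfolding labelled_def
    proof (intro conjI allI impI)
      fix r c assume "r < n" "1 \<le> c \<and> c \<le> n"
      then have rc: "r < n" "1 \<le> c" "c \<le> n" by auto
      show "cell (T (Suc r, c)) (inv w (bpd_V n T r c)) (inv w (bpd_H n T (Suc r) c)) (inv w (bpd_V n T (Suc r) c)) (inv w (bpd_H n T (Suc r) (c - 1)))"
      proof -
        have "inv w (bpd_V n T (Suc r) c) < inv w (bpd_H n T (Suc r) c)" if "T (Suc r, c) = Crossing"
          using exits rc that Crossing_labels(4)[OF rc that] unfolding sorted_exits_def by auto
        then show ?thesis
          by (rule cell_relabel[OF cell[OF rc] _ inv_eq_0])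
      qed
    next
      fix r assume "r < n"
      then show "inv w (bpd_H n T (Suc r) n) = Suc r"
        using H_right[of "Suc r"] w_inv(2) by simp
    qed (auto simp: inv_0 V_top)
  qed simp
qed

text \<open>The labels force neighbouring tiles to match, and from the bottom row on they coincide
  with the relabelled pipes; their order at crossings then yields reducedness.\<close>

lemma BPD_if_labelled:
  assumes L: "labelled n n T x e" and w: "w permutes {1..n}" and ext: "T \<in> extensional (grid n)"
    and x: "\<And>c. 1 \<le> c \<Longrightarrow> c \<le> n \<Longrightarrow> x n c = inv w c"
  shows "T \<in> BPD n w"
proof -
  have w_inv: "w (inv w y) = y" "inv w (w y) = y" for y
    using permutes_inverses[OF w] by auto
  have inv_0: "inv w 0 = 0" using permutes_not_in[OF permutes_inv[OF w]] by simp
  have inv_eq_0: "inv w y = 0 \<longleftrightarrow> y = 0" for y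
    using inv_0 w_inv(1) by metis
  have cellL: "cell (T (Suc r, c)) (x r c) (e (Suc r) c) (x (Suc r) c) (e (Suc r) (c - 1))"
    if "r < n" "1 \<le> c" "c \<le> n" for r c
    using L that by (auto simp: labelled_def)
  have e: "e (Suc r) 0 = 0" "e (Suc r) n = Suc r" if "r < n" for r
    using L that by (auto simp: labelled_def)
  have sc: "straight_cell (T (r, c)) (x (r - 1) c) (e r c) (x r c) (e r (c - 1))"
    if "1 \<le> r" "r \<le> n" "1 \<le> c" "c \<le> n" for r c
    using cellL[of "r - 1" c] that by (simp add: cell_def)
  note edges = straight_cell_edges[OF sc]
  have bpd: "is_bpd n T"
    unfolding is_bpd_def
  proof (intro conjI ballI)
    show "T \<in> grid n \<rightarrow>\<^sub>E {Elbow_BR, Elbow_TL, Horizontal, Vertical, Crossing, Blank}"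
    proof (rule PiE_I)
      fix p assume "p \<in> grid n"
      then obtain r c where "p = (r, c)" "1 \<le> r" "r \<le> n" "1 \<le> c" "c \<le> n" by (auto simp: grid_def)
      with sc[of r c] show "T p \<in> {Elbow_BR, Elbow_TL, Horizontal, Vertical, Crossing, Blank}"
        by (auto simp: straight_cell_def)
    next
      fix p assume "p \<notin> grid n"
      then show "T p = undefined" using ext by (rule extensional_arb[rotated])
    qed
    show "pipes_match n T"
      unfolding pipes_match_def
    proof (intro conjI ballI)
      fix r c assume rc: "r \<in> {1..n}" "c \<in> {1..<n}"
      then show "Right \<in> tile_edges (T (r, c)) \<longleftrightarrow> Left \<in> tile_edges (T (r, c + 1))"
        using edges(2)[of r c] edges(4)[of r "c + 1"] by simp
    next
      fix r c assume rc: "r \<in> {1..<n}" "c \<in> {1..n}"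
      then show "Bottom \<in> tile_edges (T (r, c)) \<longleftrightarrow> Top \<in> tile_edges (T (r + 1, c))"
        using edges(3)[of r c] edges(1)[of "r + 1" c] by simp
    next
      fix r assume r: "r \<in> {1..n}"
      then obtain s where s: "r = Suc s" "s < n" by (cases r) auto
      show "Left \<notin> tile_edges (T (r, 1))"
        using edges(4)[of r 1] e(1)[OF s(2)] s by simp
      show "Right \<in> tile_edges (T (r, n))"
        using edges(2)[of r n] e(2)[OF s(2)] s by simp
    qed
    fix c assume c: "c \<in> {1..n}"
    show "Top \<notin> tile_edges (T (1, c))"
      using edges(1)[of 1 c] c L by (auto simp: labelled_def)
    show "Bottom \<in> tile_edges (T (n, c))"
      using edges(3)[of n c] x[of c] c inv_eq_0[of c] by auto
  qed
  interpret bpd_flow n T "bpd_V n T" "bpd_H n T" by (rule bpd_flow[OF bpd])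
  have out: "x r c = inv w (bpd_V n T r c) \<and> e (Suc r) c = inv w (bpd_H n T (Suc r) c)"
    if "r < n" "1 \<le> c" "c \<le> n" "x (Suc r) c = inv w (bpd_V n T (Suc r) c)" "e (Suc r) (c - 1) = inv w (bpd_H n T (Suc r) (c - 1))" for r c
    using sc[of "Suc r" c] cell[of r c] that inv_0 by (auto simp: straight_cell_def)
  have lab: "x r c = inv w (bpd_V n T r c) \<and> e r (c - 1) = inv w (bpd_H n T r (c - 1))"
    if "1 \<le> r" "r \<le> n" "1 \<le> c" "c \<le> n" for r c
    using that
  proof (induction "n - r + c" arbitrary: r c rule: less_induct)
    case less
    have "x r c = inv w (bpd_V n T r c)"
    proof (cases "r = n")
      case True
      then show ?thesis using x less.prems by simp
    next
      case False
      then show ?thesis using out[of r c] less.hyps[of "Suc r" c] less.prems by auto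
    qed
    moreover have "e r (c - 1) = inv w (bpd_H n T r (c - 1))"
    proof (cases "c = 1")
      case True
      then show ?thesis using e(1)[of "r - 1"] less.prems inv_0 by simp
    next
      case False
      then show ?thesis using out[of "r - 1" "c - 1"] less.hyps[of r "c - 1"] less.prems by auto
    qed
    ultimately show ?case ..
  qed
  have right: "bpd_H n T r n = w r" if r: "r \<in> {1..n}" for r
  proof -
    obtain s where s: "r = Suc s" "s < n" using r by (cases r) auto
    have "e r n = inv w (bpd_H n T r n)"
      using out[of s n] lab[of r n] s r by auto
    then show ?thesis using e(2)[OF s(2)] s w_inv(1) by metis
  qed
  interpret bpd_flow_perm n T "bpd_V n T" "bpd_H n T" w
    by unfold_locales (use w right in auto)
  have sorted_exits
    unfolding sorted_exits_def
  proof (intro allI impI)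
    fix r c assume "r < n \<and> 1 \<le> c \<and> c \<le> n \<and> T (Suc r, c) = Crossing"
    then show "inv w (bpd_V n T (Suc r) c) < inv w (bpd_H n T (Suc r) (c - 1))"
      using cellL[of r c] lab[of "Suc r" c] by (auto simp: cell_def straight_cell_def)
  qed
  then have sorted: sorted_crossings by (rule sorted_crossings_if_sorted_exits)
  moreover have "bpd_perm n T = w"
  proof
    fix r
    show "bpd_perm n T r = w r"
    proof (cases "r \<in> {1..n}")
      case True
      then show ?thesis using bpd_perm_eq[OF bpd sorted True] right[OF True] by simp
    next
      case False
      then show ?thesis using permutes_not_in[OF w False] by (auto simp: bpd_perm_def)
    qed
  qed
  ultimately show ?thesis using bpd reduced_iff[OF bpd] by (simp add: BPD_def)
qed

theorem bij_betw_rows_of: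
  assumes w: "w permutes {1..n}"
  shows "bij_betw (\<lambda>T. rows_of n T n) (BPD n w) (stacks n (rtl (inv w) n))"
proof (rule bij_betw_imageI)
  have ext: "T \<in> extensional (grid n)" if "T \<in> BPD n w" for T
    using that by (auto simp: BPD_def is_bpd_def PiE_def)
  show "inj_on (\<lambda>T. rows_of n T n) (BPD n w)"
    by (rule inj_onI) (use rows_of_inject ext in blast)
  show "(\<lambda>T. rows_of n T n) ` BPD n w = stacks n (rtl (inv w) n)"
  proof (intro equalityI subsetI)
    fix R assume "R \<in> (\<lambda>T. rows_of n T n) ` BPD n w"
    then show "R \<in> stacks n (rtl (inv w) n)"
      using labelled_if_BPD[OF _ w] by (auto simp: stacks_rows_of)
  next
    fix R assume R: "R \<in> stacks n (rtl (inv w) n)"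
    obtain T where T: "T \<in> extensional (grid n)" "rows_of n T n = R"
      using stacks_surj[OF R] .
    with R obtain x e where "labelled n n T x e" "\<forall>c. 1 \<le> c \<and> c \<le> n \<longrightarrow> x n c = inv w c"
      unfolding T(2)[symmetric] stacks_rows_of by blast
    with BPD_if_labelled[OF _ w T(1)] have "T \<in> BPD n w" by blast
    with T(2) show "R \<in> (\<lambda>T. rows_of n T n) ` BPD n w" by blast
  qed
qed

subsection \<open>Labels of the dual co-BPD\<close>

definition word_perm :: "nat list \<Rightarrow> nat \<Rightarrow> nat" where
  "word_perm xs i = (if 1 \<le> i \<and> i \<le> length xs then xs ! (i - 1) else i)"

lemma sort2_word_perm:
  "sort2 (Suc (length ys)) (word_perm (ys @ a # e # zs)) = word_perm (ys @ min a e # max a e # zs)"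
proof -
  have 1: "word_perm (ys @ a # e # zs) (Suc (length ys)) = a"
    "word_perm (ys @ a # e # zs) (Suc (Suc (length ys))) = e"
    by (auto simp: word_perm_def nth_append)
  have 2: "word_perm (ys @ e # a # zs) = word_perm (ys @ a # e # zs) \<circ> sw (Suc (length ys))"
  proof
    fix i
    consider "i = Suc (length ys)" | "i = Suc (Suc (length ys))" | "i \<noteq> Suc (length ys)" "i \<noteq> Suc (Suc (length ys))"
      by blast
    then show "word_perm (ys @ e # a # zs) i = (word_perm (ys @ a # e # zs) \<circ> sw (Suc (length ys))) i"
      by cases (auto simp: word_perm_def nth_append nth_Cons' transpose_def)
  qed
  show ?thesis
    using 2 by (cases "e < a") (simp_all add: sort2_def 1 min_def max_def not_less)
qed

text \<open>
  \<open>co_V r c\<close> and \<open>co_H r c\<close> are the labels at the bottom and the right edge of the cell \<open>(r, c)\<close>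
  of a co-BPD.
\<close>

definition co_V :: "(nat \<times> nat \<Rightarrow> tile) \<Rightarrow> nat \<Rightarrow> nat \<Rightarrow> nat" where
  "co_V T r c = snd (cobpd_in sort_labels T (Suc r) c)"

definition co_H :: "(nat \<times> nat \<Rightarrow> tile) \<Rightarrow> nat \<Rightarrow> nat \<Rightarrow> nat" where
  "co_H T r c = fst (cobpd_in sort_labels T r (Suc c))"

lemma cobpd_in_eq: "1 \<le> c \<Longrightarrow> cobpd_in sort_labels T (Suc r) c = (co_H T (Suc r) (c - 1), co_V T r c)"
  by (simp add: co_H_def co_V_def)

lemma co_H_0 [simp]: "co_H T r 0 = 0"
  unfolding co_H_def by (subst cobpd_in.simps) simp

lemma co_V_0 [simp]: "co_V T 0 c = c"
  unfolding co_V_def by (subst cobpd_in.simps) simp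

lemma co_H_rec: "1 \<le> c \<Longrightarrow> co_H T (Suc r) c = snd (tile_exit sort_labels (T (Suc r, c)) (co_H T (Suc r) (c - 1), co_V T r c))"
  unfolding cobpd_in_eq[symmetric] unfolding co_H_def by (subst cobpd_in.simps) simp

lemma co_V_rec: "1 \<le> c \<Longrightarrow> co_V T (Suc r) c = fst (tile_exit sort_labels (T (Suc r, c)) (co_H T (Suc r) (c - 1), co_V T r c))"
  unfolding cobpd_in_eq[symmetric] unfolding co_V_def by (subst cobpd_in.simps) simp

text \<open>The tile is that of the BPD, the labels (top, right, bottom, left) those of the dual
  co-BPD: a blank carries a vertical pipe, and a horizontal tile sorts.\<close>

definition co_cell :: "tile \<Rightarrow> nat \<Rightarrow> nat \<Rightarrow> nat \<Rightarrow> nat \<Rightarrow> bool" where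
  "co_cell t a h b l \<longleftrightarrow>
     t = Blank \<and> a = b \<and> a \<noteq> 0 \<and> h = 0 \<and> l = 0 \<or>
     t = Elbow_TL \<and> b = l \<and> l \<noteq> 0 \<and> a = 0 \<and> h = 0 \<or>
     t = Vertical \<and> a = 0 \<and> b = 0 \<and> h = 0 \<and> l = 0 \<or>
     t = Horizontal \<and> a \<noteq> 0 \<and> l \<noteq> 0 \<and> h = min a l \<and> b = max a l \<or>
     t = Elbow_BR \<and> h = a \<and> a \<noteq> 0 \<and> l = 0 \<and> b = 0 \<or>
     t = Crossing \<and> h = l \<and> l \<noteq> 0 \<and> a = 0 \<and> b = 0"

lemma co_cell_exit:
  assumes "t \<in> bpd_tiles" "a \<noteq> 0 \<longleftrightarrow> Top \<notin> tile_edges t" "l \<noteq> 0 \<longleftrightarrow> Left \<in> tile_edges t"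
  shows "co_cell t a (snd (tile_exit sort_labels (check_tile t) (l, a))) (fst (tile_exit sort_labels (check_tile t) (l, a))) l"
  using assms by (cases t) (auto simp: co_cell_def bpd_tiles_def sort_labels_def min.commute max.commute)

lemma co_cell_edges:
  assumes "co_cell t a h b l"
  shows "Right \<in> tile_edges t \<longleftrightarrow> h \<noteq> 0" "Bottom \<notin> tile_edges t \<longleftrightarrow> b \<noteq> 0" "no_top t = (if a = 0 then 0 else 1)"
  using assms by (auto simp: co_cell_def no_top_def)

lemma co_cells:
  assumes "is_bpd n T" "1 \<le> c" "c \<le> n" "r < n"
  shows "co_cell (T (Suc r, c)) (co_V (check n T) r c) (co_H (check n T) (Suc r) c) (co_V (check n T) (Suc r) c) (co_H (check n T) (Suc r) (c - 1))"
  using assms(2-4)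
proof (induction "r + c" arbitrary: r c rule: less_induct)
  case less
  have match: "pipes_match n T" and top: "\<And>c. c \<in> {1..n} \<Longrightarrow> Top \<notin> tile_edges (T (1, c))"
    using assms(1) by (auto simp: is_bpd_def)
  have g: "(Suc r, c) \<in> grid n" using less.prems by (simp add: grid_def)
  have "co_V (check n T) r c \<noteq> 0 \<longleftrightarrow> Top \<notin> tile_edges (T (Suc r, c))"
  proof (cases r)
    case 0
    then show ?thesis using top[of c] less.prems by simp
  next
    case (Suc s)
    have "Bottom \<in> tile_edges (T (Suc s, c)) \<longleftrightarrow> Top \<in> tile_edges (T (Suc r, c))"
      using match less.prems Suc unfolding pipes_match_def by auto
    with co_cell_edges(2)[OF less.hyps[of s c]] less.prems Suc show ?thesis by auto
  qed
  moreover have "co_H (check n T) (Suc r) (c - 1) \<noteq> 0 \<longleftrightarrow> Left \<in> tile_edges (T (Suc r, c))"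
  proof (cases "c = 1")
    case True
    then show ?thesis using match less.prems unfolding pipes_match_def by auto
  next
    case False
    then obtain d where d: "c = Suc d" "1 \<le> d" using less.prems by (cases c) auto
    then have "Right \<in> tile_edges (T (Suc r, d)) \<longleftrightarrow> Left \<in> tile_edges (T (Suc r, c))"
      using match less.prems unfolding pipes_match_def by auto
    with co_cell_edges(1)[OF less.hyps[of r d]] d less.prems show ?thesis by auto
  qed
  moreover have "check n T (Suc r, c) = check_tile (T (Suc r, c))"
    using g by (simp add: check_def)
  ultimately show ?case
    using co_cell_exit[OF is_bpd_tiles[OF assms(1) g]] co_V_rec[OF less.prems(1)] co_H_rec[OF less.prems(1)] by simp
qed

definition upper :: "(nat \<Rightarrow> 'a) \<Rightarrow> nat \<Rightarrow> nat \<Rightarrow> 'a list" where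
  "upper f c n = map f (rev [Suc c..<Suc n])"

lemma upper_Suc: "c < n \<Longrightarrow> upper f c n = upper f (Suc c) n @ [f (Suc c)]"
  unfolding upper_def by (subst upt_conv_Cons) auto

lemma upper_n [simp]: "upper f n n = []"
  by (simp add: upper_def)

lemma rtl_upper: "c \<le> n \<Longrightarrow> rtl f n = upper f c n @ rtl f c"
proof (induction c rule: inc_induct)
  case (step c)
  then show ?case by (simp add: upper_Suc)
qed simp

text \<open>The word is the frontier after c columns: pipes already gone, tops not yet reached, the
  pipe on the right edge of column c, bottoms of finished columns. Two pipes about to cross are
  neighbours in it.\<close>

lemma row_sort_word:
  assumes cells: "\<And>c. 1 \<le> c \<Longrightarrow> c \<le> n \<Longrightarrow> co_cell (t c) (a c) (h c) (b c) (h (c - 1))"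
    and "h 0 = 0" "length ex = r"
  shows "c \<le> n \<Longrightarrow> row_sort (Suc r + length (nz (upper a c n))) (rtl t c) (word_perm (ex @ nz (rtl a n)))
    = word_perm (ex @ nz (upper a c n) @ nz [h c] @ nz (rtl b c))"
proof (induction c)
  case 0
  then show ?case using assms(2) rtl_upper[of 0 n a] by simp
next
  case (Suc c)
  let ?c = "Suc c"
  have cell: "co_cell (t ?c) (a ?c) (h ?c) (b ?c) (h c)"
    using cells[of ?c] Suc.prems by simp
  have up: "upper a c n = upper a ?c n @ [a ?c]"
    by (rule upper_Suc) (use Suc.prems in simp)
  have 1: "row_sort (Suc r + length (nz (upper a ?c n)) + no_top (t ?c)) (rtl t c) (word_perm (ex @ nz (rtl a n)))
      = word_perm (ex @ nz (upper a c n) @ nz [h c] @ nz (rtl b c))"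
    using Suc.IH Suc.prems co_cell_edges(3)[OF cell] by (cases "a ?c = 0") (simp_all add: up)
  \<comment> \<open>The index is the position of the top label of column \<open>Suc c\<close>; the
    smaller label goes on to the right and hence comes first.\<close>
  have 2: "sort2 (Suc r + length (nz (upper a ?c n))) (word_perm (ex @ nz (upper a c n) @ nz [h c] @ nz (rtl b c)))
      = word_perm (ex @ nz (upper a ?c n) @ nz [h ?c] @ nz (b ?c # rtl b c))" if "t ?c = Horizontal"
    using sort2_word_perm[of "ex @ nz (upper a ?c n)" "a ?c" "h c" "nz (rtl b c)"] cell that assms(3)
    by (auto simp: co_cell_def up)
  have 3: "ex @ nz (upper a c n) @ nz [h c] @ nz (rtl b c)
      = ex @ nz (upper a ?c n) @ nz [h ?c] @ nz (b ?c # rtl b c)" if "t ?c \<noteq> Horizontal"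
    using cell that by (auto simp: co_cell_def up)
  show ?case
  proof (cases "t ?c = Horizontal")
    case True
    show ?thesis
      unfolding rtl.simps row_sort.simps 1 if_P[OF True] by (rule 2[OF True])
  next
    case False
    show ?thesis
      unfolding rtl.simps row_sort.simps 1 if_not_P[OF False] 3[OF False] ..
  qed
qed

text \<open>Above the first row the frontier is n, ..., 1, the one-line notation of w_0.\<close>

lemma co_perm_rows_of:
  assumes "is_bpd n T"
  shows "r \<le> n \<Longrightarrow> co_perm n (rows_of n T r)
    = word_perm (map (\<lambda>\<rho>. co_H (check n T) \<rho> n) [1..<Suc r] @ nz (rtl (co_V (check n T) r) n))"
proof (induction r)
  case 0
  have "nz (rtl (co_V (check n T) 0) n) = rtl (\<lambda>c. c) n"
  proof -
    have "co_V (check n T) 0 = (\<lambda>c. c)" by auto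
    moreover have "nz (rtl (\<lambda>c. c) m) = rtl (\<lambda>c. c) m" for m :: nat
      by (induction m) auto
    ultimately show ?thesis by simp
  qed
  moreover have "longest_perm n = word_perm (rtl (\<lambda>c. c) n)"
  proof
    fix i
    have "rtl (\<lambda>c. c) m ! j = m - j" if "j < m" for m j :: nat
      using that by (induction m arbitrary: j) (auto simp: nth_Cons')
    then show "longest_perm n i = word_perm (rtl (\<lambda>c. c) n) i"
      by (auto simp: longest_perm_def word_perm_def)
  qed
  ultimately show ?case by (simp add: rows_of_def del: co_V_0)
next
  case (Suc r)
  let ?C = "check n T"
  let ?ex = "map (\<lambda>\<rho>. co_H ?C \<rho> n) [1..<Suc r]"
  have n: "r < n" using Suc.prems by simp
  have right: "co_H ?C (Suc r) n \<noteq> 0"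
  proof -
    have "Right \<in> tile_edges (T (Suc r, n))"
      using assms n by (auto simp: is_bpd_def pipes_match_def)
    with co_cell_edges(1)[OF co_cells[OF assms, of n r]] n show ?thesis by simp
  qed
  have "co_perm n (rows_of n T (Suc r)) = row_sort (Suc r) (rtl (\<lambda>c. T (Suc r, c)) n) (word_perm (?ex @ nz (rtl (co_V ?C r) n)))"
    using Suc by (simp add: rows_of_def)
  also have "\<dots> = word_perm (?ex @ nz [co_H ?C (Suc r) n] @ nz (rtl (co_V ?C (Suc r)) n))"
    using row_sort_word[of n "\<lambda>c. T (Suc r, c)" "co_V ?C r" "co_H ?C (Suc r)" "co_V ?C (Suc r)" ?ex r n]
      co_cells[OF assms _ _ n] by simp
  finally show ?case using right by simp
qed

lemma cobpd_perm_check: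
  assumes "is_bpd n T"
  shows "cobpd_perm n (check n T) = co_perm n (rows_of n T n)"
proof -
  let ?C = "check n T"
  have "co_V ?C n c = 0" if c: "1 \<le> c" "c \<le> n" for c
  proof -
    obtain s where s: "n = Suc s" using c by (cases n) auto
    have "Bottom \<in> tile_edges (T (n, c))"
      using assms c by (auto simp: is_bpd_def)
    with co_cell_edges(2)[OF co_cells[OF assms c, of s]] s show ?thesis by simp
  qed
  then have "rtl (co_V ?C n) n = rtl (\<lambda>_. 0) n" by (intro rtl_cong)
  moreover have "nz (rtl (\<lambda>_. 0) m) = []" for m by (induction m) auto
  ultimately have eq: "co_perm n (rows_of n T n) = word_perm (map (\<lambda>\<rho>. co_H ?C \<rho> n) [1..<Suc n])"
    using co_perm_rows_of[OF assms order_refl] by simp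
  show ?thesis
  proof
    fix r
    show "cobpd_perm n ?C r = co_perm n (rows_of n T n) r"
    proof (cases "r \<in> {1..n}")
      case True
      then obtain s where s: "r = Suc s" by (cases r) auto
      have "snd (tile_exit sort_labels (?C (r, n)) (cobpd_in sort_labels ?C r n)) = co_H ?C r n"
        using co_H_rec[of n ?C s] cobpd_in_eq[of n ?C s] True s by simp
      moreover have "map (\<lambda>\<rho>. co_H ?C \<rho> n) [1..<Suc n] ! (r - 1) = co_H ?C r n"
        using True by (subst nth_map_upt) auto
      ultimately show ?thesis
        using True unfolding eq by (simp add: cobpd_perm_def word_perm_def del: upt_Suc)
    next
      case False
      then show ?thesis unfolding eq by (auto simp: cobpd_perm_def word_perm_def)
    qed
  qed
qed

theorem theorem1p2:
  fixes n :: nat and w :: "nat \<Rightarrow> nat"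
  assumes "n \<ge> 1" and "w permutes {1..n}"
  shows "schubert n w = (\<Sum>B\<in>BPD n w. grothendieck n (cobpd_perm n (check n B)))"
proof -
  let ?\<xi> = "rtl (inv w) n"
  have "(\<Sum>B\<in>BPD n w. grothendieck n (cobpd_perm n (check n B)))
      = (\<Sum>B\<in>BPD n w. grothendieck n (co_perm n (rows_of n B n)))"
    by (rule sum.cong) (auto simp: BPD_def cobpd_perm_check)
  also have "\<dots> = (\<Sum>R\<in>stacks n ?\<xi>. grothendieck n (co_perm n R))"
    by (rule sum.reindex_bij_betw[OF bij_betw_rows_of[OF assms(2)]])
  also have "\<dots> = stack_poly n n ?\<xi>"
    using labels_inv(1)[OF assms(2)] by (intro sum_stacks) (simp_all only: length_rtl flip: rtl_eq_map)
  also have "\<dots> = schubert n w"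
    using schubert_eq_stack_poly[OF assms(2)] by (simp only: rtl_eq_map)
  finally show ?thesis by simp
qed

end
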